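(* (1) If $D$ is the closed unit ball of one of the real spaces $\ell_\infty^n$ ($n\in\mathbb{N}$), $c_0$ or $\ell_\infty$, or more generally of a real $\mathcal{L}_{\infty,1}$-space, then $A_D\le 6\cdot 200+2$ and $J_D\le 2\cdot(6\cdot 200+2)$. (2) If $D$ is the closed unit ball of a real Hilbert space, then $A_D\le 6\cdot 37+2$ and $J_D\le 2\cdot(6\cdot 37+2)$.
   Context: For a convex set $D$, a function $f:D\to\mathbb{R}$ is $\varepsilon$-affine if $|f(tx+(1-t)y)-tf(x)-(1-t)f(y)|\le\varepsilon$ for all $x,y\in D$, $t\in[0,1]$ (affine if $\varepsilon=0$), and $\varepsilon$-Jensen if $\left|f\left(\frac{x+y}{2}\right)-\frac{f(x)+f(y)}{2}\right|\le\varepsilon$ for all $x,y\in D$ (Jensen if $\varepsilon=0$). $A_D$ (respectively $J_D$) denotes the least constant $\kappa$ such that for every $\varepsilon$ and every $\varepsilon$-affine (respectively $\varepsilon$-Jensen) function $f:D\to\mathbb{R}$ there is an affine (respectively Jensen) function $g:D\to\mathbb{R}$ with $\sup_{x\in D}|f(x)-g(x)|\le\kappa\varepsilon$. A Banach space $X$ is an $\mathcal{L}_{\infty,1}$-space if for every finite dimensional subspace $F\subset X$ and every $\varepsilon>0$ there is a finite dimensional subspace $E\subset X$ containing $F$ whose Banach-Mazur distance to $\ell_\infty^{\dim E}$ is at most $1+\varepsilon$. *)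

theory Defs
  imports "HOL-Analysis.Analysis"
begin

text \<open>Functions on a convex set \<open>D\<close> are total functions of which only the values on \<open>D\<close> matter.\<close>

definition eps_affine_on :: "'a::real_vector set \<Rightarrow> real \<Rightarrow> ('a \<Rightarrow> real) \<Rightarrow> bool" where
  "eps_affine_on D \<epsilon> f \<longleftrightarrow>
     (\<forall>x\<in>D. \<forall>y\<in>D. \<forall>t\<in>{0..1}.
        \<bar>f (t *\<^sub>R x + (1 - t) *\<^sub>R y) - t * f x - (1 - t) * f y\<bar> \<le> \<epsilon>)"

definition eps_Jensen_on :: "'a::real_vector set \<Rightarrow> real \<Rightarrow> ('a \<Rightarrow> real) \<Rightarrow> bool" where
  "eps_Jensen_on D \<epsilon> f \<longleftrightarrow>
     (\<forall>x\<in>D. \<forall>y\<in>D. \<bar>f (midpoint x y) - (f x + f y) / 2\<bar> \<le> \<epsilon>)"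

definition affine_admissible :: "'a::real_vector set \<Rightarrow> real \<Rightarrow> bool" where
  "affine_admissible D \<kappa> \<longleftrightarrow>
     (\<forall>\<epsilon>\<ge>0. \<forall>f. eps_affine_on D \<epsilon> f \<longrightarrow>
        (\<exists>g. eps_affine_on D 0 g \<and> (SUP x\<in>D. ereal \<bar>f x - g x\<bar>) \<le> ereal (\<kappa> * \<epsilon>)))"

definition Jensen_admissible :: "'a::real_vector set \<Rightarrow> real \<Rightarrow> bool" where
  "Jensen_admissible D \<kappa> \<longleftrightarrow>
     (\<forall>\<epsilon>\<ge>0. \<forall>f. eps_Jensen_on D \<epsilon> f \<longrightarrow>
        (\<exists>g. eps_Jensen_on D 0 g \<and> (SUP x\<in>D. ereal \<bar>f x - g x\<bar>) \<le> ereal (\<kappa> * \<epsilon>)))"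

text \<open>The least admissible constants \<open>A\<^sub>D\<close> and \<open>J\<^sub>D\<close>; the value is \<open>\<infinity>\<close> if there is
  no admissible constant, and otherwise the infimum is attained (see the lemmas below).\<close>

definition affine_const :: "'a::real_vector set \<Rightarrow> ereal" where
  "affine_const D = Inf (ereal ` {\<kappa>. affine_admissible D \<kappa>})"

definition Jensen_const :: "'a::real_vector set \<Rightarrow> ereal" where
  "Jensen_const D = Inf (ereal ` {\<kappa>. Jensen_admissible D \<kappa>})"

lemma approx_limit:
  fixes f :: "'a \<Rightarrow> real"
  assumes cl: "closed G"
    and restr: "\<And>g h. g \<in> G \<Longrightarrow> (\<And>x. x \<in> D \<Longrightarrow> h x = g x) \<Longrightarrow> h \<in> G"
    and ex: "\<And>d. d > c \<Longrightarrow> \<exists>g\<in>G. \<forall>x\<in>D. \<bar>f x - g x\<bar> \<le> d"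
  shows "\<exists>g\<in>G. \<forall>x\<in>D. \<bar>f x - g x\<bar> \<le> c"
proof -
  define B where "B = Pi\<^sub>E UNIV (\<lambda>x. if x \<in> D then {f x - (c + 1)..f x + (c + 1)} else {0})"
  define C where "C d = G \<inter> (\<Inter>x\<in>D. {g. \<bar>f x - g x\<bar> \<le> d})" for d
  have "compactin (product_topology (\<lambda>_. euclidean) UNIV) B"
    by (simp add: B_def compactin_PiE)
  then have cB: "compact B"
    by (simp only: euclidean_product_topology compactin_euclidean_iff)
  have clC: "closed (C d)" for d
    unfolding C_def
    by (intro closed_Int cl closed_INT ballI closed_Collect_le continuous_on_rabs
        continuous_on_diff continuous_on_const continuous_on_product_coordinates)
  have "B \<inter> (\<Inter>d\<in>{c<..}. C d) \<noteq> {}"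
  proof (rule compact_imp_fip_image[OF cB])
    show "closed (C d)" for d by (rule clC)
    fix I assume I: "finite I" "I \<subseteq> {c<..}"
    define m where "m = Min (insert (c + 1) I)"
    have m: "m > c" "m \<le> c + 1" "\<And>d. d \<in> I \<Longrightarrow> m \<le> d"
      using I by (auto simp: m_def)
    obtain g where g: "g \<in> G" "\<And>x. x \<in> D \<Longrightarrow> \<bar>f x - g x\<bar> \<le> m"
      using ex[OF m(1)] by blast
    define h where "h x = (if x \<in> D then g x else 0)" for x
    have "h \<in> G" by (rule restr[OF g(1)]) (simp add: h_def)
    moreover have le: "\<bar>f x - h x\<bar> \<le> m" if "x \<in> D" for x
      using g(2) that by (simp add: h_def)
    moreover have "h \<in> B"
      unfolding B_def
    proof (rule PiE_I)
      fix x
      show "h x \<in> (if x \<in> D then {f x - (c + 1)..f x + (c + 1)} else {0})"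
        using le[of x] m(2) by (auto simp: h_def abs_le_iff)
    qed simp
    ultimately have "h \<in> B \<inter> (\<Inter>d\<in>I. C d)"
      using m(3) by (fastforce simp: C_def)
    then show "B \<inter> (\<Inter>d\<in>I. C d) \<noteq> {}" by blast
  qed
  then obtain g where g: "\<And>d. d > c \<Longrightarrow> g \<in> C d" by blast
  have "g \<in> G" using g[of "c + 1"] by (simp add: C_def)
  moreover have "\<bar>f x - g x\<bar> \<le> c" if "x \<in> D" for x
  proof (rule dense_ge)
    fix d assume "c < d"
    from g[OF this] that show "\<bar>f x - g x\<bar> \<le> d" by (simp add: C_def)
  qed
  ultimately show ?thesis by blast
qed

lemma Inf_ereal_approx:
  assumes "Inf (ereal ` S) = ereal c" "\<epsilon> > 0" "d > c * \<epsilon>"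
  obtains \<kappa> where "\<kappa> \<in> S" "\<kappa> * \<epsilon> < d"
proof -
  have "Inf (ereal ` S) < ereal (d / \<epsilon>)"
    using assms by (simp add: pos_less_divide_eq)
  then obtain \<kappa> where "\<kappa> \<in> S" "\<kappa> < d / \<epsilon>"
    by (auto simp: Inf_less_iff)
  with assms(2) that show ?thesis by (simp add: pos_less_divide_eq)
qed

lemma convex_fun_restrict:
  assumes "convex D" "eps_affine_on D \<epsilon> g" "\<And>x. x \<in> D \<Longrightarrow> h x = g x"
  shows "eps_affine_on D \<epsilon> h"
  using assms by (auto simp: eps_affine_on_def convexD)

lemma Jensen_fun_restrict:
  assumes "convex D" "eps_Jensen_on D \<epsilon> g" "\<And>x. x \<in> D \<Longrightarrow> h x = g x"
  shows "eps_Jensen_on D \<epsilon> h"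
proof -
  have "midpoint x y \<in> D" if "x \<in> D" "y \<in> D" for x y
    using convexD[OF assms(1) that, of "1/2" "1/2"] by (simp add: midpoint_def scaleR_right_distrib)
  with assms show ?thesis by (auto simp: eps_Jensen_on_def)
qed

lemma closed_eps_affine_on: "closed {g. eps_affine_on D \<epsilon> g}"
proof -
  have "{g. eps_affine_on D \<epsilon> g} = (\<Inter>x\<in>D. \<Inter>y\<in>D. \<Inter>t\<in>{0..1}.
      {g. \<bar>g (t *\<^sub>R x + (1 - t) *\<^sub>R y) - t * g x - (1 - t) * g y\<bar> \<le> \<epsilon>})"
    by (auto simp: eps_affine_on_def)
  moreover have "closed \<dots>"
    by (intro closed_INT ballI closed_Collect_le continuous_on_rabs continuous_on_diff
        continuous_on_mult continuous_on_const continuous_on_product_coordinates)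
  ultimately show ?thesis by simp
qed

lemma closed_eps_Jensen_on: "closed {g. eps_Jensen_on D \<epsilon> g}"
proof -
  have "{g. eps_Jensen_on D \<epsilon> g} =
      (\<Inter>x\<in>D. \<Inter>y\<in>D. {g. \<bar>g (midpoint x y) - (g x + g y) / 2\<bar> \<le> \<epsilon>})"
    by (auto simp: eps_Jensen_on_def)
  moreover have "closed \<dots>"
    by (intro closed_INT ballI closed_Collect_le continuous_on_rabs continuous_on_diff
        continuous_on_divide continuous_on_add continuous_on_const
        continuous_on_product_coordinates) auto
  ultimately show ?thesis by simp
qed

lemma affine_const_attained:
  assumes "convex D" "affine_const D = ereal c"
  shows "affine_admissible D c"
  unfolding affine_admissible_def
proof (intro allI impI)
  fix \<epsilon> f assume \<epsilon>: "0 \<le> \<epsilon>" and f: "eps_affine_on D \<epsilon> f"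
  show "\<exists>g. eps_affine_on D 0 g \<and> (SUP x\<in>D. ereal \<bar>f x - g x\<bar>) \<le> ereal (c * \<epsilon>)"
  proof (cases "\<epsilon> = 0")
    case True
    with f show ?thesis by (intro exI[of _ f]) (auto simp: SUP_le_iff)
  next
    case False
    with \<epsilon> have "\<epsilon> > 0" by simp
    have "\<exists>g\<in>{g. eps_affine_on D 0 g}. \<forall>x\<in>D. \<bar>f x - g x\<bar> \<le> c * \<epsilon>"
    proof (rule approx_limit[OF closed_eps_affine_on])
      show "h \<in> {g. eps_affine_on D 0 g}"
        if "g \<in> {g. eps_affine_on D 0 g}" "\<And>x. x \<in> D \<Longrightarrow> h x = g x" for g h
        using convex_fun_restrict[OF assms(1)] that by blast
    next
      fix d assume "d > c * \<epsilon>"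
      then obtain \<kappa> where "affine_admissible D \<kappa>" "\<kappa> * \<epsilon> < d"
        using Inf_ereal_approx[OF assms(2)[unfolded affine_const_def] \<open>\<epsilon> > 0\<close>] by blast
      then show "\<exists>g\<in>{g. eps_affine_on D 0 g}. \<forall>x\<in>D. \<bar>f x - g x\<bar> \<le> d"
        using \<epsilon> f by (fastforce simp: affine_admissible_def SUP_le_iff)
    qed
    then show ?thesis by (auto simp: SUP_le_iff)
  qed
qed

lemma Jensen_const_attained:
  assumes "convex D" "Jensen_const D = ereal c"
  shows "Jensen_admissible D c"
  unfolding Jensen_admissible_def
proof (intro allI impI)
  fix \<epsilon> f assume \<epsilon>: "0 \<le> \<epsilon>" and f: "eps_Jensen_on D \<epsilon> f"
  show "\<exists>g. eps_Jensen_on D 0 g \<and> (SUP x\<in>D. ereal \<bar>f x - g x\<bar>) \<le> ereal (c * \<epsilon>)"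
  proof (cases "\<epsilon> = 0")
    case True
    with f show ?thesis by (intro exI[of _ f]) (auto simp: SUP_le_iff)
  next
    case False
    with \<epsilon> have "\<epsilon> > 0" by simp
    have "\<exists>g\<in>{g. eps_Jensen_on D 0 g}. \<forall>x\<in>D. \<bar>f x - g x\<bar> \<le> c * \<epsilon>"
    proof (rule approx_limit[OF closed_eps_Jensen_on])
      show "h \<in> {g. eps_Jensen_on D 0 g}"
        if "g \<in> {g. eps_Jensen_on D 0 g}" "\<And>x. x \<in> D \<Longrightarrow> h x = g x" for g h
        using Jensen_fun_restrict[OF assms(1)] that by blast
    next
      fix d assume "d > c * \<epsilon>"
      then obtain \<kappa> where "Jensen_admissible D \<kappa>" "\<kappa> * \<epsilon> < d"
        using Inf_ereal_approx[OF assms(2)[unfolded Jensen_const_def] \<open>\<epsilon> > 0\<close>] by blast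
      then show "\<exists>g\<in>{g. eps_Jensen_on D 0 g}. \<forall>x\<in>D. \<bar>f x - g x\<bar> \<le> d"
        using \<epsilon> f by (fastforce simp: Jensen_admissible_def SUP_le_iff)
    qed
    then show ?thesis by (auto simp: SUP_le_iff)
  qed
qed

text \<open>Banach spaces are represented as closed linear subspaces of types of class \<open>banach\<close>.
  The type \<open>nat \<Rightarrow>\<^sub>C real\<close> of bounded continuous functions on the discrete space \<open>nat\<close>, with the
  supremum norm, is \<open>\<ell>\<^sub>\<infinity>\<close>.\<close>

type_synonym linfty = "nat \<Rightarrow>\<^sub>C real"

instance bcontfun :: (metric_space, banach) banach ..

definition linfty_n :: "nat \<Rightarrow> linfty set" where
  "linfty_n n = {x. \<forall>k\<ge>n. apply_bcontfun x k = 0}"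

definition c_zero :: "linfty set" where
  "c_zero = {x. (\<lambda>k. apply_bcontfun x k) \<longlonglongrightarrow> 0}"

definition closed_unit_ball :: "'a::real_normed_vector set \<Rightarrow> 'a set" where
  "closed_unit_ball X = {x \<in> X. norm x \<le> 1}"

definition onorm_on :: "'a::real_normed_vector set \<Rightarrow> ('a \<Rightarrow> 'b::real_normed_vector) \<Rightarrow> ereal" where
  "onorm_on E T = (SUP x\<in>closed_unit_ball E. ereal (norm (T x)))"

text \<open>Every linear map on a subspace extends to a linear map on the whole type, so it is no
  restriction to let \<open>T\<close> range over globally linear maps that are bijective from \<open>E\<close> to \<open>F\<close>.\<close>

definition banach_mazur ::
    "'a::real_normed_vector set \<Rightarrow> 'b::real_normed_vector set \<Rightarrow> ereal" where
  "banach_mazur E F =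
     (INF T\<in>{T. linear T \<and> bij_betw T E F}. onorm_on E T * onorm_on F (inv_into E T))"

definition fin_dim_subspace :: "'a::real_vector set \<Rightarrow> bool" where
  "fin_dim_subspace E \<longleftrightarrow> (\<exists>B. finite B \<and> E = span B)"

definition Linfty1_space :: "'a::banach set \<Rightarrow> bool" where
  "Linfty1_space X \<longleftrightarrow> subspace X \<and> closed X \<and>
     (\<forall>F \<epsilon>. fin_dim_subspace F \<and> F \<subseteq> X \<and> \<epsilon> > 0 \<longrightarrow>
        (\<exists>E. fin_dim_subspace E \<and> E \<subseteq> X \<and> F \<subseteq> E \<and>
             banach_mazur E (linfty_n (dim E)) \<le> ereal (1 + \<epsilon>)))"

end

theory Submission
  imports Defs
begin

text \<open>Split \<open>f\<close> into its even part, which is \<open>\<epsilon>\<close>-close to \<open>f 0\<close>, and its odd part. If an odd function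
  commutes up to \<open>C\<close> with convex combinations of arbitrarily many points, then it is \<open>C\<close>-close to a
  linear functional by the Hahn--Banach theorem. It therefore suffices to bound the defect of
  convex combinations independently of the number of points.

  On a cube this is the Kalton--Roberts theorem on nearly additive set functions: a family of \<open>4 h\<close>
  sets covering every point equally often is cut up and reassembled along a concentrator graph
  into \<open>3 h\<close> sets, so that the largest possible defect \<open>S\<close> of a family satisfies \<open>S \<le> 3/4 S + const\<close>.
  In a space of type \<open>L\<^sub>\<infinity>\<close>, finitely many points of the ball lie in \<open>3/2\<close> times the linear image of a cube
  contained in the ball. In a Hilbert space, random signs \<open>\<plusminus>1\<close> make both a sum of \<open>n\<close> vectors of the ball
  and the corresponding defect of order \<open>\<surd>n\<close> up to a logarithm, and a sum without signs is
  assembled from signed sums of geometrically growing length.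

  Finally, a Jensen function with error \<open>\<epsilon>\<close> differs by an exact Jensen function, built from a Hamel basis
  and Hyers' theorem on each coordinate line, from a function that is bounded on segments and hence
  \<open>2 \<epsilon>\<close>-affine.\<close>

section \<open>Concentrators\<close>

text \<open>Applying near affinity to two points at a time, even along a balanced tree, gives an
  error that grows with the number of points. Each geometry therefore needs its own mechanism
  against this growth: a self-improving inequality for set functions on the cube, and cancellation
  of random signs in an inner product space. Both are integer arguments about families with
  repetitions. Real weights are reached by multiplying them by a large \<open>N\<close>, rounding
  down and letting \<open>N\<close> grow, so a remainder may be estimated as crudely as one likes,
  as long as its bound is independent of \<open>N\<close>. Constants for the cube: S = 3/4 S + 20
  \<Delta> gives 80 \<Delta>; with \<Delta> = 2 \<epsilon> and a factor 2 from centring the set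
  function this is 320 \<epsilon> per unit of mass. Mass 2 and two vertex representations give 646 =
  640 + 3 + 3, and the factor 3/2 of the zonotope gives 972 = 3/2 (646 + 2). In a Hilbert space 39
  for sums becomes 40 for convex combinations; the scale 2 \<epsilon> and two comparisons with a
  homogeneous function give 82 = 80 + 2. The even part adds 1 in both cases.\<close>

lemma Hall_marriage:
  fixes N :: "'k \<Rightarrow> 'j set"
  assumes "finite K" "\<And>k. k \<in> K \<Longrightarrow> finite (N k)"
    and "\<And>J. J \<subseteq> K \<Longrightarrow> card J \<le> card (\<Union>(N ` J))"
  shows "\<exists>\<sigma>. inj_on \<sigma> K \<and> (\<forall>k\<in>K. \<sigma> k \<in> N k)"
  using assms
proof (induction "card K" arbitrary: K N rule: less_induct)
  case less
  note fin = less.prems(1,2) and hall = less.prems(3)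
  show ?case
  proof (cases "K = {}")
    case False
    \<comment> \<open>If some nonempty proper \<open>J\<close> is tight, it is matched inside its
      neighbourhood \<open>U\<close>, and the rest still satisfies Hall's condition outside
      \<open>U\<close>.\<close>
    show ?thesis
    proof (cases "\<exists>J. J \<noteq> {} \<and> J \<subset> K \<and> card (\<Union>(N ` J)) \<le> card J")
      case True
      then obtain J where J: "J \<noteq> {}" "J \<subset> K" "card (\<Union>(N ` J)) \<le> card J"
        by blast
      define U where "U = \<Union>(N ` J)"
      have finJ: "finite J" using J(2) fin(1) by (meson finite_subset psubset_imp_subset)
      have finU: "finite U" using J(2) fin(2) finJ by (auto simp: U_def)
      have "\<exists>\<sigma>. inj_on \<sigma> J \<and> (\<forall>k\<in>J. \<sigma> k \<in> N k)"
      proof (rule less.hyps)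
        show "card J < card K" using J(2) fin(1) by (rule psubset_card_mono[rotated])
        show "finite J" by (rule finJ)
        show "finite (N k)" if "k \<in> J" for k using that J(2) fin(2) by blast
        show "card L \<le> card (\<Union>(N ` L))" if "L \<subseteq> J" for L using that J(2) hall by blast
      qed
      then obtain \<sigma> where \<sigma>: "inj_on \<sigma> J" "\<And>k. k \<in> J \<Longrightarrow> \<sigma> k \<in> N k" by blast
      have "\<exists>\<tau>. inj_on \<tau> (K - J) \<and> (\<forall>k\<in>K - J. \<tau> k \<in> N k - U)"
      proof (rule less.hyps)
        show "card (K - J) < card K"
          using J(1,2) fin(1) by (intro psubset_card_mono) auto
        show "finite (K - J)" using fin(1) by simp
        show "finite (N k - U)" if "k \<in> K - J" for k using that fin(2) by blast
        show "card L \<le> card (\<Union>k\<in>L. N k - U)" if L: "L \<subseteq> K - J" for L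
        proof -
          have finL: "finite L" using L fin(1) finite_subset by blast
          have "card L + card J = card (L \<union> J)"
            using L finL finJ by (subst card_Un_disjoint) auto
          also have "\<dots> \<le> card (\<Union>(N ` (L \<union> J)))"
            using L J(2) by (intro hall) auto
          also have "\<Union>(N ` (L \<union> J)) = (\<Union>k\<in>L. N k - U) \<union> U" by (auto simp: U_def)
          also have "card \<dots> \<le> card (\<Union>k\<in>L. N k - U) + card U" by (rule card_Un_le)
          finally show ?thesis using J(3) by (simp add: U_def)
        qed
      qed
      then obtain \<tau> where \<tau>: "inj_on \<tau> (K - J)" "\<And>k. k \<in> K - J \<Longrightarrow> \<tau> k \<in> N k - U" by blast
      define \<rho> where "\<rho> k = (if k \<in> J then \<sigma> k else \<tau> k)" for k
      have "\<sigma> k \<in> U" if "k \<in> J" for k using \<sigma>(2) that by (auto simp: U_def)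
      then have "inj_on \<rho> K"
        using \<sigma>(1) \<tau> unfolding inj_on_def \<rho>_def by (metis Diff_iff)
      moreover have "\<forall>k\<in>K. \<rho> k \<in> N k" using \<sigma>(2) \<tau>(2) by (auto simp: \<rho>_def)
      ultimately show ?thesis by blast
    next
      case strict: False
      \<comment> \<open>Every nonempty proper subset now has a neighbour to spare, so any
        \<open>k\<close> may take any neighbour \<open>y\<close>.\<close>
      obtain k where k: "k \<in> K" using False by blast
      have "card {k} \<le> card (\<Union>(N ` {k}))" by (rule hall) (use k in auto)
      then obtain y where y: "y \<in> N k" by (cases "N k = {}") auto
      have "\<exists>\<sigma>. inj_on \<sigma> (K - {k}) \<and> (\<forall>j\<in>K - {k}. \<sigma> j \<in> N j - {y})"
      proof (rule less.hyps)
        show "card (K - {k}) < card K" using k fin(1) by (meson card_Diff1_less)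
        show "finite (K - {k})" using fin(1) by simp
        show "finite (N j - {y})" if "j \<in> K - {k}" for j using that fin(2) by blast
        show "card L \<le> card (\<Union>j\<in>L. N j - {y})" if L: "L \<subseteq> K - {k}" for L
        proof (cases "L = {}")
          case False
          moreover have "L \<subset> K" using L k by blast
          ultimately have "card L < card (\<Union>(N ` L))" using strict by (meson not_le_imp_less)
          moreover have "(\<Union>j\<in>L. N j - {y}) = \<Union>(N ` L) - {y}" by auto
          moreover have "card (\<Union>(N ` L)) \<le> Suc (card (\<Union>(N ` L) - {y}))"
            by (simp only: card_Diff_singleton_if split: if_split) arith
          ultimately show ?thesis by simp
        qed simp
      qed
      then obtain \<sigma> where \<sigma>: "inj_on \<sigma> (K - {k})" "\<And>j. j \<in> K - {k} \<Longrightarrow> \<sigma> j \<in> N j - {y}" by blast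
      have "inj_on (\<sigma>(k := y)) K"
        using \<sigma> unfolding inj_on_def by (metis Diff_iff fun_upd_apply insertI1 singletonD)
      moreover have "\<forall>j\<in>K. (\<sigma>(k := y)) j \<in> N j" using \<sigma>(2) y by auto
      ultimately show ?thesis by blast
    qed
  qed simp
qed

text \<open>A single term of the exponential series at \<open>k\<close> is at most exp k, and e is
  at most 3.\<close>

lemma power_self_le_fact: "real k ^ k \<le> 3 ^ k * fact k"
proof -
  have "real k ^ k / fact k \<le> exp (real k)"
    using summable_exp_generic[of "real k"]
    unfolding exp_def
    by (subst divide_inverse, subst mult.commute,
        intro order_trans[OF _ sum_le_suminf[where I = "{k}"]]) (auto simp: scaleR_conv_of_real)
  also have "\<dots> = exp 1 ^ k" by (simp flip: exp_of_nat_mult)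
  also have "\<dots> \<le> 3 ^ k" by (intro power_mono exp_le) simp
  finally show ?thesis by (simp add: divide_simps)
qed

text \<open>The bound (e n / k)^k for binomial coefficients with 3 in place of e, freed of the
  division so that k = 0 is included.\<close>

lemma binomial_mult_power_le: "real (n choose k) * real k ^ k \<le> (3 * real n) ^ k"
proof -
  have "real (n choose k) * real k ^ k \<le> real (n choose k) * (3 ^ k * fact k)"
    by (intro mult_left_mono power_self_le_fact) simp
  also have "\<dots> = 3 ^ k * real ((n choose k) * fact k)" by simp
  also have "\<dots> \<le> 3 ^ k * real (n ^ k)"
    by (intro mult_left_mono of_nat_mono) (simp_all add: binomial_fact_pow)
  finally show ?thesis by (simp add: power_mult_distrib)
qed

text \<open>The number of pairs (K, L) times the probability (k / 3 h)^(10 k) that all edges from K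
  end in L is at most 2^(-k). For degree d the estimate requires 12 * 9 * 2 * 2^(d - 2) <= 3^d, and
  d = 10 is the first value that works: 55296 <= 59049.\<close>

lemma concentrator_union_bound:
  assumes "k \<le> 2 * h"
  shows "real (4 * h choose k) * real (3 * h choose k) * real k ^ (10 * k) * 2 ^ k \<le> real (3 * h) ^ (10 * k)"
proof -
  have "real (4 * h choose k) * real (3 * h choose k) * real k ^ (10 * k) * 2 ^ k
      = (real (4 * h choose k) * real k ^ k) * (real (3 * h choose k) * real k ^ k) * (2 * real k ^ 8) ^ k"
  proof -
    have "real k ^ (10 * k) = real k ^ k * real k ^ k * (real k ^ 8) ^ k"
      by (simp flip: power_mult power_add)
    then show ?thesis by (simp add: power_mult_distrib)
  qed
  also have "\<dots> \<le> (3 * real (4 * h)) ^ k * (3 * real (3 * h)) ^ k * (2 * (2 * real h) ^ 8) ^ k"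
    using assms
    by (intro mult_mono binomial_mult_power_le power_mono mult_left_mono) (auto simp flip: of_nat_mult)
  also have "\<dots> = (55296 * real h ^ 10) ^ k"
    unfolding power_mult_distrib[symmetric] by (simp add: power_mult_distrib eval_nat_numeral)
  also have "\<dots> \<le> (59049 * real h ^ 10) ^ k"
    by (intro power_mono mult_right_mono) auto
  also have "\<dots> = real (3 * h) ^ (10 * k)"
    by (simp add: power_mult power_mult_distrib)
  finally show ?thesis .
qed

text \<open>A random graph of degree 10 works with positive probability: a set of \<open>k\<close> vertices violating the
  condition exists with probability at most \<open>2\<^sup>-\<^sup>k\<close>.\<close>

lemma concentrator:
  assumes "h > 0"
  shows "\<exists>g :: nat \<Rightarrow> nat \<Rightarrow> nat. (\<forall>k<4 * h. \<forall>s<10. g k s < 3 * h) \<and>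
    (\<forall>K\<subseteq>{..<4 * h}. card K \<le> 2 * h \<longrightarrow> card K \<le> card (\<Union>k\<in>K. g k ` {..<10}))"
proof (rule ccontr)
  assume neg: "\<nexists>g :: nat \<Rightarrow> nat \<Rightarrow> nat. (\<forall>k<4 * h. \<forall>s<10. g k s < 3 * h) \<and>
    (\<forall>K\<subseteq>{..<4 * h}. card K \<le> 2 * h \<longrightarrow> card K \<le> card (\<Union>k\<in>K. g k ` {..<10}))"
  define E where "E = {..<4 * h} \<times> {..<10::nat}"
  define \<Omega> where "\<Omega> = Pi\<^sub>E E (\<lambda>_. {..<3 * h})"
  \<comment> \<open>An element of \<open>E\<close> is an edge slot: a vertex and one of ten numbers.
    For \<open>(K, L) \<in> P k\<close> the graphs in \<open>Bad K L\<close> make up a fraction (k /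
    3 h)^(10 k) of \<open>\<Omega>\<close>.\<close>
  define Bad where "Bad K L = Pi\<^sub>E E (\<lambda>e. if fst e \<in> K then L else {..<3 * h})" for K L
  define P where "P k = {K. K \<subseteq> {..<4 * h} \<and> card K = k} \<times> {L. L \<subseteq> {..<3 * h} \<and> card L = k}" for k
  have finP: "finite (P k)" for k
    unfolding P_def by (intro finite_cartesian_product) auto
  have cardP: "card (P k) = (4 * h choose k) * (3 * h choose k)" for k
    unfolding P_def by (simp add: card_cartesian_product n_subsets)
  have finE: "finite E" by (simp add: E_def)
  have finBad: "finite (Bad K L)" if "(K, L) \<in> P k" for K L k
    unfolding Bad_def using that finE by (intro finite_PiE) (auto simp: P_def finite_subset)
  have cardBad: "card (Bad K L) = k ^ (10 * k) * (3 * h) ^ (40 * h - 10 * k)" if "(K, L) \<in> P k" for K L k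
  proof -
    have KL: "K \<subseteq> {..<4 * h}" "card K = k" "card L = k" using that by (auto simp: P_def)
    have fin: "finite K" using KL(1) finite_subset by blast
    have "card (Bad K L) = (\<Prod>e\<in>E. if fst e \<in> K then k else 3 * h)"
      unfolding Bad_def card_PiE[OF finE] by (intro prod.cong) (auto simp: KL)
    also have "\<dots> = (\<Prod>e\<in>{e\<in>E. fst e \<in> K}. k) * (\<Prod>e\<in>{e\<in>E. fst e \<notin> K}. 3 * h)"
      using finE by (subst prod.If_cases) (auto intro!: arg_cong2[where f = "(*)"] arg_cong[where f = "\<lambda>A. _ ^ card A"])
    also have "{e\<in>E. fst e \<in> K} = K \<times> {..<10}" using KL(1) by (auto simp: E_def)
    also have "{e\<in>E. fst e \<notin> K} = ({..<4 * h} - K) \<times> {..<10}" by (auto simp: E_def)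
    finally show ?thesis
      using KL fin by (simp add: card_cartesian_product card_Diff_subset mult.commute diff_mult_distrib2)
  qed
  have "\<Omega> \<subseteq> (\<Union>k\<in>{1..2 * h}. \<Union>(K, L)\<in>P k. Bad K L)"
  proof
    fix g assume g: "g \<in> \<Omega>"
    then have g_lt: "g (k, s) < 3 * h" if "k < 4 * h" "s < 10" for k s
      using that by (auto simp: \<Omega>_def E_def)
    obtain K where K: "K \<subseteq> {..<4 * h}" "card K \<le> 2 * h"
        "card (\<Union>k\<in>K. (\<lambda>s. g (k, s)) ` {..<10}) < card K"
      using neg g_lt by (auto simp: not_le dest!: spec[of _ "\<lambda>k s. g (k, s)"])
    let ?N = "\<Union>k\<in>K. (\<lambda>s. g (k, s)) ` {..<10}"
    have N: "?N \<subseteq> {..<3 * h}" using K(1) g_lt by auto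
    have "card K \<le> card {..<3 * h}" using K(2) by simp
    \<comment> \<open>The neighbourhood, being too small, is enlarged to exactly
      \<open>card K\<close> elements, so that two binomial coefficients count the pairs.\<close>
    then obtain L where L: "?N \<subseteq> L" "L \<subseteq> {..<3 * h}" "card L = card K"
      using exists_subset_between[OF less_imp_le[OF K(3)] _ N] by blast
    have "g \<in> Bad K L"
      unfolding Bad_def
    proof (rule PiE_I)
      fix e assume e: "e \<in> E"
      obtain k s where [simp]: "e = (k, s)" by (cases e)
      show "g e \<in> (if fst e \<in> K then L else {..<3 * h})"
        using e L(1) g_lt by (auto simp: E_def)
    next
      fix e assume "e \<notin> E"
      then show "g e = undefined" using g by (auto simp: \<Omega>_def)
    qed
    moreover have "(K, L) \<in> P (card K)" using K L by (simp add: P_def)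
    moreover have "card K \<in> {1..2 * h}" using K by simp
    ultimately show "g \<in> (\<Union>k\<in>{1..2 * h}. \<Union>(K, L)\<in>P k. Bad K L)" by blast
  qed
  then have "card \<Omega> \<le> card (\<Union>k\<in>{1..2 * h}. \<Union>(K, L)\<in>P k. Bad K L)"
    using finP finBad by (intro card_mono) auto
  also have "\<dots> \<le> (\<Sum>k\<in>{1..2 * h}. card (\<Union>(K, L)\<in>P k. Bad K L))"
    by (rule card_UN_le) simp
  also have "\<dots> \<le> (\<Sum>k\<in>{1..2 * h}. \<Sum>(K, L)\<in>P k. card (Bad K L))"
    by (intro sum_mono order_trans[OF card_UN_le] finP) (simp add: case_prod_unfold)
  also have "\<dots> = (\<Sum>k\<in>{1..2 * h}. card (P k) * (k ^ (10 * k) * (3 * h) ^ (40 * h - 10 * k)))"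
    by (intro sum.cong) (auto simp: cardBad case_prod_unfold)
  finally have "real (card \<Omega>) \<le> (\<Sum>k\<in>{1..2 * h}. real (card (P k) * (k ^ (10 * k) * (3 * h) ^ (40 * h - 10 * k))))"
    unfolding of_nat_sum[symmetric] by (rule of_nat_mono)
  also have "\<dots> \<le> (\<Sum>k\<in>{1..2 * h}. real (3 * h) ^ (40 * h) * (1 / 2) ^ k)"
  proof (rule sum_mono)
    fix k assume "k \<in> {1..2 * h}"
    then have k: "k \<le> 2 * h" by simp
    have "real (card (P k) * (k ^ (10 * k) * (3 * h) ^ (40 * h - 10 * k)))
        = (real (4 * h choose k) * real (3 * h choose k) * real k ^ (10 * k) * 2 ^ k)
          * ((1 / 2) ^ k * real (3 * h) ^ (40 * h - 10 * k))"
      by (simp add: cardP power_divide)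
    also have "\<dots> \<le> real (3 * h) ^ (10 * k) * ((1 / 2) ^ k * real (3 * h) ^ (40 * h - 10 * k))"
      by (intro mult_right_mono concentrator_union_bound k) auto
    also have "\<dots> = real (3 * h) ^ (40 * h) * (1 / 2) ^ k"
    proof -
      have "real (3 * h) ^ (40 * h) = real (3 * h) ^ (10 * k) * real (3 * h) ^ (40 * h - 10 * k)"
        using k by (subst power_add[symmetric]) simp
      then show ?thesis by (simp add: mult_ac)
    qed
    finally show "real (card (P k) * (k ^ (10 * k) * (3 * h) ^ (40 * h - 10 * k)))
      \<le> real (3 * h) ^ (40 * h) * (1 / 2) ^ k" .
  qed
  also have "\<dots> = real (3 * h) ^ (40 * h) * (\<Sum>k\<in>{1..2 * h}. (1 / 2) ^ k)"
    by (simp add: sum_distrib_left)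
  \<comment> \<open>The empty set never violates the condition, so the series starts at 1 and its
    finite sum is strictly below 1: some graph is left over.\<close>
  also have "(\<Sum>k\<in>{1..2 * h}. (1 / 2 :: real) ^ k) = 1 - (1 / 2) ^ (2 * h)"
    by (subst sum_gp) (simp add: field_simps)
  also have "real (3 * h) ^ (40 * h) * (1 - (1 / 2) ^ (2 * h)) < real (3 * h) ^ (40 * h) * 1"
    using assms by (intro mult_strict_left_mono) auto
  also have "\<dots> = real (card \<Omega>)"
    unfolding \<Omega>_def card_PiE[OF finE] by (simp add: E_def card_cartesian_product)
  finally show False by simp
qed

section \<open>Nearly additive set functions\<close>

text \<open>Indexing by \<open>k div 4\<close> lists every member four times, which turns a family
  of any length \<open>N\<close> into one of the length \<open>4 * N\<close> that the concentrator
  asks for.\<close>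

lemma sum_lessThan_div_4: "(\<Sum>k<4 * N. f (k div 4)) = 4 * (\<Sum>k<N. f k :: 'a::comm_semiring_1)" for N :: nat
proof (induction N)
  case (Suc N)
  have "4 * Suc N = Suc (Suc (Suc (Suc (4 * N))))" by simp
  moreover have "Suc (4 * N) div 4 = N" "Suc (Suc (4 * N)) div 4 = N" "Suc (Suc (Suc (4 * N))) div 4 = N"
    by simp_all
  moreover have "4 * x = x + x + x + x" for x :: 'a
    by (simp only: numeral_Bit0 numeral_One distrib_right mult_1_left add.assoc)
  ultimately show ?case
    using Suc by (simp only: sum.lessThan_Suc) (simp add: ac_simps)
qed simp

text \<open>Complements are respected exactly, not just up to \<Delta>: replacing every set of a
  family by its complement then preserves the defect, so points covered by more than half of the
  sets can be avoided.\<close>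

locale near_additive =
  fixes I :: "'i set" and G :: "'i set \<Rightarrow> real" and \<Delta> :: real
  assumes finite_I: "finite I"
    and G_Un: "\<And>A B. A \<subseteq> I \<Longrightarrow> B \<subseteq> I \<Longrightarrow> A \<inter> B = {} \<Longrightarrow> \<bar>G (A \<union> B) - G A - G B\<bar> \<le> \<Delta>"
    and G_empty: "G {} = 0"
    and G_compl: "\<And>A. A \<subseteq> I \<Longrightarrow> G (I - A) = G I - G A"
begin

lemma G_UNION:
  assumes "finite P" "\<And>p. p \<in> P \<Longrightarrow> X p \<subseteq> I"
    and "\<And>p q. p \<in> P \<Longrightarrow> q \<in> P \<Longrightarrow> p \<noteq> q \<Longrightarrow> X p \<inter> X q = {}"
  shows "\<bar>G (\<Union>(X ` P)) - (\<Sum>p\<in>P. G (X p))\<bar> \<le> real (card P) * \<Delta>"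
  using assms
proof (induction P)
  case (insert p P)
  have "\<bar>G (X p \<union> \<Union>(X ` P)) - G (X p) - G (\<Union>(X ` P))\<bar> \<le> \<Delta>"
    using insert by (intro G_Un) blast+
  moreover have "\<bar>G (\<Union>(X ` P)) - (\<Sum>p\<in>P. G (X p))\<bar> \<le> real (card P) * \<Delta>"
    using insert by (intro insert.IH) blast+
  ultimately show ?case using insert.hyps by (simp add: algebra_simps)
qed (simp add: G_empty)

text \<open>The concentrator redistributes the sets \<open>A k\<close>: a point \<open>i\<close> lies in at most half of them, so by
  Hall's theorem these can be matched with distinct neighbours, and \<open>C j\<close> collects the points
  which are sent to \<open>j\<close>.\<close>

lemma shrink_family:
  assumes "h > 0" "\<And>k. k < 4 * h \<Longrightarrow> A k \<subseteq> I"
    and cov: "\<And>i. i \<in> I \<Longrightarrow> card {k. k < 4 * h \<and> i \<in> A k} = m" and m: "m \<le> 2 * h"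
  shows "\<exists>C. (\<forall>j<3 * h. C j \<subseteq> I) \<and> (\<forall>i\<in>I. card {j. j < 3 * h \<and> i \<in> C j} = m) \<and>
    \<bar>(\<Sum>k<4 * h. G (A k)) - (\<Sum>j<3 * h. G (C j))\<bar> \<le> 80 * real h * \<Delta>"
proof -
  obtain g :: "nat \<Rightarrow> nat \<Rightarrow> nat" where g: "\<And>k s. k < 4 * h \<Longrightarrow> s < 10 \<Longrightarrow> g k s < 3 * h"
    and expand: "\<And>K. K \<subseteq> {..<4 * h} \<Longrightarrow> card K \<le> 2 * h \<Longrightarrow> card K \<le> card (\<Union>k\<in>K. g k ` {..<10})"
    using concentrator[OF assms(1)] by blast
  define K where "K i = {k. k < 4 * h \<and> i \<in> A k}" for i
  have "\<exists>\<tau>. inj_on (\<lambda>k. g k (\<tau> k)) (K i) \<and> (\<forall>k\<in>K i. \<tau> k < 10)" if i: "i \<in> I" for i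
  proof -
    have "\<exists>\<sigma>. inj_on \<sigma> (K i) \<and> (\<forall>k\<in>K i. \<sigma> k \<in> g k ` {..<10})"
    proof (rule Hall_marriage)
      show "finite (K i)" by (simp add: K_def)
      show "card J \<le> card (\<Union>k\<in>J. g k ` {..<10})" if J: "J \<subseteq> K i" for J
      proof (rule expand)
        show "J \<subseteq> {..<4 * h}" using J by (auto simp: K_def)
        have "card J \<le> card (K i)" using J by (intro card_mono) (auto simp: K_def)
        then show "card J \<le> 2 * h" using cov[OF i] m by (simp add: K_def)
      qed
    qed simp
    then obtain \<sigma> where \<sigma>: "inj_on \<sigma> (K i)" "\<And>k. k \<in> K i \<Longrightarrow> \<exists>s<10. \<sigma> k = g k s" by fastforce
    then obtain \<tau> where \<tau>: "\<And>k. k \<in> K i \<Longrightarrow> \<tau> k < 10 \<and> \<sigma> k = g k (\<tau> k)" by metis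
    have "inj_on (\<lambda>k. g k (\<tau> k)) (K i) \<longleftrightarrow> inj_on \<sigma> (K i)"
      by (rule inj_on_cong) (simp add: \<tau>)
    with \<sigma>(1) \<tau> show ?thesis by blast
  qed
  then obtain \<tau> where \<tau>: "\<And>i. i \<in> I \<Longrightarrow> inj_on (\<lambda>k. g k (\<tau> i k)) (K i)"
      "\<And>i k. i \<in> I \<Longrightarrow> k \<in> K i \<Longrightarrow> \<tau> i k < 10"
    by metis
  \<comment> \<open>The part of \<open>A k\<close> whose points are matched along edge
    \<open>s\<close> of \<open>k\<close>. Cutting the \<open>4 * h\<close> sets into ten such pieces
    each costs \<open>40 * h * \<Delta>\<close>.\<close>
  define X where "X e = {i \<in> A (fst e). \<tau> i (fst e) = snd e}" for e :: "nat \<times> nat"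
  define E where "E = {..<4 * h} \<times> {..<10::nat}"
  define E' where "E' j = {e \<in> E. g (fst e) (snd e) = j}" for j
  define C where "C j = \<Union>(X ` E' j)" for j
  have XI: "X e \<subseteq> I" if "e \<in> E" for e using that assms(2)[of "fst e"] by (auto simp: X_def E_def)
  have finE: "finite E" "finite (E' j)" for j by (simp_all add: E_def E'_def)
  have memX: "i \<in> X (k, s) \<longleftrightarrow> k \<in> K i \<and> \<tau> i k = s" if "k < 4 * h" for i k s
    using that by (auto simp: X_def K_def)
  have inj: "k = l" if "i \<in> I" "k \<in> K i" "l \<in> K i" "g k (\<tau> i k) = g l (\<tau> i l)" for i k l
    using \<tau>(1)[OF that(1)] that by (auto dest: inj_onD)
  have 1: "\<bar>G (A k) - (\<Sum>s<10. G (X (k, s)))\<bar> \<le> 10 * \<Delta>" if k: "k < 4 * h" for k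
  proof -
    have "A k = (\<Union>s<10. X (k, s))"
      using \<tau>(2) assms(2)[OF k] k by (auto simp: X_def K_def)
    moreover have "\<bar>G (\<Union>s<10. X (k, s)) - (\<Sum>s<10. G (X (k, s)))\<bar> \<le> real (card {..<10::nat}) * \<Delta>"
      using assms(2)[OF k] by (intro G_UNION) (auto simp: X_def)
    ultimately show ?thesis by simp
  qed
  \<comment> \<open>The pieces collected at \<open>j\<close> are disjoint because the matching is
    injective at every point. There are \<open>40 * h\<close> pieces in all, so gluing costs as much
    as cutting did.\<close>
  have 2: "\<bar>G (C j) - (\<Sum>e\<in>E' j. G (X e))\<bar> \<le> real (card (E' j)) * \<Delta>" for j
    unfolding C_def
  proof (rule G_UNION)
    fix e e' assume e: "e \<in> E' j" "e' \<in> E' j" "e \<noteq> e'"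
    show "X e \<inter> X e' = {}"
    proof (rule ccontr)
      assume "X e \<inter> X e' \<noteq> {}"
      then obtain i where i: "i \<in> X e" "i \<in> X e'" by blast
      obtain k s k' s' where ks: "e = (k, s)" "e' = (k', s')" by (cases e, cases e')
      have lt: "k < 4 * h" "k' < 4 * h" and eq: "g k s = g k' s'"
        using e ks by (auto simp: E'_def E_def)
      have "i \<in> I" using i(1) ks e(1) XI by (auto simp: E'_def)
      with i eq lt have "k = k'" using inj[of i k k'] by (auto simp: ks memX)
      with i lt e(3) show False by (auto simp: ks memX)
    qed
  qed (use finE XI in \<open>auto simp: E'_def\<close>)
  have "(\<Sum>k<4 * h. \<Sum>s<10. G (X (k, s))) = (\<Sum>e\<in>E. G (X e))"
    by (simp add: E_def sum.cartesian_product)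
  also have "\<dots> = (\<Sum>j<3 * h. \<Sum>e\<in>E' j. G (X e))"
    unfolding E'_def by (rule sum.group[symmetric]) (use finE g in \<open>auto simp: E_def\<close>)
  finally have eq: "(\<Sum>k<4 * h. \<Sum>s<10. G (X (k, s))) = (\<Sum>j<3 * h. \<Sum>e\<in>E' j. G (X e))" .
  have "(\<Sum>j<3 * h. card (E' j)) = (\<Sum>j<3 * h. \<Sum>e\<in>E' j. 1)" by simp
  also have "\<dots> = (\<Sum>e\<in>E. 1)"
    unfolding E'_def by (rule sum.group) (use finE g in \<open>auto simp: E_def\<close>)
  also have "\<dots> = 40 * h" by (simp add: E_def card_cartesian_product)
  finally have cardE: "(\<Sum>j<3 * h. card (E' j)) = 40 * h" .
  have "\<bar>(\<Sum>k<4 * h. G (A k)) - (\<Sum>k<4 * h. \<Sum>s<10. G (X (k, s)))\<bar> \<le> (\<Sum>k<4 * h. 10 * \<Delta>)"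
    unfolding sum_subtractf[symmetric] by (intro order_trans[OF sum_abs] sum_mono 1) simp
  moreover have "\<bar>(\<Sum>j<3 * h. G (C j)) - (\<Sum>j<3 * h. \<Sum>e\<in>E' j. G (X e))\<bar> \<le> (\<Sum>j<3 * h. real (card (E' j)) * \<Delta>)"
    unfolding sum_subtractf[symmetric] by (intro order_trans[OF sum_abs] sum_mono 2)
  moreover have "(\<Sum>j<3 * h. real (card (E' j)) * \<Delta>) = 40 * real h * \<Delta>"
    by (simp flip: sum_distrib_right of_nat_sum add: cardE)
  ultimately have "\<bar>(\<Sum>k<4 * h. G (A k)) - (\<Sum>j<3 * h. G (C j))\<bar> \<le> 80 * real h * \<Delta>"
    using eq by simp
  moreover have "C j \<subseteq> I" for j using XI by (auto simp: C_def E'_def)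
  moreover have "card {j. j < 3 * h \<and> i \<in> C j} = m" if i: "i \<in> I" for i
  proof -
    have "{j. j < 3 * h \<and> i \<in> C j} = (\<lambda>k. g k (\<tau> i k)) ` K i"
    proof (intro set_eqI iffI)
      fix j assume "j \<in> {j. j < 3 * h \<and> i \<in> C j}"
      then show "j \<in> (\<lambda>k. g k (\<tau> i k)) ` K i"
        by (auto simp: C_def E'_def E_def memX)
    next
      fix j assume "j \<in> (\<lambda>k. g k (\<tau> i k)) ` K i"
      then obtain k where k: "k \<in> K i" "j = g k (\<tau> i k)" by blast
      then have "k < 4 * h" "\<tau> i k < 10" using \<tau>(2)[OF i] by (auto simp: K_def)
      with k have "i \<in> X (k, \<tau> i k)" "(k, \<tau> i k) \<in> E' j" "j < 3 * h"
        using g by (simp_all add: memX E'_def E_def)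
      then show "j \<in> {j. j < 3 * h \<and> i \<in> C j}" by (auto simp: C_def)
    qed
    then show ?thesis using card_image[OF \<tau>(1)[OF i]] cov[OF i] by (simp add: K_def)
  qed
  ultimately show ?thesis by (intro exI[of _ C] conjI allI impI ballI)
qed

section \<open>Uniform covers and the contraction of their defect\<close>

definition uniform_cover :: "nat \<Rightarrow> (nat \<Rightarrow> 'i set) \<Rightarrow> nat \<Rightarrow> bool" where
  "uniform_cover N A m \<longleftrightarrow> N > 0 \<and> m \<le> N \<and> (\<forall>k<N. A k \<subseteq> I) \<and> (\<forall>i\<in>I. card {k. k < N \<and> i \<in> A k} = m)"

text \<open>Dividing by the number of sets makes the passage from \<open>4 * N\<close> to
  \<open>3 * N\<close> sets a contraction by 3/4.\<close>

definition cover_defect :: "nat \<Rightarrow> (nat \<Rightarrow> 'i set) \<Rightarrow> nat \<Rightarrow> real" where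
  "cover_defect N A m = \<bar>(\<Sum>k<N. G (A k)) - real m * G I\<bar> / real N"

text \<open>Four copies of the family have \<open>4 * N\<close> members and multiplicity
  \<open>4 * m <= 2 * N\<close>, so \<open>shrink_family\<close> with \<open>h = N\<close> yields
  \<open>3 * N\<close> sets of the same multiplicity. Their total defect is at most
  \<open>3 * N * S\<close>, the rearrangement costs \<open>80 * N * \<Delta>\<close>, and both are
  divided by \<open>4 * N\<close>.\<close>

lemma cover_defect_improve:
  assumes S: "\<And>N A m. uniform_cover N A m \<Longrightarrow> cover_defect N A m \<le> S"
    and A: "uniform_cover N A m" and m: "2 * m \<le> N"
  shows "cover_defect N A m \<le> 3 / 4 * S + 20 * \<Delta>"
proof -
  have N: "N > 0" using A by (simp add: uniform_cover_def)
  have cov: "card {k. k < 4 * N \<and> i \<in> A (k div 4)} = 4 * m" if "i \<in> I" for i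
  proof -
    have "card {k. k < 4 * N \<and> i \<in> A (k div 4)} = (\<Sum>k<4 * N. of_bool (i \<in> A (k div 4)))"
      by (simp add: sum_of_bool_eq Int_def)
    also have "\<dots> = 4 * (\<Sum>k<N. of_bool (i \<in> A k))" by (rule sum_lessThan_div_4)
    also have "(\<Sum>k<N. of_bool (i \<in> A k)) = card {k. k < N \<and> i \<in> A k}"
      by (simp add: sum_of_bool_eq Int_def)
    finally show ?thesis using A that by (simp add: uniform_cover_def)
  qed
  have "A (k div 4) \<subseteq> I" if "k < 4 * N" for k
    using A that by (simp add: uniform_cover_def)
  then have "\<exists>C. (\<forall>j<3 * N. C j \<subseteq> I) \<and> (\<forall>i\<in>I. card {j. j < 3 * N \<and> i \<in> C j} = 4 * m) \<and>
      \<bar>(\<Sum>k<4 * N. G (A (k div 4))) - (\<Sum>j<3 * N. G (C j))\<bar> \<le> 80 * real N * \<Delta>"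
    using m by (intro shrink_family cov N) simp_all
  then obtain C where C: "\<forall>j<3 * N. C j \<subseteq> I" "\<forall>i\<in>I. card {j. j < 3 * N \<and> i \<in> C j} = 4 * m"
      "\<bar>4 * (\<Sum>k<N. G (A k)) - (\<Sum>j<3 * N. G (C j))\<bar> \<le> 80 * real N * \<Delta>"
    unfolding sum_lessThan_div_4[of "\<lambda>k. G (A k)" N] by (elim exE conjE)
  have "uniform_cover (3 * N) C (4 * m)" using C m N by (simp add: uniform_cover_def)
  then have "cover_defect (3 * N) C (4 * m) \<le> S" by (rule S)
  then have "\<bar>(\<Sum>j<3 * N. G (C j)) - 4 * (real m * G I)\<bar> \<le> S * (3 * real N)"
    using N by (simp add: cover_defect_def divide_simps mult_ac)
  with C(3) have "\<bar>4 * (\<Sum>k<N. G (A k)) - 4 * (real m * G I)\<bar> \<le> S * (3 * real N) + 80 * real N * \<Delta>"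
    by linarith
  then have "4 * \<bar>(\<Sum>k<N. G (A k)) - real m * G I\<bar> \<le> S * (3 * real N) + 80 * real N * \<Delta>"
    unfolding right_diff_distrib[symmetric] abs_mult by simp
  then show ?thesis
    using N by (simp add: cover_defect_def divide_simps algebra_simps)
qed

text \<open>The contraction inequality can be solved for the supremum only if that is finite; the
  bound \<open>2 * M\<close>, which depends on \<open>I\<close>, serves this purpose alone.\<close>

lemma cover_defect_le:
  assumes "uniform_cover N A m"
  shows "cover_defect N A m \<le> 80 * \<Delta>"
proof -
  define Q where "Q = {cover_defect N A m | N A m. uniform_cover N A m}"
  define S where "S = Sup Q"
  define M where "M = (\<Sum>A\<in>Pow I. \<bar>G A\<bar>)"
  have M: "\<bar>G A\<bar> \<le> M" if "A \<subseteq> I" for A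
    unfolding M_def using that finite_I by (intro member_le_sum) auto
  have "cover_defect N A m \<le> 2 * M" if "uniform_cover N A m" for N A m
  proof -
    have N: "N > 0" "m \<le> N" using that by (auto simp: uniform_cover_def)
    have "\<bar>\<Sum>k<N. G (A k)\<bar> \<le> (\<Sum>k<N. M)"
      using that by (intro order_trans[OF sum_abs] sum_mono M) (auto simp: uniform_cover_def)
    moreover have "\<bar>real m * G I\<bar> \<le> real N * M"
      unfolding abs_mult using N M[of I] by (intro mult_mono) auto
    ultimately have "\<bar>(\<Sum>k<N. G (A k)) - real m * G I\<bar> \<le> 2 * (real N * M)"
      using abs_triangle_ineq4[of "\<Sum>k<N. G (A k)" "real m * G I"] by simp
    then show ?thesis using N by (simp add: cover_defect_def divide_simps mult_ac)
  qed
  then have bdd: "bdd_above Q" by (auto simp: Q_def intro!: bdd_aboveI)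
  have S: "cover_defect N A m \<le> S" if "uniform_cover N A m" for N A m
    unfolding S_def by (rule cSup_upper[OF _ bdd]) (use that in \<open>auto simp: Q_def\<close>)
  have "S \<le> 3 / 4 * S + 20 * \<Delta>"
    unfolding S_def
  proof (rule cSup_least)
    show "Q \<noteq> {}" using assms by (auto simp: Q_def)
    fix x assume "x \<in> Q"
    then obtain N A m where x: "x = cover_defect N A m" and A: "uniform_cover N A m"
      by (auto simp: Q_def)
    have "x \<le> 3 / 4 * S + 20 * \<Delta>"
    proof (cases "2 * m \<le> N")
      case True
      show ?thesis unfolding x by (rule cover_defect_improve[OF S A True])
    next
      case False
      \<comment> \<open>A multiplicity above \<open>N / 2\<close> is turned into
        \<open>N - m\<close> by complements, with the same defect.\<close>
      have AI: "A k \<subseteq> I" if "k < N" for k using A that by (simp add: uniform_cover_def)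
      have m: "m \<le> N" using A by (simp add: uniform_cover_def)
      have "card {k. k < N \<and> i \<in> I - A k} = N - m" if "i \<in> I" for i
      proof -
        have "{k. k < N \<and> i \<in> I - A k} = {..<N} - {k. k < N \<and> i \<in> A k}" using that by auto
        then show ?thesis using A that by (simp add: card_Diff_subset subset_eq uniform_cover_def)
      qed
      then have A': "uniform_cover N (\<lambda>k. I - A k) (N - m)"
        using A by (auto simp: uniform_cover_def)
      have "(\<Sum>k<N. G (I - A k)) = (\<Sum>k<N. G I - G (A k))"
        by (intro sum.cong) (auto simp: G_compl AI)
      then have "(\<Sum>k<N. G (I - A k)) - real (N - m) * G I = - ((\<Sum>k<N. G (A k)) - real m * G I)"
        using m by (simp add: sum_subtractf of_nat_diff algebra_simps)
      then have "cover_defect N (\<lambda>k. I - A k) (N - m) = x"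
        unfolding x cover_defect_def by (simp only: abs_minus_cancel)
      then show ?thesis using cover_defect_improve[OF S A'] False by simp
    qed
    then show "x \<le> 3 / 4 * Sup Q + 20 * \<Delta>" by (simp add: S_def)
  qed
  then have "S \<le> 80 * \<Delta>" by simp
  with S[OF assms] show ?thesis by linarith
qed

end

section \<open>Nearly affine functions on cubes\<close>

definition vertex :: "'i set \<Rightarrow> 'i \<Rightarrow> real" where
  "vertex A i = (if i \<in> A then 1 else -1)"

locale near_affine_cube =
  fixes I :: "'i set" and \<phi> :: "('i \<Rightarrow> real) \<Rightarrow> real" and \<epsilon> :: real
    and Q :: "('i \<Rightarrow> real) set"
  defines "Q \<equiv> {a. \<forall>i\<in>I. \<bar>a i\<bar> \<le> 1}"
  assumes finite_I: "finite I"
    and \<phi>_cong: "\<And>a b. (\<And>i. i \<in> I \<Longrightarrow> a i = b i) \<Longrightarrow> \<phi> a = \<phi> b"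
    and \<phi>_affine: "\<And>a b t. a \<in> Q \<Longrightarrow> b \<in> Q \<Longrightarrow> 0 \<le> t \<Longrightarrow> t \<le> 1 \<Longrightarrow>
      \<bar>\<phi> (\<lambda>i. t * a i + (1 - t) * b i) - t * \<phi> a - (1 - t) * \<phi> b\<bar> \<le> \<epsilon>"
    and \<phi>_odd: "\<And>a. a \<in> Q \<Longrightarrow> \<phi> (\<lambda>i. - a i) = - \<phi> a"
begin

definition F :: "'i set \<Rightarrow> real" where
  "F A = \<phi> (vertex A)"

lemma vertex_Q [simp]: "vertex A \<in> Q"
  by (simp add: Q_def vertex_def)

lemma eps_nonneg: "0 \<le> \<epsilon>"
  using order_trans[OF abs_ge_zero \<phi>_affine[of "vertex {}" "vertex {}" 0]] by simp

lemma convex_Q: "finite K \<Longrightarrow> (\<And>k. k \<in> K \<Longrightarrow> p k \<in> Q) \<Longrightarrow> (\<And>k. k \<in> K \<Longrightarrow> 0 \<le> l k) \<Longrightarrow> sum l K = 1 \<Longrightarrow>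
    (\<lambda>i. \<Sum>k\<in>K. l k * p k i) \<in> Q"
proof -
  assume *: "finite K" "\<And>k. k \<in> K \<Longrightarrow> p k \<in> Q" "\<And>k. k \<in> K \<Longrightarrow> 0 \<le> l k" "sum l K = 1"
  have "\<bar>\<Sum>k\<in>K. l k * p k i\<bar> \<le> 1" if "i \<in> I" for i
  proof -
    have "\<bar>\<Sum>k\<in>K. l k * p k i\<bar> \<le> (\<Sum>k\<in>K. l k * 1)"
      using * that by (intro order_trans[OF sum_abs] sum_mono) (auto simp: abs_mult Q_def intro!: mult_left_le)
    then show ?thesis using * by simp
  qed
  then show ?thesis by (simp add: Q_def)
qed

lemma F_compl: "A \<subseteq> I \<Longrightarrow> F (I - A) = - F A"
proof -
  assume "A \<subseteq> I"
  have "F (I - A) = \<phi> (\<lambda>i. - vertex A i)"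
    unfolding F_def by (rule \<phi>_cong) (auto simp: vertex_def)
  then show ?thesis by (simp add: \<phi>_odd F_def)
qed

text \<open>For disjoint sets the vertices of \<open>A \<union> B\<close> and \<open>{}\<close> have
  the same midpoint as those of \<open>A\<close> and \<open>B\<close>. Two midpoint errors
  \<epsilon> are doubled when the halves are cleared.\<close>

lemma F_Un:
  assumes "A \<inter> B = {}"
  shows "\<bar>F (A \<union> B) + F {} - F A - F B\<bar> \<le> 4 * \<epsilon>"
proof -
  have "\<phi> (\<lambda>i. 1 / 2 * vertex (A \<union> B) i + (1 - 1 / 2) * vertex {} i)
      = \<phi> (\<lambda>i. 1 / 2 * vertex A i + (1 - 1 / 2) * vertex B i)"
    by (rule \<phi>_cong) (use assms in \<open>auto simp: vertex_def\<close>)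
  then show ?thesis
    using \<phi>_affine[of "vertex (A \<union> B)" "vertex {}" "1/2"] \<phi>_affine[of "vertex A" "vertex B" "1/2"]
    by (simp add: F_def)
qed

text \<open>Adding \<open>F I\<close> makes the function vanish at \<open>{}\<close>, because
  oddness gives \<open>F {} = - F I\<close>; halving restores the value \<open>F I\<close> at
  \<open>I\<close>.\<close>

interpretation near_additive I "\<lambda>A. (F A + F I) / 2" "2 * \<epsilon>"
proof
  have e: "F {} = - F I" using F_compl[of I] by simp
  show "finite I" by (rule finite_I)
  show "(F {} + F I) / 2 = 0" using e by simp
  show "(F (I - A) + F I) / 2 = (F I + F I) / 2 - (F A + F I) / 2" if "A \<subseteq> I" for A
    using F_compl[OF that] by (simp add: field_simps)
  fix A B :: "'i set" assume "A \<inter> B = {}"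
  from F_Un[OF this] show "\<bar>(F (A \<union> B) + F I) / 2 - (F A + F I) / 2 - (F B + F I) / 2\<bar> \<le> 2 * \<epsilon>"
    unfolding e by (simp add: field_simps abs_le_iff)
qed

text \<open>Balance at \<open>i\<close> says that \<open>i\<close> lies in exactly half of the sets,
  so the family is a uniform cover. Its defect is at most 80 * 2 \<epsilon> for the centred
  function, hence twice that for \<open>F\<close>. An odd \<open>N\<close> is possible only for
  empty \<open>I\<close>, where \<open>F\<close> vanishes by oddness.\<close>

lemma F_balanced_nat:
  assumes "\<And>k. k < N \<Longrightarrow> A k \<subseteq> I" and bal: "\<And>i. i \<in> I \<Longrightarrow> (\<Sum>k<N. vertex (A k) i) = 0"
  shows "\<bar>\<Sum>k<N. F (A k)\<bar> \<le> 320 * \<epsilon> * real N"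
proof (cases "I = {} \<or> N = 0")
  case True
  then show ?thesis
  proof
    assume [simp]: "I = {}"
    have "F {} = 0" using F_compl[of "{}"] by simp
    then have "(\<Sum>k<N. F (A k)) = 0" using assms(1) by (intro sum.neutral) simp
    then show ?thesis using eps_nonneg by simp
  qed simp
next
  case False
  have cov: "2 * card {k. k < N \<and> i \<in> A k} = N" if "i \<in> I" for i
  proof -
    have "(\<Sum>k<N. vertex (A k) i) = (\<Sum>k<N. 2 * of_bool (i \<in> A k) - 1)"
      by (intro sum.cong) (auto simp: vertex_def)
    also have "\<dots> = 2 * real (card {k. k < N \<and> i \<in> A k}) - real N"
      by (simp add: sum_subtractf sum_of_bool_eq Int_def flip: sum_distrib_left)
    finally show ?thesis using bal[OF that] by linarith
  qed
  define m where "m = N div 2"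
  have m: "N = 2 * m" using cov False unfolding m_def by (metis all_not_in_conv dvd_triv_left dvd_mult_div_cancel)
  have "uniform_cover N A m"
    unfolding uniform_cover_def using assms(1) cov False m by auto
  then have "cover_defect N A m \<le> 80 * (2 * \<epsilon>)" by (rule cover_defect_le)
  then have "\<bar>(\<Sum>k<N. (F (A k) + F I) / 2) - real m * F I\<bar> \<le> 160 * \<epsilon> * real N"
    using False by (simp add: cover_defect_def divide_simps mult_ac)
  moreover have "(\<Sum>k<N. (F (A k) + F I) / 2) = (\<Sum>k<N. F (A k)) / 2 + real m * F I"
    using m by (simp add: sum.distrib flip: sum_divide_distrib)
  ultimately show ?thesis by simp
qed

lemma F_balanced:
  assumes "finite K" "\<And>k. k \<in> K \<Longrightarrow> A k \<subseteq> I" "\<And>i. i \<in> I \<Longrightarrow> (\<Sum>k\<in>K. vertex (A k) i) = 0"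
  shows "\<bar>\<Sum>k\<in>K. F (A k)\<bar> \<le> 320 * \<epsilon> * real (card K)"
proof -
  obtain h where h: "bij_betw h {..<card K} K"
    using ex_bij_betw_nat_finite[OF assms(1)] by (auto simp: lessThan_atLeast0)
  have "\<bar>\<Sum>k<card K. F (A (h k))\<bar> \<le> 320 * \<epsilon> * real (card K)"
  proof (rule F_balanced_nat)
    show "A (h k) \<subseteq> I" if "k < card K" for k
      using that assms(2) h by (auto dest: bij_betw_apply)
    show "(\<Sum>k<card K. vertex (A (h k)) i) = 0" if "i \<in> I" for i
      using sum.reindex_bij_betw[OF h, of "\<lambda>k. vertex (A k) i"] assms(3)[OF that] by simp
  qed
  then show ?thesis using sum.reindex_bij_betw[OF h, of "\<lambda>k. F (A k)"] by simp
qed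

text \<open>The weights are rounded down to multiples of \<open>1 / N\<close>; the integer remainder vector stays bounded,
  has coordinates of equal parity, and is therefore a sum of boundedly many vertices.\<close>

lemma F_balanced_real:
  assumes nonneg: "\<And>A. A \<subseteq> I \<Longrightarrow> 0 \<le> w A"
    and bal: "\<And>i. i \<in> I \<Longrightarrow> (\<Sum>A\<in>Pow I. w A * vertex A i) = 0"
  shows "\<bar>\<Sum>A\<in>Pow I. w A * F A\<bar> \<le> 320 * \<epsilon> * (\<Sum>A\<in>Pow I. w A)"
proof (rule ccontr)
  define P where "P = Pow I"
  have finP: "finite P" using finite_I by (simp add: P_def)
  define M where "M = (\<Sum>A\<in>P. \<bar>F A\<bar>)"
  have M: "\<bar>F A\<bar> \<le> M" if "A \<subseteq> I" for A
    unfolding M_def using that finP by (intro member_le_sum) (auto simp: P_def)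
  have M0: "M \<ge> 0" unfolding M_def by (simp add: sum_nonneg)
  define p where "p = card P"
  \<comment> \<open>The right-hand side does not depend on \<open>N\<close>, so the rounding
    disappears for large \<open>N\<close>.\<close>
  have key: "real N * (\<bar>\<Sum>A\<in>P. w A * F A\<bar> - 320 * \<epsilon> * (\<Sum>A\<in>P. w A)) \<le> (320 * \<epsilon> + M) * real (p + 1) + real p * M" for N :: nat
  proof -
    define n where "n A = nat \<lfloor>real N * w A\<rfloor>" for A
    have n: "real (n A) \<le> real N * w A" "real N * w A \<le> real (n A) + 1" if "A \<in> P" for A
      using nonneg[of A] that by (auto simp: n_def P_def)
    define T where "T = (\<Sum>A\<in>P. n A)"
    define c where "c i = (\<Sum>A\<in>{A\<in>P. i \<in> A}. n A)" for i
    have s_eq: "(\<Sum>A\<in>P. real (n A) * vertex A i) = 2 * real (c i) - real T" for i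
    proof -
      have "(\<Sum>A\<in>P. real (n A) * vertex A i) = (\<Sum>A\<in>P. 2 * (if i \<in> A then real (n A) else 0) - real (n A))"
        by (intro sum.cong) (auto simp: vertex_def)
      then show ?thesis
        using finP
        by (simp add: sum_subtractf T_def c_def sum.inter_filter if_distrib[of real] cong: if_cong flip: sum_distrib_left)
    qed
    have s_bound: "\<bar>2 * real (c i) - real T\<bar> \<le> real p" if "i \<in> I" for i
    proof -
      have "(\<Sum>A\<in>P. real (n A) * vertex A i) = - (\<Sum>A\<in>P. (real N * w A - real (n A)) * vertex A i)"
        using bal[OF that] by (simp add: algebra_simps sum_subtractf P_def flip: sum_distrib_left)
      moreover have "\<bar>\<Sum>A\<in>P. (real N * w A - real (n A)) * vertex A i\<bar> \<le> (\<Sum>A\<in>P. 1)"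
        using n by (intro order_trans[OF sum_abs] sum_mono)
          (auto simp: abs_mult vertex_def diff_le_eq add.commute)
      ultimately show ?thesis by (simp add: s_eq p_def)
    qed
    \<comment> \<open>\<open>W\<close> is the number of vertices that compensate the remainder. It
      has the parity of \<open>T\<close>, hence of every coordinate \<open>2 * c i - T\<close>, and
      is at least \<open>p\<close>, which bounds these coordinates; therefore \<open>b i\<close> is
      an exact half and lies between 0 and \<open>W\<close>.\<close>
    define W where "W = (if even (p + T) then p else p + 1)"
    have W: "even (W + T)" "p \<le> W" "W \<le> p + 1" by (auto simp: W_def)
    define b where "b i = (W + T) div 2 - c i" for i
    have b: "2 * real (b i) = real W + real T - 2 * real (c i)" and bW: "b i \<le> W" if "i \<in> I" for i
    proof -
      have 1: "2 * c i \<le> W + T" "T \<le> 2 * c i + W" using s_bound[OF that] W by linarith+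
      have 2: "2 * ((W + T) div 2) = W + T" using W(1) by simp
      have "2 * b i = W + T - 2 * c i" unfolding b_def using 2 by simp
      then have "2 * b i + 2 * c i = W + T" using 1 by simp
      then show "2 * real (b i) = real W + real T - 2 * real (c i)" "b i \<le> W" using 1 by linarith+
    qed
    \<comment> \<open>A coordinate \<open>i\<close> lies in exactly \<open>b i\<close> of the sets
      \<open>B l\<close> with \<open>l < W\<close>, so their vertices add up to
      \<open>2 * b i - W\<close>, the negative of the remainder.\<close>
    define B where "B l = {i \<in> I. l < b i}" for l
    define K where "K = Sigma P (\<lambda>A. {..<n A}) <+> {..<W}"
    define f :: "'i set \<times> nat + nat \<Rightarrow> 'i set" where "f = case_sum fst B"
    have finS: "finite (Sigma P (\<lambda>A. {..<n A}))" using finP by auto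
    have sumK: "(\<Sum>k\<in>K. g (f k)) = (\<Sum>A\<in>P. real (n A) * g A) + (\<Sum>l<W. g (B l))" for g :: "'i set \<Rightarrow> real"
    proof -
      have "(\<Sum>A\<in>P. real (n A) * g A) = (\<Sum>A\<in>P. \<Sum>j<n A. g A)" by simp
      also have "\<dots> = (\<Sum>x\<in>Sigma P (\<lambda>A. {..<n A}). g (fst x))"
        using finP by (subst sum.Sigma) (auto simp: case_prod_unfold)
      finally show ?thesis
        unfolding K_def sum.Plus[OF finS finite_lessThan] by (simp add: f_def)
    qed
    have "real (card K) = real T + real W"
      using sumK[of "\<lambda>_. 1"] by (simp add: T_def)
    moreover have "\<bar>\<Sum>k\<in>K. F (f k)\<bar> \<le> 320 * \<epsilon> * real (card K)"
    proof (rule F_balanced)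
      show "finite K" using finS by (simp add: K_def)
      show "f k \<subseteq> I" if "k \<in> K" for k
        using that by (auto simp: K_def f_def B_def P_def split: sum.splits)
      fix i assume i: "i \<in> I"
      have "(\<Sum>l<W. vertex (B l) i) = (\<Sum>l<W. 2 * of_bool (l < b i) - 1)"
        using i by (intro sum.cong) (auto simp: vertex_def B_def)
      also have "\<dots> = 2 * real (card ({..<W} \<inter> {..<b i})) - real W"
        by (simp add: sum_subtractf sum_of_bool_eq lessThan_def flip: sum_distrib_left)
      also have "{..<W} \<inter> {..<b i} = {..<b i}" using bW[OF i] by auto
      finally show "(\<Sum>k\<in>K. vertex (f k) i) = 0"
        using b[OF i] unfolding sumK[of "\<lambda>A. vertex A i"] s_eq by simp
    qed
    ultimately have 1: "\<bar>(\<Sum>A\<in>P. real (n A) * F A) + (\<Sum>l<W. F (B l))\<bar> \<le> 320 * \<epsilon> * (real T + real W)"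
      by (simp add: sumK)
    have 2: "\<bar>\<Sum>l<W. F (B l)\<bar> \<le> real W * M"
      by (rule order_trans[OF sum_abs], rule order_trans[OF sum_mono[of _ _ "\<lambda>_. M"]])
        (auto intro!: M simp: B_def)
    have "\<bar>real N * (\<Sum>A\<in>P. w A * F A) - (\<Sum>A\<in>P. real (n A) * F A)\<bar> = \<bar>\<Sum>A\<in>P. (real N * w A - real (n A)) * F A\<bar>"
      by (simp add: algebra_simps sum_subtractf flip: sum_distrib_left)
    also have "\<dots> \<le> (\<Sum>A\<in>P. 1 * M)"
      using n M by (intro order_trans[OF sum_abs] sum_mono, unfold abs_mult)
        (intro mult_mono, auto simp: P_def diff_le_eq add.commute)
    finally have 3: "\<bar>real N * (\<Sum>A\<in>P. w A * F A) - (\<Sum>A\<in>P. real (n A) * F A)\<bar> \<le> real p * M"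
      by (simp add: p_def)
    have "real T \<le> real N * (\<Sum>A\<in>P. w A)"
      unfolding T_def sum_distrib_left of_nat_sum by (intro sum_mono n)
    then have 4: "320 * \<epsilon> * (real T + real W) \<le> 320 * \<epsilon> * (real N * (\<Sum>A\<in>P. w A) + real (p + 1))"
      using W eps_nonneg by (intro mult_left_mono add_mono) auto
    have 5: "real W * M \<le> real (p + 1) * M" using W M0 by (intro mult_right_mono) auto
    have "\<bar>real N * (\<Sum>A\<in>P. w A * F A)\<bar> \<le> 320 * \<epsilon> * (real N * (\<Sum>A\<in>P. w A) + real (p + 1)) + real (p + 1) * M + real p * M"
      using 1 2 3 4 5 by linarith
    then show ?thesis by (simp add: abs_mult algebra_simps)
  qed
  assume "\<not> ?thesis"
  then have "0 < \<bar>\<Sum>A\<in>P. w A * F A\<bar> - 320 * \<epsilon> * (\<Sum>A\<in>P. w A)" by (simp add: P_def)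
  then obtain N :: nat where "(320 * \<epsilon> + M) * real (p + 1) + real p * M
      < real N * (\<bar>\<Sum>A\<in>P. w A * F A\<bar> - 320 * \<epsilon> * (\<Sum>A\<in>P. w A))"
    using ex_less_of_nat_mult by blast
  with key[of N] show False by simp
qed

section \<open>Representing points of the cube by vertices\<close>

definition vertex_representation :: "('i \<Rightarrow> real) \<Rightarrow> ('i set \<Rightarrow> real) \<Rightarrow> real \<Rightarrow> bool" where
  "vertex_representation a w e \<longleftrightarrow> (\<forall>A. 0 \<le> w A) \<and> (\<Sum>A\<in>Pow I. w A) = 1 \<and>
     (\<forall>i\<in>I. (\<Sum>A\<in>Pow I. w A * vertex A i) = a i) \<and> \<bar>\<phi> a - (\<Sum>A\<in>Pow I. w A * F A)\<bar> \<le> e"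

lemma vertex_representation_vertex:
  assumes "A \<subseteq> I"
  shows "vertex_representation (vertex A) (\<lambda>B. of_bool (B = A)) 0"
proof -
  have "(\<Sum>B\<in>Pow I. of_bool (B = A) * g B) = (g A :: real)" for g
    using assms finite_I by (subst sum.mono_neutral_right[of _ "{A}"]) auto
  from this[of "\<lambda>_. 1"] this show ?thesis
    by (simp add: vertex_representation_def F_def)
qed

lemma vertex_representation_cong:
  assumes "vertex_representation a w e" "\<And>i. i \<in> I \<Longrightarrow> a i = b i" "e \<le> e'"
  shows "vertex_representation b w e'"
  using assms \<phi>_cong[of a b] by (auto simp: vertex_representation_def)

lemma vertex_representation_combine:
  assumes a: "vertex_representation a w e" "a \<in> Q" and b: "vertex_representation b v d" "b \<in> Q"
    and t: "0 \<le> t" "t \<le> 1"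
  shows "vertex_representation (\<lambda>i. t * a i + (1 - t) * b i) (\<lambda>A. t * w A + (1 - t) * v A)
    (\<epsilon> + t * e + (1 - t) * d)"
proof -
  have sum_eq: "(\<Sum>A\<in>Pow I. (t * w A + (1 - t) * v A) * g A)
      = t * (\<Sum>A\<in>Pow I. w A * g A) + (1 - t) * (\<Sum>A\<in>Pow I. v A * g A)" for g
    by (simp add: algebra_simps sum.distrib sum_subtractf sum_distrib_left)
  have "\<bar>t * (\<phi> a - (\<Sum>A\<in>Pow I. w A * F A))\<bar> \<le> t * e"
    using a t by (auto simp: vertex_representation_def abs_mult intro!: mult_left_mono)
  moreover have "\<bar>(1 - t) * (\<phi> b - (\<Sum>A\<in>Pow I. v A * F A))\<bar> \<le> (1 - t) * d"
    using b t by (auto simp: vertex_representation_def abs_mult intro!: mult_left_mono)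
  moreover note \<phi>_affine[OF a(2) b(2) t]
  ultimately have "\<bar>\<phi> (\<lambda>i. t * a i + (1 - t) * b i) - (\<Sum>A\<in>Pow I. (t * w A + (1 - t) * v A) * F A)\<bar>
      \<le> \<epsilon> + t * e + (1 - t) * d"
    unfolding sum_eq by (simp only: right_diff_distrib)
  then show ?thesis
    using a b t sum_eq[of "\<lambda>_. 1"] by (auto simp: vertex_representation_def sum_eq)
qed

text \<open>Coordinates are pushed to their two extreme values one at a time, each at the price
  \<epsilon>. The dependence on the dimension is harmless, as this is only the starting point of the
  expansion in binary digits.\<close>

lemma crude_vertex_representation:
  assumes "a \<in> Q" "J \<subseteq> I" "\<And>i. i \<in> I - J \<Longrightarrow> \<bar>a i\<bar> = 1"
  shows "\<exists>w. vertex_representation a w (real (card J) * \<epsilon>)"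
proof -
  have "finite J" using assms(2) finite_I finite_subset by blast
  then show ?thesis using assms
  proof (induction J arbitrary: a)
    case empty
    have "a i = vertex {i \<in> I. a i = 1} i" if "i \<in> I" for i
      using empty(3)[of i] that by (auto simp: vertex_def)
    then show ?case
      using vertex_representation_cong[OF vertex_representation_vertex[of "{i \<in> I. a i = 1}"], of a 0]
      by fastforce
  next
    case (insert j J)
    have "\<exists>w. vertex_representation (a(j := s)) w (real (card J) * \<epsilon>)" if "\<bar>s\<bar> = 1" for s
      using insert.prems that by (intro insert.IH) (auto simp: Q_def)
    from this[of 1] this[of "-1"] obtain w v where
      w: "vertex_representation (a(j := 1)) w (real (card J) * \<epsilon>)" and
      v: "vertex_representation (a(j := -1)) v (real (card J) * \<epsilon>)" by auto
    define t where "t = (1 + a j) / 2"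
    have "\<bar>a j\<bar> \<le> 1" using insert.prems by (auto simp: Q_def)
    then have t: "0 \<le> t" "t \<le> 1" by (auto simp: t_def)
    have "vertex_representation (\<lambda>i. t * (a(j := 1)) i + (1 - t) * (a(j := -1)) i) (\<lambda>A. t * w A + (1 - t) * v A)
        (\<epsilon> + t * (real (card J) * \<epsilon>) + (1 - t) * (real (card J) * \<epsilon>))"
      using insert.prems(1) by (intro vertex_representation_combine w v t) (auto simp: Q_def)
    then show ?case
      using insert.hyps
      by (intro exI[of _ "\<lambda>A. t * w A + (1 - t) * v A"], elim vertex_representation_cong)
        (auto simp: t_def field_simps)
  qed
qed

text \<open>Each binary digit halves the previous error and adds \<open>\<epsilon>\<close>.\<close>

lemma dyadic_vertex_representation:
  assumes "a \<in> Q"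
  shows "\<exists>w. vertex_representation a w (2 * \<epsilon> + real (card I) * \<epsilon> / 2 ^ n)"
  using assms
proof (induction n arbitrary: a)
  case 0
  then obtain w where "vertex_representation a w (real (card I) * \<epsilon>)"
    using crude_vertex_representation[of a I] by auto
  then have "vertex_representation a w (2 * \<epsilon> + real (card I) * \<epsilon> / 2 ^ 0)"
    by (rule vertex_representation_cong) (use eps_nonneg in auto)
  then show ?case by blast
next
  case (Suc n)
  define A where "A = {i \<in> I. 0 \<le> a i}"
  \<comment> \<open>\<open>a\<close> is the midpoint of the vertex of its sign pattern and of
    \<open>b\<close>. The choice of signs keeps \<open>b\<close> in the cube, so \<open>b\<close>
    carries the remaining digits.\<close>
  define b where "b i = 2 * a i - vertex A i" for i
  have bQ: "b \<in> Q" using Suc.prems by (auto simp: Q_def b_def vertex_def A_def abs_le_iff)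
  obtain w where w: "vertex_representation b w (2 * \<epsilon> + real (card I) * \<epsilon> / 2 ^ n)"
    using Suc.IH[OF bQ] by blast
  have "A \<subseteq> I" by (auto simp: A_def)
  have "vertex_representation (\<lambda>i. 1 / 2 * vertex A i + (1 - 1 / 2) * b i)
      (\<lambda>B. 1 / 2 * of_bool (B = A) + (1 - 1 / 2) * w B)
      (\<epsilon> + 1 / 2 * 0 + (1 - 1 / 2) * (2 * \<epsilon> + real (card I) * \<epsilon> / 2 ^ n))"
    by (intro vertex_representation_combine vertex_representation_vertex w bQ \<open>A \<subseteq> I\<close>) auto
  then have "vertex_representation a (\<lambda>B. 1 / 2 * of_bool (B = A) + (1 - 1 / 2) * w B)
      (2 * \<epsilon> + real (card I) * \<epsilon> / 2 ^ Suc n)"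
    by (rule vertex_representation_cong) (auto simp: b_def field_simps)
  then show ?case by blast
qed

text \<open>After \<open>card I\<close> digits the dimensional term is at most \<epsilon>, because
  \<open>card I <= 2 ^ card I\<close>.\<close>

lemma ex_vertex_representation:
  assumes "a \<in> Q"
  shows "\<exists>w. vertex_representation a w (3 * \<epsilon>)"
proof -
  obtain w where w: "vertex_representation a w (2 * \<epsilon> + real (card I) * \<epsilon> / 2 ^ card I)"
    using dyadic_vertex_representation[OF assms] by blast
  have "real (card I) \<le> 2 ^ card I" using of_nat_less_two_power[of "card I"] by (simp add: less_imp_le)
  then have "real (card I) * \<epsilon> \<le> 2 ^ card I * \<epsilon>" using eps_nonneg by (rule mult_right_mono)
  then have "2 * \<epsilon> + real (card I) * \<epsilon> / 2 ^ card I \<le> 3 * \<epsilon>" by (simp add: divide_simps mult_ac)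
  with w show ?thesis using vertex_representation_cong by blast
qed

text \<open>Represent every \<open>p k\<close> and the negative of their barycentre by vertices. The
  combined weights are balanced and have total mass 2, which costs 640 \<epsilon>; the
  representations of the points and of the barycentre cost 3 \<epsilon> each.\<close>

lemma cube_convex_combination:
  assumes K: "finite K" "\<And>k. k \<in> K \<Longrightarrow> p k \<in> Q" "\<And>k. k \<in> K \<Longrightarrow> 0 \<le> l k" "sum l K = 1"
  shows "\<bar>\<phi> (\<lambda>i. \<Sum>k\<in>K. l k * p k i) - (\<Sum>k\<in>K. l k * \<phi> (p k))\<bar> \<le> 646 * \<epsilon>"
proof -
  define b where "b i = (\<Sum>k\<in>K. l k * p k i)" for i
  have bQ: "b \<in> Q" unfolding b_def using K by (rule convex_Q)
  then have "(\<lambda>i. - b i) \<in> Q" by (simp add: Q_def)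
  then obtain v where v: "vertex_representation (\<lambda>i. - b i) v (3 * \<epsilon>)"
    using ex_vertex_representation by blast
  have "\<forall>k\<in>K. \<exists>w. vertex_representation (p k) w (3 * \<epsilon>)"
    using ex_vertex_representation K(2) by blast
  then obtain w where w: "\<And>k. k \<in> K \<Longrightarrow> vertex_representation (p k) (w k) (3 * \<epsilon>)" by metis
  define u where "u A = (\<Sum>k\<in>K. l k * w k A) + v A" for A
  have u_sum: "(\<Sum>A\<in>Pow I. u A * g A) = (\<Sum>k\<in>K. l k * (\<Sum>A\<in>Pow I. w k A * g A)) + (\<Sum>A\<in>Pow I. v A * g A)" for g
    unfolding u_def sum_distrib_left
    by (subst sum.swap) (simp add: distrib_right sum.distrib sum_distrib_right mult.assoc)
  have "\<bar>\<Sum>A\<in>Pow I. u A * F A\<bar> \<le> 320 * \<epsilon> * (\<Sum>A\<in>Pow I. u A)"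
  proof (rule F_balanced_real)
    show "0 \<le> u A" for A
      using v w K(3) by (auto simp: u_def vertex_representation_def intro!: add_nonneg_nonneg sum_nonneg)
    show "(\<Sum>A\<in>Pow I. u A * vertex A i) = 0" if "i \<in> I" for i
      using v w that by (simp add: u_sum vertex_representation_def b_def)
  qed
  moreover have "(\<Sum>A\<in>Pow I. u A) = 2"
    using v w K(4) u_sum[of "\<lambda>_. 1"] by (simp add: vertex_representation_def)
  ultimately have 1: "\<bar>(\<Sum>k\<in>K. l k * (\<Sum>A\<in>Pow I. w k A * F A)) + (\<Sum>A\<in>Pow I. v A * F A)\<bar> \<le> 640 * \<epsilon>"
    by (simp add: u_sum)
  have 2: "\<bar>- \<phi> b - (\<Sum>A\<in>Pow I. v A * F A)\<bar> \<le> 3 * \<epsilon>"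
    using v \<phi>_odd[OF bQ] by (simp add: vertex_representation_def)
  have "\<bar>(\<Sum>k\<in>K. l k * \<phi> (p k)) - (\<Sum>k\<in>K. l k * (\<Sum>A\<in>Pow I. w k A * F A))\<bar>
      = \<bar>\<Sum>k\<in>K. l k * (\<phi> (p k) - (\<Sum>A\<in>Pow I. w k A * F A))\<bar>"
    by (simp add: right_diff_distrib sum_subtractf)
  also have "\<dots> \<le> (\<Sum>k\<in>K. l k * (3 * \<epsilon>))"
    using w K(3) by (intro order_trans[OF sum_abs] sum_mono)
      (auto simp: abs_mult vertex_representation_def intro!: mult_left_mono)
  also have "\<dots> = 3 * \<epsilon>" using K(4) by (simp flip: sum_distrib_right)
  finally show ?thesis using 1 2 unfolding b_def by linarith
qed

end

section \<open>Linear approximation of odd functions\<close>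

definition sublinear :: "('a::real_vector \<Rightarrow> real) \<Rightarrow> bool" where
  "sublinear p \<longleftrightarrow> (\<forall>x y. p (x + y) \<le> p x + p y) \<and> (\<forall>c\<ge>0. \<forall>x. p (c *\<^sub>R x) \<le> c * p x)"

lemma sublinear_zero: "sublinear p \<Longrightarrow> p 0 = 0"
proof -
  assume p: "sublinear p"
  have "p (0 *\<^sub>R 0) \<le> 0 * p 0" "p (0 + 0) \<le> p 0 + p 0"
    using p unfolding sublinear_def by blast+
  then show ?thesis by simp
qed

lemma sublinear_minus: "sublinear p \<Longrightarrow> - p (- x) \<le> p x"
proof -
  assume p: "sublinear p"
  have "p (x + - x) \<le> p x + p (- x)" using p unfolding sublinear_def by blast
  then show ?thesis using sublinear_zero[OF p] by simp
qed

text \<open>The common pattern of three infima below: along a chain, along a direction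
  \<open>y\<close>, and over all representations of a vector by points of the ball.\<close>

lemma sublinear_Inf:
  fixes W :: "'a::real_vector \<Rightarrow> real set"
  assumes ne: "\<And>x. W x \<noteq> {}" and bdd: "\<And>x. bdd_below (W x)"
    and add: "\<And>x y r s. r \<in> W x \<Longrightarrow> s \<in> W y \<Longrightarrow> \<exists>t\<in>W (x + y). t \<le> r + s"
    and scale: "\<And>x r c. r \<in> W x \<Longrightarrow> 0 \<le> c \<Longrightarrow> \<exists>t\<in>W (c *\<^sub>R x). t \<le> c * r"
  shows "sublinear (\<lambda>x. Inf (W x))"
  unfolding sublinear_def
proof (intro conjI allI impI)
  fix x y
  have "Inf (W (x + y)) - s \<le> Inf (W x)" if s: "s \<in> W y" for s
  proof (rule cInf_greatest[OF ne])
    fix r assume "r \<in> W x"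
    then obtain t where "t \<in> W (x + y)" "t \<le> r + s" using add s by blast
    with cInf_lower[OF _ bdd] show "Inf (W (x + y)) - s \<le> r" by fastforce
  qed
  then have "Inf (W (x + y)) - Inf (W x) \<le> Inf (W y)"
    by (intro cInf_greatest[OF ne]) (simp add: algebra_simps)
  then show "Inf (W (x + y)) \<le> Inf (W x) + Inf (W y)" by simp
next
  fix c :: real and x assume c: "0 \<le> c"
  have le: "Inf (W (c *\<^sub>R x)) \<le> c * r" if r: "r \<in> W x" for r
  proof -
    obtain t where "t \<in> W (c *\<^sub>R x)" "t \<le> c * r" using scale[OF r c] by blast
    with cInf_lower[OF _ bdd] show ?thesis by fastforce
  qed
  show "Inf (W (c *\<^sub>R x)) \<le> c * Inf (W x)"
  proof (cases "c = 0")
    case True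
    then show ?thesis using le ne[of x] by auto
  next
    case False
    then have "Inf (W (c *\<^sub>R x)) / c \<le> Inf (W x)"
      using c le by (intro cInf_greatest[OF ne]) (simp add: divide_simps mult.commute)
    then show ?thesis using c False by (simp add: divide_simps mult.commute)
  qed
qed

text \<open>A minimal sublinear functional \<open>q\<close> is linear, since it coincides with
  \<open>\<lambda>x. Inf {q (x + t y) - t q y | t \<ge> 0}\<close> for every \<open>y\<close>.\<close>

lemma Hahn_Banach_sublinear:
  fixes p :: "'a::real_vector \<Rightarrow> real"
  assumes p: "sublinear p"
  shows "\<exists>g. linear g \<and> (\<forall>x. g x \<le> p x)"
proof -
  define A where "A = {q. sublinear q \<and> (\<forall>x. q x \<le> p x)}"
  define R where "R = (\<lambda>a b :: 'a \<Rightarrow> real. \<forall>x. b x \<le> a x)"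
  \<comment> \<open>A lower bound common to all of \<open>A\<close>, which keeps the infimum of a
    chain finite.\<close>
  have lower: "- p (- x) \<le> q x" if "q \<in> A" for q x
  proof -
    have "- p (- x) \<le> - q (- x)" using that by (simp add: A_def)
    also have "\<dots> \<le> q x" using that sublinear_minus by (auto simp: A_def)
    finally show ?thesis .
  qed
  \<comment> \<open>\<open>R\<close> is the reversed pointwise order, so a maximal element is a
    minimal functional.\<close>
  have "\<exists>m\<in>A. \<forall>a\<in>A. R m a \<longrightarrow> a = m"
  proof (rule predicate_Zorn)
    show "partial_order_on A (relation_of R A)"
      by (rule partial_order_on_relation_ofI) (auto simp: R_def fun_eq_iff intro: order.trans antisym)
    fix C assume C: "C \<in> Chains (relation_of R A)"
    then have CA: "C \<subseteq> A" by (rule Chains_relation_of)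
    show "\<exists>u\<in>A. \<forall>a\<in>C. R a u"
    proof (cases "C = {}")
      case True
      then show ?thesis using p by (intro bexI[of _ p]) (auto simp: A_def)
    next
      case False
      define W where "W x = (\<lambda>q. q x) ` C" for x
      have bdd: "bdd_below (W x)" for x
        using lower CA by (intro bdd_belowI[of _ "- p (- x)"]) (auto simp: W_def)
      have "sublinear (\<lambda>x. Inf (W x))"
      proof (rule sublinear_Inf)
        show "W x \<noteq> {}" for x using False by (simp add: W_def)
        show "bdd_below (W x)" for x by (rule bdd)
        fix x y r s assume "r \<in> W x" "s \<in> W y"
        then obtain a b where ab: "a \<in> C" "b \<in> C" "r = a x" "s = b y" by (auto simp: W_def)
        then have "R a b \<or> R b a" using C by (auto simp: Chains_def relation_of_def)
        then obtain c where c: "c \<in> C" "c x \<le> a x" "c y \<le> b y" using ab by (auto simp: R_def)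
        have "c (x + y) \<le> c x + c y" using c(1) CA by (auto simp: A_def sublinear_def)
        with c ab show "\<exists>t\<in>W (x + y). t \<le> r + s" by (auto simp: W_def intro!: bexI[of _ c])
      next
        fix x r and c :: real assume "r \<in> W x" "0 \<le> c"
        with CA show "\<exists>t\<in>W (c *\<^sub>R x). t \<le> c * r"
          by (force simp: W_def A_def sublinear_def)
      qed
      moreover have le: "Inf (W x) \<le> a x" if "a \<in> C" for a x
        using that by (intro cInf_lower bdd) (auto simp: W_def)
      moreover have "Inf (W x) \<le> p x" for x
      proof -
        obtain a where a: "a \<in> C" using False by blast
        then have "a x \<le> p x" using CA by (auto simp: A_def)
        with le[OF a, of x] show ?thesis by linarith
      qed
      ultimately show ?thesis
        by (intro bexI[of _ "\<lambda>x. Inf (W x)"]) (auto simp: A_def R_def)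
    qed
  qed
  then obtain q where q: "q \<in> A" and minimal: "\<And>a. a \<in> A \<Longrightarrow> (\<And>x. a x \<le> q x) \<Longrightarrow> a = q"
    by (auto simp: R_def)
  have sub: "sublinear q" using q by (simp add: A_def)
  have q_add: "q (x + y) \<le> q x + q y" and q_scale: "0 \<le> c \<Longrightarrow> q (c *\<^sub>R x) \<le> c * q x" for x y c
    using sub by (auto simp: sublinear_def)
  have q_scale_eq: "q (c *\<^sub>R x) = c * q x" if "0 \<le> c" for c x
  proof (cases "c = 0")
    case True
    then show ?thesis using sublinear_zero[OF sub] by simp
  next
    case False
    then have "c * q ((1 / c) *\<^sub>R (c *\<^sub>R x)) \<le> c * ((1 / c) * q (c *\<^sub>R x))"
      using that by (intro mult_left_mono q_scale) auto
    then show ?thesis using False q_scale[OF that, of x] by simp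
  qed
  have additive: "q (x + y) = q x + q y" for x y
  proof -
    define W where "W x = (\<lambda>t. q (x + t *\<^sub>R y) - t * q y) ` {0..}" for x
    have bdd: "bdd_below (W x)" for x
    proof (rule bdd_belowI[of _ "- q (- x)"])
      fix r assume "r \<in> W x"
      then obtain t where t: "0 \<le> t" "r = q (x + t *\<^sub>R y) - t * q y" by (auto simp: W_def)
      have "t * q y = q ((x + t *\<^sub>R y) + (- x))" using q_scale_eq[OF t(1), of y] by simp
      also have "\<dots> \<le> q (x + t *\<^sub>R y) + q (- x)" by (rule q_add)
      finally show "- q (- x) \<le> r" using t by simp
    qed
    have "sublinear (\<lambda>x. Inf (W x))"
    proof (rule sublinear_Inf)
      show "W x \<noteq> {}" for x by (simp add: W_def)
      show "bdd_below (W x)" for x by (rule bdd)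
      fix x z r s assume "r \<in> W x" "s \<in> W z"
      then obtain a b where ab: "0 \<le> a" "0 \<le> b" "r = q (x + a *\<^sub>R y) - a * q y" "s = q (z + b *\<^sub>R y) - b * q y"
        by (auto simp: W_def)
      have "q ((x + z) + (a + b) *\<^sub>R y) \<le> q (x + a *\<^sub>R y) + q (z + b *\<^sub>R y)"
        using q_add[of "x + a *\<^sub>R y" "z + b *\<^sub>R y"] by (simp add: algebra_simps)
      with ab show "\<exists>t\<in>W (x + z). t \<le> r + s"
        by (auto simp: W_def algebra_simps intro!: bexI[of _ "a + b"])
    next
      fix x r and c :: real assume "r \<in> W x" and c: "0 \<le> c"
      then obtain a where a: "0 \<le> a" "r = q (x + a *\<^sub>R y) - a * q y" by (auto simp: W_def)
      have "q (c *\<^sub>R x + (c * a) *\<^sub>R y) \<le> c * q (x + a *\<^sub>R y)"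
        using q_scale[OF c, of "x + a *\<^sub>R y"] by (simp add: algebra_simps)
      then have "q (c *\<^sub>R x + (c * a) *\<^sub>R y) - (c * a) * q y \<le> c * r"
        by (simp add: a algebra_simps)
      with a c show "\<exists>t\<in>W (c *\<^sub>R x). t \<le> c * r" by (auto simp: W_def)
    qed
    moreover have le: "Inf (W x) \<le> q (x + t *\<^sub>R y) - t * q y" if "0 \<le> t" for x t
      using that by (intro cInf_lower bdd) (auto simp: W_def)
    from le[of 0] have le0: "Inf (W x) \<le> q x" for x by simp
    moreover have "q x \<le> p x" for x using q by (simp add: A_def)
    ultimately have "(\<lambda>x. Inf (W x)) \<in> A" by (auto simp: A_def intro: order_trans)
    then have "(\<lambda>x. Inf (W x)) = q" using le0 by (rule minimal)
    \<comment> \<open>Minimality identifies the infimum with \<open>q\<close>, and its member with t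
      = 1 is the missing half of additivity.\<close>
    then have "q x \<le> q (x + 1 *\<^sub>R y) - 1 * q y" using le[of 1 x] by (metis zero_le_one)
    then show ?thesis using q_add[of x y] by simp
  qed
  have neg: "q (- x) = - q x" for x
    using additive[of x "- x"] sublinear_zero[OF sub] by simp
  have "linear q"
  proof (rule linearI)
    show "q (c *\<^sub>R x) = c *\<^sub>R q x" for c x
    proof (cases "0 \<le> c")
      case False
      then have "q (- ((- c) *\<^sub>R x)) = - ((- c) * q x)" unfolding neg by (subst q_scale_eq) auto
      then show ?thesis by simp
    qed (simp add: q_scale_eq)
  qed (rule additive)
  moreover have "\<forall>x. q x \<le> p x" using q by (simp add: A_def)
  ultimately show ?thesis by blast
qed

section \<open>From convex combinations of many points to a linear functional\<close>

definition multi_affine_on :: "'a::real_vector set \<Rightarrow> real \<Rightarrow> ('a \<Rightarrow> real) \<Rightarrow> bool" where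
  "multi_affine_on D C f \<longleftrightarrow> (\<forall>S u. finite S \<and> S \<subseteq> D \<and> (\<forall>x\<in>S. 0 \<le> u x) \<and> sum u S = 1 \<longrightarrow>
     \<bar>f (\<Sum>x\<in>S. u x *\<^sub>R x) - (\<Sum>x\<in>S. u x * f x)\<bar> \<le> C)"

lemma multi_affine_onD:
  assumes "multi_affine_on D C f" "finite S" "S \<subseteq> D" "\<And>x. x \<in> S \<Longrightarrow> 0 \<le> u x" "sum u S = 1"
  shows "\<bar>f (\<Sum>x\<in>S. u x *\<^sub>R x) - (\<Sum>x\<in>S. u x * f x)\<bar> \<le> C"
  using assms unfolding multi_affine_on_def by simp

text \<open>Combinations are indexed by sets of points, so adding two of them means adding the
  weights at common points.\<close>

lemma sum_Un_weights:
  fixes h :: "'a \<Rightarrow> 'b::real_vector"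
  assumes "finite S" "finite T"
  shows "(\<Sum>z\<in>S \<union> T. ((if z \<in> S then u z else 0) + (if z \<in> T then v z else 0)) *\<^sub>R h z)
    = (\<Sum>z\<in>S. u z *\<^sub>R h z) + (\<Sum>z\<in>T. v z *\<^sub>R h z)"
proof -
  have "(\<Sum>z\<in>S \<union> T. (if z \<in> S then u z else 0) *\<^sub>R h z) = (\<Sum>z\<in>S. u z *\<^sub>R h z)"
    using assms by (intro sum.mono_neutral_cong_right) auto
  moreover have "(\<Sum>z\<in>S \<union> T. (if z \<in> T then v z else 0) *\<^sub>R h z) = (\<Sum>z\<in>T. v z *\<^sub>R h z)"
    using assms by (intro sum.mono_neutral_cong_right) auto
  ultimately show ?thesis by (simp only: scaleR_add_left sum.distrib)
qed

lemma closed_unit_ball_uminus: "subspace X \<Longrightarrow> x \<in> closed_unit_ball X \<Longrightarrow> - x \<in> closed_unit_ball X"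
  by (simp add: closed_unit_ball_def subspace_neg)

lemma closed_unit_ball_0: "subspace X \<Longrightarrow> 0 \<in> closed_unit_ball X"
  by (simp add: closed_unit_ball_def subspace_0)

lemma closed_unit_ball_scaleR:
  "subspace X \<Longrightarrow> x \<in> closed_unit_ball X \<Longrightarrow> \<bar>t\<bar> \<le> 1 \<Longrightarrow> t *\<^sub>R x \<in> closed_unit_ball X"
  by (auto simp: closed_unit_ball_def subspace_scale mult_le_one)

lemma convex_closed_unit_ball: "subspace X \<Longrightarrow> convex (closed_unit_ball X)"
proof -
  assume "subspace X"
  have "closed_unit_ball X = X \<inter> cball 0 1" by (auto simp: closed_unit_ball_def)
  then show ?thesis by (simp add: \<open>subspace X\<close> convex_Int subspace_imp_convex)
qed

text \<open>Minimise the corresponding sums of \<open>f + C\<close> over all nonnegative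
  combinations of ball points that represent \<open>x\<close>. The minimum is sublinear and not
  minus infinity, because a combination representing 0 has a nonnegative value by multi-affinity. A
  linear \<open>g\<close> below it satisfies \<open>g <= f + C\<close> on the ball, and oddness
  turns this into the two-sided bound.\<close>

lemma linear_approximation:
  fixes f :: "'a::real_normed_vector \<Rightarrow> real"
  assumes X: "subspace X" and D: "D = closed_unit_ball X"
    and odd: "\<And>x. x \<in> D \<Longrightarrow> f (- x) = - f x" and f: "multi_affine_on D C f"
  shows "\<exists>g. linear g \<and> (\<forall>x\<in>D. \<bar>f x - g x\<bar> \<le> C)"
proof -
  \<comment> \<open>The Hahn--Banach lemma concerns whole types; the projection onto
    \<open>X\<close> makes every vector of the type representable.\<close>
  obtain \<pi> where \<pi>: "range \<pi> \<subseteq> X" "linear \<pi>" "\<And>x. x \<in> X \<Longrightarrow> \<pi> x = x"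
    using linear_exists_left_inverse_on[OF linear_id X] by auto
  define W where "W x = {(\<Sum>y\<in>S. u y * (f y + C)) | S u. finite S \<and> S \<subseteq> D \<and> (\<forall>y\<in>S. 0 \<le> u y)
    \<and> (\<Sum>y\<in>S. u y *\<^sub>R y) = \<pi> x}" for x
  have WI: "(\<Sum>y\<in>S. u y * (f y + C)) \<in> W x" if "finite S" "S \<subseteq> D" "\<And>y. y \<in> S \<Longrightarrow> 0 \<le> u y"
    "(\<Sum>y\<in>S. u y *\<^sub>R y) = \<pi> x" for S u x
    using that unfolding W_def by blast
  have WE: "\<exists>S u. finite S \<and> S \<subseteq> D \<and> (\<forall>y\<in>S. 0 \<le> u y) \<and> (\<Sum>y\<in>S. u y *\<^sub>R y) = \<pi> x
      \<and> r = (\<Sum>y\<in>S. u y * (f y + C))" if "r \<in> W x" for r x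
    using that unfolding W_def by (elim CollectE exE conjE) (intro exI conjI)
  have ne: "W x \<noteq> {}" for x
  proof -
    define c where "c = norm (\<pi> x) + 1"
    have c: "c > 0" "norm (\<pi> x) \<le> c" by (auto simp: c_def add_nonneg_pos)
    have "\<pi> x \<in> X" using \<pi>(1) by blast
    then have "(1 / c) *\<^sub>R \<pi> x \<in> D"
      using c X by (auto simp: D closed_unit_ball_def divide_simps subspace_scale)
    then have "(\<Sum>y\<in>{(1 / c) *\<^sub>R \<pi> x}. c * (f y + C)) \<in> W x"
      using c by (intro WI) auto
    then show ?thesis by blast
  qed
  have add: "r + s \<in> W (x + y)" if rs: "r \<in> W x" "s \<in> W y" for r s x y
  proof -
    obtain S u where S: "finite S" "S \<subseteq> D" "\<forall>y\<in>S. 0 \<le> u y" "(\<Sum>y\<in>S. u y *\<^sub>R y) = \<pi> x"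
        "r = (\<Sum>y\<in>S. u y * (f y + C))" using WE[OF rs(1)] by (elim exE conjE)
    obtain T v where T: "finite T" "T \<subseteq> D" "\<forall>y\<in>T. 0 \<le> v y" "(\<Sum>y\<in>T. v y *\<^sub>R y) = \<pi> y"
        "s = (\<Sum>y\<in>T. v y * (f y + C))" using WE[OF rs(2)] by (elim exE conjE)
    define w where "w z = (if z \<in> S then u z else 0) + (if z \<in> T then v z else 0)" for z
    have "(\<Sum>z\<in>S \<union> T. w z * (f z + C)) \<in> W (x + y)"
    proof (rule WI)
      show "(\<Sum>z\<in>S \<union> T. w z *\<^sub>R z) = \<pi> (x + y)"
        unfolding w_def using sum_Un_weights[OF S(1) T(1), of u v "\<lambda>z. z"] S(4) T(4) \<pi>(2)
        by (simp add: linear_add)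
    qed (use S T in \<open>auto simp: w_def\<close>)
    moreover have "(\<Sum>z\<in>S \<union> T. w z * (f z + C)) = r + s"
      unfolding w_def using sum_Un_weights[OF S(1) T(1), of u v "\<lambda>z. f z + C"] S(5) T(5) by simp
    ultimately show ?thesis by simp
  qed
  have scale: "c * r \<in> W (c *\<^sub>R x)" if rs: "r \<in> W x" "0 \<le> c" for c r x
  proof -
    obtain S u where S: "finite S" "S \<subseteq> D" "\<forall>y\<in>S. 0 \<le> u y" "(\<Sum>y\<in>S. u y *\<^sub>R y) = \<pi> x"
        "r = (\<Sum>y\<in>S. u y * (f y + C))" using WE[OF rs(1)] by (elim exE conjE)
    have "(\<Sum>y\<in>S. (c * u y) * (f y + C)) \<in> W (c *\<^sub>R x)"
    proof (rule WI)
      show "(\<Sum>y\<in>S. (c * u y) *\<^sub>R y) = \<pi> (c *\<^sub>R x)"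
        using \<pi>(2) by (simp add: linear_scale S(4)[symmetric] scaleR_sum_right)
    qed (use S rs in auto)
    then show ?thesis by (simp add: S(5) sum_distrib_left mult.assoc)
  qed
  have nonneg: "0 \<le> r" if rs: "r \<in> W 0" for r
  proof -
    obtain S u where S: "finite S" "S \<subseteq> D" "\<forall>y\<in>S. 0 \<le> u y" "(\<Sum>y\<in>S. u y *\<^sub>R y) = \<pi> 0"
        "r = (\<Sum>y\<in>S. u y * (f y + C))" using WE[OF rs(1)] by (elim exE conjE)
    \<comment> \<open>Division by the total weight \<open>U\<close> produces a convex combination of
      value 0, where \<open>f\<close> vanishes by oddness.\<close>
    define U where "U = sum u S"
    have U0: "U \<ge> 0" unfolding U_def using S(3) by (intro sum_nonneg) simp
    show ?thesis
    proof (cases "U = 0")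
      case True
      then have "\<forall>y\<in>S. u y = 0" using S unfolding U_def by (simp add: sum_nonneg_eq_0_iff)
      then show ?thesis by (simp add: S(5))
    next
      case False
      have f0: "f 0 = 0" using odd[of 0] closed_unit_ball_0[OF X] by (simp add: D)
      have "(\<Sum>y\<in>S. (u y / U) *\<^sub>R y) = (1 / U) *\<^sub>R (\<Sum>y\<in>S. u y *\<^sub>R y)"
        by (simp add: scaleR_sum_right)
      also have "\<dots> = 0" using S(4) \<pi>(2) by (simp add: linear_0)
      finally have 0: "(\<Sum>y\<in>S. (u y / U) *\<^sub>R y) = 0" .
      have "\<bar>f (\<Sum>y\<in>S. (u y / U) *\<^sub>R y) - (\<Sum>y\<in>S. u y / U * f y)\<bar> \<le> C"
        using S U0 False
        by (intro multi_affine_onD[OF f]) (auto simp: U_def simp flip: sum_divide_distrib)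
      then have "- C \<le> (\<Sum>y\<in>S. u y / U * f y)" by (simp add: 0 f0)
      then have "- C * U \<le> (\<Sum>y\<in>S. u y / U * f y) * U" using U0 by (rule mult_right_mono)
      also have "\<dots> = (\<Sum>y\<in>S. u y * f y)" using False by (simp add: sum_distrib_right)
      finally have "- C * U \<le> (\<Sum>y\<in>S. u y * f y)" .
      moreover have "r = (\<Sum>y\<in>S. u y * f y) + U * C"
        unfolding S(5) U_def by (simp only: distrib_left sum.distrib sum_distrib_right)
      ultimately show ?thesis by (simp add: mult.commute)
    qed
  qed
  have bdd: "bdd_below (W x)" for x
  proof -
    obtain s where s: "s \<in> W (- x)" using ne by blast
    have "- s \<le> r" if "r \<in> W x" for r using nonneg[of "r + s"] add[OF that s] by simp
    then show ?thesis by (rule bdd_belowI)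
  qed
  have "sublinear (\<lambda>x. Inf (W x))"
    using add scale by (intro sublinear_Inf ne bdd) blast+
  then obtain g where g: "linear g" "\<And>x. g x \<le> Inf (W x)" using Hahn_Banach_sublinear by blast
  have le: "g x \<le> f x + C" if "x \<in> D" for x
  proof -
    have "(\<Sum>y\<in>{x}. 1 * (f y + C)) \<in> W x"
      using that \<pi>(3) by (intro WI) (auto simp: D closed_unit_ball_def)
    then have "Inf (W x) \<le> f x + C" using cInf_lower[OF _ bdd] by fastforce
    with g(2)[of x] show ?thesis by linarith
  qed
  have "\<bar>f x - g x\<bar> \<le> C" if "x \<in> D" for x
  proof -
    have "- x \<in> D" using that X closed_unit_ball_uminus by (simp add: D)
    from le[OF this] have "- g x \<le> - f x + C" using odd[OF that] g(1) by (simp add: linear_neg)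
    with le[OF that] show ?thesis by (simp add: abs_le_iff)
  qed
  with g(1) show ?thesis by blast
qed

lemma affine_admissible_ball:
  fixes X :: "'a::real_normed_vector set"
  assumes X: "subspace X" and D: "D = closed_unit_ball X"
    and multi: "\<And>f \<epsilon>. 0 \<le> \<epsilon> \<Longrightarrow> eps_affine_on D \<epsilon> f \<Longrightarrow> (\<And>x. x \<in> D \<Longrightarrow> f (- x) = - f x)
      \<Longrightarrow> multi_affine_on D (C * \<epsilon>) f"
  shows "affine_admissible D (C + 1)"
  unfolding affine_admissible_def
proof (intro allI impI)
  fix \<epsilon> and f :: "'a \<Rightarrow> real" assume \<epsilon>: "0 \<le> \<epsilon>" and f: "eps_affine_on D \<epsilon> f"
  have neg: "- x \<in> D" if "x \<in> D" for x using that X closed_unit_ball_uminus by (simp add: D)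
  define h where "h x = (f x - f (- x)) / 2" for x
  have h_odd: "h (- x) = - h x" for x
    by (simp only: h_def minus_minus minus_divide_left minus_diff_eq)
  have avg: "\<bar>(p - q) / 2\<bar> \<le> \<epsilon>" if "\<bar>p\<bar> \<le> \<epsilon>" "\<bar>q\<bar> \<le> \<epsilon>" for p q :: real
    using that abs_triangle_ineq4[of p q] by simp
  have "eps_affine_on D \<epsilon> h"
    unfolding eps_affine_on_def
  proof (intro ballI)
    fix x y and t :: real assume xy: "x \<in> D" "y \<in> D" "t \<in> {0..1}"
    have "\<bar>f (t *\<^sub>R x + (1 - t) *\<^sub>R y) - t * f x - (1 - t) * f y\<bar> \<le> \<epsilon>"
      using f xy by (auto simp: eps_affine_on_def)
    moreover have "\<bar>f (t *\<^sub>R (- x) + (1 - t) *\<^sub>R (- y)) - t * f (- x) - (1 - t) * f (- y)\<bar> \<le> \<epsilon>"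
      using xy by (intro f[unfolded eps_affine_on_def, rule_format] neg)
    moreover have "- (t *\<^sub>R x + (1 - t) *\<^sub>R y) = t *\<^sub>R (- x) + (1 - t) *\<^sub>R (- y)" by simp
    moreover have "h (t *\<^sub>R x + (1 - t) *\<^sub>R y) - t * h x - (1 - t) * h y =
        ((f (t *\<^sub>R x + (1 - t) *\<^sub>R y) - t * f x - (1 - t) * f y)
          - (f (- (t *\<^sub>R x + (1 - t) *\<^sub>R y)) - t * f (- x) - (1 - t) * f (- y))) / 2"
    proof -
      have "(a - a') / 2 - t * ((b - b') / 2) - (1 - t) * ((c - c') / 2)
          = ((a - t * b - (1 - t) * c) - (a' - t * b' - (1 - t) * c')) / 2" for a a' b b' c c' :: real
        by (simp add: field_simps)
      then show ?thesis unfolding h_def .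
    qed
    ultimately show "\<bar>h (t *\<^sub>R x + (1 - t) *\<^sub>R y) - t * h x - (1 - t) * h y\<bar> \<le> \<epsilon>"
      by (simp only: avg)
  qed
  then have "multi_affine_on D (C * \<epsilon>) h" using \<epsilon> by (intro multi h_odd)
  then have "\<exists>g. linear g \<and> (\<forall>x\<in>D. \<bar>h x - g x\<bar> \<le> C * \<epsilon>)"
    by (rule linear_approximation[OF X D, rotated]) (rule h_odd)
  then obtain g where g: "linear g" "\<And>x. x \<in> D \<Longrightarrow> \<bar>h x - g x\<bar> \<le> C * \<epsilon>" by blast
  \<comment> \<open>0 is the midpoint of \<open>x\<close> and \<open>- x\<close>, so the even part
    of \<open>f\<close> is within \<epsilon> of \<open>f 0\<close>; this is the
    \<open>+ 1\<close>.\<close>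
  have "\<bar>f x - (f 0 + g x)\<bar> \<le> (C + 1) * \<epsilon>" if x: "x \<in> D" for x
  proof -
    have "\<bar>f ((1 / 2) *\<^sub>R x + (1 - 1 / 2) *\<^sub>R (- x)) - 1 / 2 * f x - (1 - 1 / 2) * f (- x)\<bar> \<le> \<epsilon>"
      using f x neg[OF x] unfolding eps_affine_on_def by (intro f[unfolded eps_affine_on_def, rule_format]) auto
    then have "\<bar>f 0 - f x / 2 - f (- x) / 2\<bar> \<le> \<epsilon>" by simp
    with g(2)[OF x] show ?thesis by (simp add: h_def abs_le_iff field_simps)
  qed
  moreover have "eps_affine_on D 0 (\<lambda>x. f 0 + g x)"
    unfolding eps_affine_on_def linear_add[OF g(1)] linear_scale[OF g(1)] by (simp add: algebra_simps)
  ultimately show "\<exists>g. eps_affine_on D 0 g \<and> (SUP x\<in>D. ereal \<bar>f x - g x\<bar>) \<le> ereal ((C + 1) * \<epsilon>)"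
    by (intro exI[of _ "\<lambda>x. f 0 + g x"]) (simp add: SUP_le_iff)
qed

lemma affine_const_le: "affine_admissible D \<kappa> \<Longrightarrow> affine_const D \<le> ereal \<kappa>"
  unfolding affine_const_def by (intro Inf_lower) simp

lemma Jensen_const_le: "Jensen_admissible D \<kappa> \<Longrightarrow> Jensen_const D \<le> ereal \<kappa>"
  unfolding Jensen_const_def by (intro Inf_lower) simp

section \<open>Inner product spaces\<close>

text \<open>Random signs are modelled by the uniformly chosen set \<open>P\<close> of indices with a minus sign.\<close>

definition signed_sum :: "'k set \<Rightarrow> 'k set \<Rightarrow> ('k \<Rightarrow> 'a::real_vector) \<Rightarrow> 'a" where
  "signed_sum B P v = sum v (B - P) - sum v P"

text \<open>Signs on disjoint blocks are independent.\<close>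

lemma sum_Pow_Un:
  assumes "finite B" "finite C" "B \<inter> C = {}"
  shows "(\<Sum>P\<in>Pow (B \<union> C). h P) = (\<Sum>P\<in>Pow B. \<Sum>R\<in>Pow C. h (P \<union> R) :: real)"
proof -
  have "bij_betw (\<lambda>(P, R). P \<union> R) (Pow B \<times> Pow C) (Pow (B \<union> C))"
  proof (rule bij_betwI[where g = "\<lambda>U. (U \<inter> B, U \<inter> C)"])
    show "(\<lambda>(P, R). P \<union> R) \<in> Pow B \<times> Pow C \<rightarrow> Pow (B \<union> C)" by auto
    show "(\<lambda>U. (U \<inter> B, U \<inter> C)) \<in> Pow (B \<union> C) \<rightarrow> Pow B \<times> Pow C" by auto
  qed (use assms(3) in auto)
  then have "(\<Sum>P\<in>Pow (B \<union> C). h P) = (\<Sum>(P, R)\<in>Pow B \<times> Pow C. h (P \<union> R))"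
    by (simp add: sum.reindex_bij_betw[symmetric] case_prod_unfold)
  then show ?thesis by (simp add: sum.cartesian_product)
qed

lemma signed_sum_Un:
  assumes "finite B" "finite C" "B \<inter> C = {}" "P \<subseteq> B" "R \<subseteq> C"
  shows "signed_sum (B \<union> C) (P \<union> R) v = signed_sum B P v + signed_sum C R v"
proof -
  have "(B \<union> C) - (P \<union> R) = (B - P) \<union> (C - R)" using assms by auto
  moreover have "sum v ((B - P) \<union> (C - R)) = sum v (B - P) + sum v (C - R)"
    using assms by (intro sum.union_disjoint) auto
  moreover have "sum v (P \<union> R) = sum v P + sum v R"
    using assms by (intro sum.union_disjoint) (auto dest: finite_subset)
  ultimately show ?thesis by (simp add: signed_sum_def)
qed

lemma signed_sum_compl: "finite B \<Longrightarrow> P \<subseteq> B \<Longrightarrow> signed_sum B (B - P) v = - signed_sum B P v"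
  by (simp add: signed_sum_def double_diff)

lemma sum_eq_signed_sum: "finite B \<Longrightarrow> P \<subseteq> B \<Longrightarrow> sum v B = signed_sum B P v + 2 *\<^sub>R sum v P"
  by (simp add: signed_sum_def sum.subset_diff[of P B] scaleR_2)

text \<open>By the parallelogram law the two signs of each new vector cancel the cross term. This is
  where the inner product enters the estimate.\<close>

lemma sum_norm_signed_sum:
  fixes v :: "'k \<Rightarrow> 'a::real_inner"
  assumes "finite B"
  shows "(\<Sum>P\<in>Pow B. (norm (signed_sum B P v))\<^sup>2) = 2 ^ card B * (\<Sum>k\<in>B. (norm (v k))\<^sup>2)"
  using assms
proof (induction B)
  case empty
  then show ?case by (simp add: signed_sum_def)
next
  case (insert b B)
  have un: "insert b B = B \<union> {b}" by simp
  have "(\<Sum>P\<in>Pow (insert b B). (norm (signed_sum (insert b B) P v))\<^sup>2)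
      = (\<Sum>P\<in>Pow B. \<Sum>R\<in>Pow {b}. (norm (signed_sum (B \<union> {b}) (P \<union> R) v))\<^sup>2)"
    unfolding un using insert.hyps by (intro sum_Pow_Un) auto
  also have "\<dots> = (\<Sum>P\<in>Pow B. \<Sum>R\<in>Pow {b}. (norm (signed_sum B P v + signed_sum {b} R v))\<^sup>2)"
    using insert.hyps by (intro sum.cong refl arg_cong[where f = "\<lambda>x. (norm x)\<^sup>2"] signed_sum_Un) auto
  also have "\<dots> = (\<Sum>P\<in>Pow B. 2 * (norm (signed_sum B P v))\<^sup>2 + 2 * (norm (v b))\<^sup>2)"
  proof (rule sum.cong)
    fix P
    have "Pow {b} = {{}, {b}}" by auto
    then show "(\<Sum>R\<in>Pow {b}. (norm (signed_sum B P v + signed_sum {b} R v))\<^sup>2)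
        = 2 * (norm (signed_sum B P v))\<^sup>2 + 2 * (norm (v b))\<^sup>2"
      by (simp add: signed_sum_def power2_norm_eq_inner inner_simps inner_commute)
  qed simp
  also have "\<dots> = 2 * (2 ^ card B * (\<Sum>k\<in>B. (norm (v k))\<^sup>2)) + 2 ^ card B * (2 * (norm (v b))\<^sup>2)"
    using insert by (simp add: sum.distrib card_Pow flip: sum_distrib_left)
  also have "\<dots> = 2 ^ card (insert b B) * (\<Sum>k\<in>insert b B. (norm (v k))\<^sup>2)"
    using insert.hyps by (simp add: algebra_simps)
  finally show ?case .
qed

text \<open>The model is the homogeneous extension of a nearly affine function from the unit sphere.
  Its additive error is proportional to norms instead of merely bounded, so small norms of signed
  sums pay off.\<close>

locale quasilinear =
  fixes \<phi> :: "'a::real_inner \<Rightarrow> real"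
  assumes \<phi>_scale: "\<And>c x. \<phi> (c *\<^sub>R x) = c * \<phi> x"
    and \<phi>_add: "\<And>x y. \<bar>\<phi> (x + y) - \<phi> x - \<phi> y\<bar> \<le> norm x + norm y"
begin

lemma \<phi>_minus: "\<phi> (- x) = - \<phi> x"
  using \<phi>_scale[of "-1" x] by simp

lemma \<phi>_zero: "\<phi> 0 = 0"
  using \<phi>_scale[of 0 0] by simp

definition sign_defect :: "('k \<Rightarrow> 'a) \<Rightarrow> 'k set \<Rightarrow> 'k set \<Rightarrow> real" where
  "sign_defect v B P = \<phi> (signed_sum B P v) - signed_sum B P (\<lambda>k. \<phi> (v k))"

lemma sign_defect_compl: "finite B \<Longrightarrow> P \<subseteq> B \<Longrightarrow> sign_defect v B (B - P) = - sign_defect v B P"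
  by (simp add: sign_defect_def signed_sum_compl \<phi>_minus)

text \<open>Oddness cancels each sign pattern against the opposite one, so the defect has mean
  zero.\<close>

lemma sum_sign_defect: "finite B \<Longrightarrow> (\<Sum>P\<in>Pow B. sign_defect v B P) = 0"
proof -
  assume B: "finite B"
  have "bij_betw (\<lambda>P. B - P) (Pow B) (Pow B)"
    by (rule bij_betwI[where g = "\<lambda>P. B - P"]) auto
  then have "(\<Sum>P\<in>Pow B. sign_defect v B P) = (\<Sum>P\<in>Pow B. sign_defect v B (B - P))"
    by (rule sum.reindex_bij_betw[symmetric])
  also have "\<dots> = - (\<Sum>P\<in>Pow B. sign_defect v B P)"
    using B by (simp add: sign_defect_compl sum_negf)
  finally show ?thesis by simp
qed

text \<open>The defects of the two halves are independent with mean zero, so their variances add up; the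
  new error is bounded by the norms of two signed sums. With constant signs this would be
  of order \<open>2\<^sup>j\<close>, but here it only is of order \<open>2\<^bsup>j/2\<^esup>\<close>.\<close>

lemma sum_sign_defect_square:
  assumes "finite B" "card B \<le> 2 ^ j" "\<And>k. k \<in> B \<Longrightarrow> norm (v k) \<le> 1"
  shows "(\<Sum>P\<in>Pow B. (sign_defect v B P)\<^sup>2) \<le> 2 ^ card B * (2 * real j ^ 2 * 2 ^ j)"
  using assms
proof (induction j arbitrary: B)
  case 0
  then consider "B = {}" | b where "B = {b}"
    by (metis One_nat_def card_1_singletonE card_eq_0_iff le_Suc_eq le_zero_eq power_0)
  then show ?case
  proof cases
    case 1
    then show ?thesis by (simp add: sign_defect_def signed_sum_def \<phi>_zero)
  next
    case 2
    have "Pow {b} = {{}, {b}}" by auto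
    with 2 show ?thesis by (simp add: sign_defect_def signed_sum_def \<phi>_minus \<phi>_zero)
  qed
next
  case (Suc j)
  obtain C where C: "C \<subseteq> B" "card C = card B div 2"
    using obtain_subset_with_card_n[of "card B div 2" B] by auto
  define D where "D = B - C"
  have fin: "finite C" "finite D" and CD: "C \<inter> D = {}" and B: "B = C \<union> D"
    using C Suc.prems(1) finite_subset by (auto simp: D_def)
  have cardB: "card B = card C + card D" unfolding B using fin CD by (rule card_Un_disjoint)
  have cards: "card C \<le> 2 ^ j" "card D \<le> 2 ^ j" using C(2) cardB Suc.prems(2) by auto
  have norm1: "\<And>k. k \<in> C \<Longrightarrow> norm (v k) \<le> 1" "\<And>k. k \<in> D \<Longrightarrow> norm (v k) \<le> 1"
    using Suc.prems(3) B by auto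
  define X where "X P = sign_defect v C P" for P
  define Y where "Y R = sign_defect v D R" for R
  \<comment> \<open>The error made when the signed sums of the two halves are added, bounded by
    their norms through \<open>\<phi>_add\<close>.\<close>
  define Z where "Z P R = sign_defect v B (P \<union> R) - X P - Y R" for P R
  define a where "a P = norm (signed_sum C P v)" for P
  define b where "b R = norm (signed_sum D R v)" for R
  define c d where "c = (2::real) ^ card C" and "d = (2::real) ^ card D"
  have cd: "c > 0" "d > 0" "2 ^ card B = c * d" by (simp_all add: c_def d_def cardB power_add)
  have Z: "\<bar>Z P R\<bar> \<le> a P + b R" if "P \<subseteq> C" "R \<subseteq> D" for P R
    using \<phi>_add[of "signed_sum C P v" "signed_sum D R v"] that fin CD
    by (simp add: Z_def X_def Y_def sign_defect_def B signed_sum_Un a_def b_def)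
  have Z2: "(Z P R)\<^sup>2 \<le> 2 * (a P)\<^sup>2 + 2 * (b R)\<^sup>2" if "P \<subseteq> C" "R \<subseteq> D" for P R
  proof -
    have "(Z P R)\<^sup>2 \<le> (a P + b R)\<^sup>2" using Z[OF that] by (rule power2_le_iff_abs_le[THEN iffD2, rotated]) (simp add: a_def b_def)
    also have "\<dots> \<le> 2 * (a P)\<^sup>2 + 2 * (b R)\<^sup>2"
      using zero_le_power2[of "a P - b R"] by (simp add: power2_eq_square algebra_simps)
    finally show ?thesis .
  qed
  have "(\<Sum>P\<in>Pow C. (a P)\<^sup>2) \<le> c * card C"
    unfolding a_def sum_norm_signed_sum[OF fin(1)] c_def
    by (intro mult_left_mono order_trans[OF sum_bounded_above[of _ _ 1]]) (auto intro!: power_le_one norm1(1))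
  also have "\<dots> \<le> c * 2 ^ j" using cards cd by (intro mult_left_mono) (auto simp: of_nat_le_numeral_power_cancel_iff)
  finally have a2: "(\<Sum>P\<in>Pow C. (a P)\<^sup>2) \<le> c * 2 ^ j" .
  have "(\<Sum>P\<in>Pow D. (b P)\<^sup>2) \<le> d * card D"
    unfolding b_def sum_norm_signed_sum[OF fin(2)] d_def
    by (intro mult_left_mono order_trans[OF sum_bounded_above[of _ _ 1]]) (auto intro!: power_le_one norm1(2))
  also have "\<dots> \<le> d * 2 ^ j" using cards cd by (intro mult_left_mono) (auto simp: of_nat_le_numeral_power_cancel_iff)
  finally have b2: "(\<Sum>P\<in>Pow D. (b P)\<^sup>2) \<le> d * 2 ^ j" .
  define J where "J = real j"
  have J: "J \<ge> 0" by (simp add: J_def)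
  define V where "V = 2 * J\<^sup>2 * 2 ^ j"
  have X2: "(\<Sum>P\<in>Pow C. (X P)\<^sup>2) \<le> c * V"
    unfolding X_def c_def V_def J_def by (rule Suc.IH[OF fin(1) cards(1) norm1(1)])
  have Y2: "(\<Sum>P\<in>Pow D. (Y P)\<^sup>2) \<le> d * V"
    unfolding Y_def d_def V_def J_def by (rule Suc.IH[OF fin(2) cards(2) norm1(2)])
  \<comment> \<open>Independence and mean zero: no correlation between the defects of the
    halves.\<close>
  have cross: "(\<Sum>P\<in>Pow C. \<Sum>R\<in>Pow D. X P * Y R) = 0"
    using sum_sign_defect[OF fin(2)] by (simp add: Y_def flip: sum_distrib_left)
  have cardPow: "real (card (Pow C)) = c" "real (card (Pow D)) = d"
    using fin by (simp_all add: card_Pow c_def d_def)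
  have sum2: "(\<Sum>P\<in>Pow C. \<Sum>R\<in>Pow D. f P + g R) = d * (\<Sum>P\<in>Pow C. f P) + c * (\<Sum>R\<in>Pow D. g R)" for f g :: "_ \<Rightarrow> real"
    using fin by (simp add: sum.distrib card_Pow c_def d_def mult.commute flip: sum_distrib_right sum_distrib_left)
  have XY: "(\<Sum>P\<in>Pow C. \<Sum>R\<in>Pow D. (X P + Y R)\<^sup>2) \<le> c * d * (2 * V)"
  proof -
    have "(\<Sum>P\<in>Pow C. \<Sum>R\<in>Pow D. (X P + Y R)\<^sup>2)
        = (\<Sum>P\<in>Pow C. \<Sum>R\<in>Pow D. (X P)\<^sup>2 + (Y R)\<^sup>2) + 2 * (\<Sum>P\<in>Pow C. \<Sum>R\<in>Pow D. X P * Y R)"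
      by (simp add: power2_sum sum.distrib sum_distrib_left mult.assoc)
    also have "\<dots> = d * (\<Sum>P\<in>Pow C. (X P)\<^sup>2) + c * (\<Sum>R\<in>Pow D. (Y R)\<^sup>2)" by (simp add: sum2 cross)
    also have "\<dots> \<le> d * (c * V) + c * (d * V)"
      using X2 Y2 cd by (intro add_mono mult_left_mono) auto
    finally show ?thesis by (simp add: algebra_simps)
  qed
  have ZZ: "(\<Sum>P\<in>Pow C. \<Sum>R\<in>Pow D. (Z P R)\<^sup>2) \<le> c * d * (4 * 2 ^ j)"
  proof -
    have "(\<Sum>P\<in>Pow C. \<Sum>R\<in>Pow D. (Z P R)\<^sup>2) \<le> (\<Sum>P\<in>Pow C. \<Sum>R\<in>Pow D. 2 * (a P)\<^sup>2 + 2 * (b R)\<^sup>2)"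
      by (intro sum_mono Z2) auto
    also have "\<dots> = d * (2 * (\<Sum>P\<in>Pow C. (a P)\<^sup>2)) + c * (2 * (\<Sum>R\<in>Pow D. (b R)\<^sup>2))"
      by (simp add: sum2 flip: sum_distrib_left)
    also have "\<dots> \<le> d * (2 * (c * 2 ^ j)) + c * (2 * (d * 2 ^ j))"
      using a2 b2 cd by (intro add_mono mult_left_mono) auto
    finally show ?thesis by (simp add: algebra_simps)
  qed
  have total: "(\<Sum>P\<in>Pow B. (sign_defect v B P)\<^sup>2) = (\<Sum>P\<in>Pow C. \<Sum>R\<in>Pow D. (X P + Y R + Z P R)\<^sup>2)"
    unfolding B by (subst sum_Pow_Un[OF fin CD]) (simp add: Z_def B)
  show ?case
  \<comment> \<open>For \<open>j = 0\<close> the halves have no defect, and \<open>Z\<close> is the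
    whole one. The weighted inequality of the other case needs a positive weight.\<close>
  proof (cases "j = 0")
    case True
    then have "X P = 0" if "P \<subseteq> C" for P
    proof -
      have "(\<Sum>P\<in>Pow C. (X P)\<^sup>2) = 0"
        using X2 True by (intro antisym sum_nonneg) (auto simp: V_def J_def)
      then show ?thesis using that fin by (subst (asm) sum_nonneg_eq_0_iff) auto
    qed
    moreover have "Y R = 0" if "R \<subseteq> D" for R
    proof -
      have "(\<Sum>P\<in>Pow D. (Y P)\<^sup>2) = 0"
        using Y2 True by (intro antisym sum_nonneg) (auto simp: V_def J_def)
      then show ?thesis using that fin by (subst (asm) sum_nonneg_eq_0_iff) auto
    qed
    ultimately have "(\<Sum>P\<in>Pow B. (sign_defect v B P)\<^sup>2) = (\<Sum>P\<in>Pow C. \<Sum>R\<in>Pow D. (Z P R)\<^sup>2)"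
      unfolding total by (intro sum.cong) auto
    with ZZ cd True show ?thesis by simp
  next
    case False
    then have J1: "J > 0" by (simp add: J_def)
    \<comment> \<open>This is (x + y)^2 <= (1 + 1/J) x^2 + (1 + J) y^2 with denominators cleared.
      The weight is tuned so that a variance bound 2 J^2 2^j for the halves passes to 2 (J + 1)^2
      2^(j + 1).\<close>
    have pt: "J * (x + y)\<^sup>2 \<le> (J + 1) * x\<^sup>2 + J * (J + 1) * y\<^sup>2" for x y
      using zero_le_power2[of "x - J * y"] by (simp add: power2_eq_square algebra_simps)
    have "J * (\<Sum>P\<in>Pow B. (sign_defect v B P)\<^sup>2)
        \<le> (\<Sum>P\<in>Pow C. \<Sum>R\<in>Pow D. (J + 1) * (X P + Y R)\<^sup>2 + J * (J + 1) * (Z P R)\<^sup>2)"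
      unfolding total sum_distrib_left by (intro sum_mono pt)
    also have "\<dots> = (J + 1) * (\<Sum>P\<in>Pow C. \<Sum>R\<in>Pow D. (X P + Y R)\<^sup>2) + J * (J + 1) * (\<Sum>P\<in>Pow C. \<Sum>R\<in>Pow D. (Z P R)\<^sup>2)"
      by (simp add: sum.distrib flip: sum_distrib_left)
    also have "\<dots> \<le> (J + 1) * (c * d * (2 * V)) + J * (J + 1) * (c * d * (4 * 2 ^ j))"
      using XY ZZ J by (intro add_mono mult_left_mono) auto
    also have "\<dots> = J * (c * d * (2 * (J + 1)\<^sup>2 * 2 ^ Suc j))"
      by (simp add: V_def power2_eq_square algebra_simps)
    finally show ?thesis using J1 cd by (simp add: J_def add.commute)
  qed
qed

text \<open>Some sign pattern has \<open>\<Phi>\<close> at most its average 3 J^2 2^j with J = j +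
  1, and (x + y)^2 <= 2 (x^2 + y^2) gives 6 J^2 2^j. The stated form replaces the root of 6 by 5/2
  and the root of 2 by 3/2, still below 2. Passing to the opposite pattern ensures that at most half
  of the signs are negative.\<close>

lemma ex_good_signs:
  assumes B: "finite B" "card B \<le> 2 ^ j" "\<And>k. k \<in> B \<Longrightarrow> norm (v k) \<le> 1"
  shows "\<exists>P\<subseteq>B. 2 * card P \<le> card B \<and>
    (real j + 1) * norm (signed_sum B P v) + \<bar>sign_defect v B P\<bar> \<le> 5 / 2 * (real j + 1) * (3 / 2) ^ j"
proof -
  define J where "J = real j + 1"
  have J: "J \<ge> 1" "real j \<le> J" by (simp_all add: J_def)
  define \<Phi> where "\<Phi> P = J\<^sup>2 * (norm (signed_sum B P v))\<^sup>2 + (sign_defect v B P)\<^sup>2" for P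
  have "(\<Sum>k\<in>B. (norm (v k))\<^sup>2) \<le> real (card B)"
    using B(3) by (intro order_trans[OF sum_bounded_above[of _ _ 1]]) (auto intro!: power_le_one)
  also have "\<dots> \<le> 2 ^ j" using B(2) by (simp add: of_nat_le_numeral_power_cancel_iff)
  finally have n: "(\<Sum>k\<in>B. (norm (v k))\<^sup>2) \<le> 2 ^ j" .
  have "(\<Sum>P\<in>Pow B. \<Phi> P) = J\<^sup>2 * (2 ^ card B * (\<Sum>k\<in>B. (norm (v k))\<^sup>2)) + (\<Sum>P\<in>Pow B. (sign_defect v B P)\<^sup>2)"
    by (simp add: \<Phi>_def sum.distrib sum_norm_signed_sum[OF B(1)] flip: sum_distrib_left)
  also have "\<dots> \<le> J\<^sup>2 * (2 ^ card B * 2 ^ j) + 2 ^ card B * (2 * real j ^ 2 * 2 ^ j)"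
    by (intro add_mono mult_left_mono sum_sign_defect_square B n) auto
  also have "\<dots> \<le> J\<^sup>2 * (2 ^ card B * 2 ^ j) + 2 ^ card B * (2 * J ^ 2 * 2 ^ j)"
    using J by (intro add_mono mult_left_mono mult_right_mono power_mono) auto
  also have "\<dots> = (\<Sum>P\<in>Pow B. 3 * J\<^sup>2 * 2 ^ j)" using B(1) by (simp add: card_Pow)
  finally have "\<not> (\<Sum>P\<in>Pow B. 3 * J\<^sup>2 * 2 ^ j) < (\<Sum>P\<in>Pow B. \<Phi> P)" by simp
  then have "\<not> (\<forall>P\<in>Pow B. 3 * J\<^sup>2 * 2 ^ j < \<Phi> P)"
    using B(1) by (intro notI) (erule notE, rule sum_strict_mono, auto)
  then obtain P where P: "P \<in> Pow B" "\<Phi> P \<le> 3 * J\<^sup>2 * 2 ^ j" by (auto simp: not_less)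
  have bound: "J * norm (signed_sum B P v) + \<bar>sign_defect v B P\<bar> \<le> 5 / 2 * J * (3 / 2) ^ j"
    if "\<Phi> P \<le> 3 * J\<^sup>2 * 2 ^ j" for P
  proof (rule power2_le_imp_le)
    have "(J * norm (signed_sum B P v) + \<bar>sign_defect v B P\<bar>)\<^sup>2 \<le> 2 * \<Phi> P"
      using zero_le_power2[of "J * norm (signed_sum B P v) - \<bar>sign_defect v B P\<bar>"]
      by (simp add: \<Phi>_def power2_sum power2_diff power_mult_distrib)
    also have "\<dots> \<le> 6 * J\<^sup>2 * 2 ^ j" using that by simp
    also have "\<dots> \<le> (25 / 4 * J\<^sup>2) * (9 / 4) ^ j"
      by (intro mult_mono power_mono mult_right_mono) auto
    also have "(9 / 4 :: real) ^ j = ((3 / 2) ^ j)\<^sup>2"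
      by (simp add: power2_eq_square flip: power_mult_distrib)
    also have "25 / 4 * J\<^sup>2 * ((3 / 2) ^ j)\<^sup>2 = (5 / 2 * J * (3 / 2) ^ j)\<^sup>2"
      by (simp add: power_mult_distrib power2_eq_square)
    finally show "(J * norm (signed_sum B P v) + \<bar>sign_defect v B P\<bar>)\<^sup>2 \<le> (5 / 2 * J * (3 / 2) ^ j)\<^sup>2" .
  qed (use J in auto)
  have PB: "P \<subseteq> B" using P by simp
  have "card (B - P) = card B - card P" using PB B(1) by (simp add: card_Diff_subset finite_subset)
  then consider "2 * card P \<le> card B" | "2 * card (B - P) \<le> card B" by linarith
  then show ?thesis
  proof cases
    case 1
    then show ?thesis using PB bound[OF P(2)] by (auto simp: J_def)
  next
    case 2
    have "\<Phi> (B - P) = \<Phi> P" using PB B(1) by (simp add: \<Phi>_def signed_sum_compl sign_defect_compl)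
    then show ?thesis using 2 bound[of "B - P"] P(2) by (intro exI[of _ "B - P"]) (auto simp: J_def)
  qed
qed

text \<open>With \<open>B\<close> the whole family, \<open>s = 0\<close> and \<open>c = 1\<close> this decomposes the sum into
  \<open>\<Sum>l. 2\<^sup>l w\<^sub>l\<close> where \<open>w\<^sub>l\<close> is a signed sum of at most \<open>2\<^bsup>j-l\<^esup>\<close> vectors; the norms of the terms grow
  geometrically, and they are added starting with the small ones.\<close>

lemma quasilinear_sum_aux:
  assumes "finite B" "card B \<le> 2 ^ j" "\<And>k. k \<in> B \<Longrightarrow> norm (v k) \<le> 1" "0 \<le> c"
  shows "\<bar>\<phi> (s + c *\<^sub>R sum v B) - \<phi> s - c * (\<Sum>k\<in>B. \<phi> (v k))\<bar>
    \<le> (real j + 1) * norm s + c * (77 / 2 * 2 ^ j - (15 / 2 * real j + 75 / 2) * (3 / 2) ^ j)"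
  using assms
proof (induction j arbitrary: B s c)
  case 0
  then consider "B = {}" | b where "B = {b}"
    by (metis One_nat_def card_1_singletonE card_eq_0_iff le_Suc_eq le_zero_eq power_0)
  then show ?case
  proof cases
    case 1
    then show ?thesis using 0 by simp
  next
    case 2
    have "\<bar>\<phi> (s + c *\<^sub>R v b) - \<phi> s - \<phi> (c *\<^sub>R v b)\<bar> \<le> norm s + norm (c *\<^sub>R v b)" by (rule \<phi>_add)
    moreover have "norm (c *\<^sub>R v b) \<le> c * 1"
      using 0 2 by (auto intro: mult_left_le)
    ultimately show ?thesis using 2 by (simp add: \<phi>_scale)
  qed
next
  case (Suc j)
  define J where "J = real j"
  have J: "J \<ge> 0" by (simp add: J_def)
  have "\<exists>P\<subseteq>B. 2 * card P \<le> card B \<and>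
    (real (Suc j) + 1) * norm (signed_sum B P v) + \<bar>sign_defect v B P\<bar> \<le> 5 / 2 * (real (Suc j) + 1) * (3 / 2) ^ Suc j"
    using Suc.prems by (intro ex_good_signs)
  then obtain P where P: "P \<subseteq> B" "2 * card P \<le> card B"
    "(real (Suc j) + 1) * norm (signed_sum B P v) + \<bar>sign_defect v B P\<bar> \<le> 5 / 2 * (real (Suc j) + 1) * (3 / 2) ^ Suc j"
    by (elim exE conjE)
  define w where "w = signed_sum B P v"
  define w\<phi> where "w\<phi> = signed_sum B P (\<lambda>k. \<phi> (v k))"
  \<comment> \<open>The solution of \<beta>(0) = 1 and \<beta>(j + 1) = 2 \<beta>(j) + 5/2 (j + 2)
    (3/2)^(j + 1), the last term being the cost of good signs.\<close>
  define \<beta> where "\<beta> = 77 / 2 * 2 ^ j - (15 / 2 * J + 75 / 2) * (3 / 2) ^ j"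
  have sums: "sum v B = w + 2 *\<^sub>R sum v P" "(\<Sum>k\<in>B. \<phi> (v k)) = w\<phi> + 2 * (\<Sum>k\<in>P. \<phi> (v k))"
    unfolding w_def w\<phi>_def
    using sum_eq_signed_sum[OF Suc.prems(1) P(1), of v]
      sum_eq_signed_sum[OF Suc.prems(1) P(1), of "\<lambda>k. \<phi> (v k)"] by auto
  have w: "(J + 2) * norm w + \<bar>\<phi> w - w\<phi>\<bar> \<le> 5 / 2 * (J + 2) * (3 / 2) ^ Suc j"
    using P(3) by (simp add: w_def w\<phi>_def sign_defect_def J_def add.commute)
  \<comment> \<open>The signed sum joins the accumulator \<open>s\<close>. What remains is a sum
    over \<open>P\<close>, of at most half the length but with coefficient \<open>2 * c\<close>, so
    the induction hypothesis applies.\<close>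
  have 1: "\<bar>\<phi> ((s + c *\<^sub>R w) + (2 * c) *\<^sub>R sum v P) - \<phi> (s + c *\<^sub>R w) - (2 * c) * (\<Sum>k\<in>P. \<phi> (v k))\<bar>
      \<le> (J + 1) * norm (s + c *\<^sub>R w) + (2 * c) * \<beta>"
    unfolding J_def \<beta>_def
    using P(1,2) Suc.prems by (intro Suc.IH) (auto intro: finite_subset)
  have 2: "\<bar>\<phi> (s + c *\<^sub>R w) - \<phi> s - c * \<phi> w\<bar> \<le> norm s + c * norm w"
    using \<phi>_add[of s "c *\<^sub>R w"] Suc.prems(4) by (simp add: \<phi>_scale)
  have 3: "(J + 1) * norm (s + c *\<^sub>R w) \<le> (J + 1) * (norm s + c * norm w)"
    using Suc.prems(4) J by (intro mult_left_mono order_trans[OF norm_triangle_ineq]) auto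
  have 4: "\<bar>c * \<phi> w - c * w\<phi>\<bar> = c * \<bar>\<phi> w - w\<phi>\<bar>"
    unfolding right_diff_distrib[symmetric] abs_mult using Suc.prems(4) by simp
  have 5: "c * ((J + 2) * norm w + \<bar>\<phi> w - w\<phi>\<bar>) \<le> c * (5 / 2 * (J + 2) * (3 / 2) ^ Suc j)"
    using w Suc.prems(4) by (rule mult_left_mono)
  have eq: "s + c *\<^sub>R sum v B = (s + c *\<^sub>R w) + (2 * c) *\<^sub>R sum v P"
    "c * (\<Sum>k\<in>B. \<phi> (v k)) = c * w\<phi> + (2 * c) * (\<Sum>k\<in>P. \<phi> (v k))"
    by (simp_all add: sums algebra_simps)
  have "\<bar>\<phi> (s + c *\<^sub>R sum v B) - \<phi> s - c * (\<Sum>k\<in>B. \<phi> (v k))\<bar>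
      \<le> (J + 1) * (norm s + c * norm w) + (2 * c) * \<beta> + norm s + c * norm w + c * \<bar>\<phi> w - w\<phi>\<bar>"
    unfolding eq using 1 2 3 4 by linarith
  also have "\<dots> = (J + 2) * norm s + c * ((J + 2) * norm w + \<bar>\<phi> w - w\<phi>\<bar>) + 2 * c * \<beta>"
    by (simp add: algebra_simps)
  also have "\<dots> \<le> (J + 2) * norm s + c * (5 / 2 * (J + 2) * (3 / 2) ^ Suc j) + 2 * c * \<beta>"
    using 5 by simp
  also have "\<dots> = (J + 2) * norm s + c * (77 / 2 * 2 ^ Suc j - (15 / 2 * (J + 1) + 75 / 2) * (3 / 2) ^ Suc j)"
    by (simp add: \<beta>_def field_simps)
  finally show ?case by (simp add: J_def add.commute)
qed

lemma quasilinear_sum: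
  assumes "finite B" "card B \<le> 2 ^ j" "\<And>k. k \<in> B \<Longrightarrow> norm (v k) \<le> 1"
  shows "\<bar>\<phi> (sum v B) - (\<Sum>k\<in>B. \<phi> (v k))\<bar> \<le> 39 * 2 ^ j"
proof -
  have "\<bar>\<phi> (0 + 1 *\<^sub>R sum v B) - \<phi> 0 - 1 * (\<Sum>k\<in>B. \<phi> (v k))\<bar>
      \<le> (real j + 1) * norm (0 :: 'a) + 1 * (77 / 2 * 2 ^ j - (15 / 2 * real j + 75 / 2) * (3 / 2) ^ j)"
    using assms by (intro quasilinear_sum_aux) auto
  also have "\<dots> \<le> 39 * 2 ^ j" by (simp add: algebra_simps add_nonneg_nonneg)
  finally show ?thesis by (simp add: \<phi>_zero)
qed

end

section \<open>From sums to convex combinations in the Hilbert ball\<close>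

lemma eps_affine_on_mono: "eps_affine_on D \<epsilon> f \<Longrightarrow> \<epsilon> \<le> \<delta> \<Longrightarrow> eps_affine_on D \<delta> f"
  unfolding eps_affine_on_def by force

lemma eps_affine_on_scaleR:
  assumes X: "subspace X" and f: "eps_affine_on (closed_unit_ball X) \<epsilon> f" "f 0 = 0"
    and x: "x \<in> closed_unit_ball X" and t: "0 \<le> t" "t \<le> 1"
  shows "\<bar>f (t *\<^sub>R x) - t * f x\<bar> \<le> \<epsilon>"
proof -
  have "\<bar>f (t *\<^sub>R x + (1 - t) *\<^sub>R 0) - t * f x - (1 - t) * f 0\<bar> \<le> \<epsilon>"
    using x t closed_unit_ball_0[OF X] by (intro f(1)[unfolded eps_affine_on_def, rule_format]) auto
  then show ?thesis using f(2) by simp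
qed

context quasilinear
begin

text \<open>A crude bound depending on the set, but not on the scaling factor: it is used only for
  the rounding remainder.\<close>

lemma abs_sum_le:
  assumes "finite S" "\<And>x. x \<in> S \<Longrightarrow> norm x \<le> 1" "\<And>x. x \<in> S \<Longrightarrow> 0 \<le> r x \<and> r x \<le> 1"
  shows "\<bar>\<phi> (\<Sum>x\<in>S. r x *\<^sub>R x)\<bar> \<le> (\<Sum>x\<in>S. \<bar>\<phi> x\<bar>) + (real (card S))\<^sup>2 \<and>
    norm (\<Sum>x\<in>S. r x *\<^sub>R x) \<le> real (card S)"
  using assms
proof (induction S)
  case empty
  then show ?case by (simp add: \<phi>_zero)
next
  case (insert y S)
  have y: "norm (r y *\<^sub>R y) \<le> 1" using insert.prems by (auto intro!: mult_le_one)
  have "\<bar>\<phi> (r y *\<^sub>R y)\<bar> \<le> \<bar>\<phi> y\<bar>"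
    using insert.prems by (auto simp: \<phi>_scale abs_mult intro!: mult_left_le_one_le)
  moreover have IH: "\<bar>\<phi> (\<Sum>x\<in>S. r x *\<^sub>R x)\<bar> \<le> (\<Sum>x\<in>S. \<bar>\<phi> x\<bar>) + (real (card S))\<^sup>2"
    "norm (\<Sum>x\<in>S. r x *\<^sub>R x) \<le> real (card S)"
    using insert by auto
  moreover note \<phi>_add[of "r y *\<^sub>R y" "\<Sum>x\<in>S. r x *\<^sub>R x"] y
  ultimately have "\<bar>\<phi> (r y *\<^sub>R y + (\<Sum>x\<in>S. r x *\<^sub>R x))\<bar>
      \<le> \<bar>\<phi> y\<bar> + (\<Sum>x\<in>S. \<bar>\<phi> x\<bar>) + (real (card S))\<^sup>2 + real (card S) + 1" by linarith
  then show ?case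
    using insert.hyps y IH(2) norm_triangle_ineq[of "r y *\<^sub>R y" "\<Sum>x\<in>S. r x *\<^sub>R x"]
    by (simp add: power2_eq_square algebra_simps)
qed

text \<open>Scale the weights by N = 2^L and round them down. The integer part is a sum of at most
  2^L vectors and costs 39 N; joining it to the remainder costs N plus a quantity independent of N.
  Division by N and large L leave 40.\<close>

lemma quasilinear_convex_combination:
  assumes S: "finite S" "\<And>x. x \<in> S \<Longrightarrow> norm x \<le> 1" and u: "\<And>x. x \<in> S \<Longrightarrow> 0 \<le> u x" "sum u S = 1"
  shows "\<bar>\<phi> (\<Sum>x\<in>S. u x *\<^sub>R x) - (\<Sum>x\<in>S. u x * \<phi> x)\<bar> \<le> 40"
proof (rule ccontr)
  define p where "p = real (card S)"
  define M where "M = (\<Sum>x\<in>S. \<bar>\<phi> x\<bar>)"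
  define d where "d = \<bar>\<phi> (\<Sum>x\<in>S. u x *\<^sub>R x) - (\<Sum>x\<in>S. u x * \<phi> x)\<bar>"
  have key: "2 ^ L * (d - 40) \<le> 2 * M + p\<^sup>2 + p" for L :: nat
  proof -
    define N :: real where "N = 2 ^ L"
    have N: "N > 0" by (simp add: N_def)
    define n where "n x = nat \<lfloor>N * u x\<rfloor>" for x
    define r where "r x = N * u x - real (n x)" for x
    have n: "real (n x) \<le> N * u x" and r: "0 \<le> r x" "r x \<le> 1" if "x \<in> S" for x
    proof -
      have "0 \<le> N * u x" using u(1)[OF that] N by simp
      then show "real (n x) \<le> N * u x" "0 \<le> r x" "r x \<le> 1" unfolding r_def n_def by linarith+
    qed
    \<comment> \<open>The family listing each \<open>x\<close> exactly \<open>n x\<close>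
      times.\<close>
    define B where "B = Sigma S (\<lambda>x. {..<n x})"
    have finB: "finite B" using S by (simp add: B_def)
    have sumB: "(\<Sum>k\<in>B. g (fst k)) = (\<Sum>x\<in>S. real (n x) *\<^sub>R g x)" for g :: "'a \<Rightarrow> 'b::real_vector"
      using S(1) unfolding B_def by (subst sum.Sigma[symmetric, where g = "\<lambda>x k. g x", simplified case_prod_unfold])
        (auto simp: sum_constant_scaleR)
    have "real (card B) = (\<Sum>x\<in>S. real (n x))" using S(1) by (simp add: B_def card_SigmaI)
    also have "\<dots> \<le> (\<Sum>x\<in>S. N * u x)" by (intro sum_mono n)
    also have "\<dots> = N" using u(2) by (simp flip: sum_distrib_left)
    finally have cardB: "real (card B) \<le> N" .
    then have "card B \<le> 2 ^ L" unfolding N_def by (simp add: of_nat_le_numeral_power_cancel_iff)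
    then have "\<bar>\<phi> (\<Sum>k\<in>B. fst k) - (\<Sum>k\<in>B. \<phi> (fst k))\<bar> \<le> 39 * 2 ^ L"
      using S(2) by (intro quasilinear_sum finB) (auto simp: B_def)
    then have 1: "\<bar>\<phi> (\<Sum>x\<in>S. real (n x) *\<^sub>R x) - (\<Sum>x\<in>S. real (n x) * \<phi> x)\<bar> \<le> 39 * N"
      using sumB[of "\<lambda>x. x"] sumB[of \<phi>] by (simp add: N_def)
    have rS: "\<bar>\<phi> (\<Sum>x\<in>S. r x *\<^sub>R x)\<bar> \<le> M + p\<^sup>2" "norm (\<Sum>x\<in>S. r x *\<^sub>R x) \<le> p"
      unfolding M_def p_def using abs_sum_le[of S r] S r by auto
    have "norm (\<Sum>x\<in>S. real (n x) *\<^sub>R x) \<le> (\<Sum>x\<in>S. real (n x) * 1)"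
      using S(2) by (intro sum_norm_le) (auto intro!: mult_left_le)
    then have nn: "norm (\<Sum>x\<in>S. real (n x) *\<^sub>R x) \<le> N"
      using cardB S(1) by (simp add: B_def card_SigmaI)
    have "(\<Sum>x\<in>S. real (n x) *\<^sub>R x) + (\<Sum>x\<in>S. r x *\<^sub>R x) = N *\<^sub>R (\<Sum>x\<in>S. u x *\<^sub>R x)"
      by (simp add: r_def scaleR_sum_right flip: sum.distrib scaleR_add_left)
    then have 2: "\<bar>N * \<phi> (\<Sum>x\<in>S. u x *\<^sub>R x) - \<phi> (\<Sum>x\<in>S. real (n x) *\<^sub>R x) - \<phi> (\<Sum>x\<in>S. r x *\<^sub>R x)\<bar> \<le> N + p"
      using \<phi>_add[of "\<Sum>x\<in>S. real (n x) *\<^sub>R x" "\<Sum>x\<in>S. r x *\<^sub>R x"] nn rS(2) by (simp add: \<phi>_scale)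
    have 3: "N * (\<Sum>x\<in>S. u x * \<phi> x) = (\<Sum>x\<in>S. real (n x) * \<phi> x) + (\<Sum>x\<in>S. r x * \<phi> x)"
      by (simp add: r_def sum_distrib_left algebra_simps flip: sum.distrib)
    have "\<bar>\<Sum>x\<in>S. r x * \<phi> x\<bar> \<le> M"
      unfolding M_def using r by (intro order_trans[OF sum_abs] sum_mono) (simp add: abs_mult mult_left_le_one_le)
    with 1 2 3 rS have "\<bar>N * \<phi> (\<Sum>x\<in>S. u x *\<^sub>R x) - N * (\<Sum>x\<in>S. u x * \<phi> x)\<bar> \<le> 40 * N + p + (M + p\<^sup>2) + M"
      by linarith
    then have "N * d \<le> 40 * N + p + (M + p\<^sup>2) + M"
      unfolding right_diff_distrib[symmetric] abs_mult d_def using N by simp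
    then show ?thesis by (simp add: N_def algebra_simps)
  qed
  assume "\<not> ?thesis"
  then have "d - 40 > 0" by (simp add: d_def)
  then obtain L where "(2 * M + p\<^sup>2 + p) / (d - 40) < 2 ^ L" using real_arch_pow[of 2] by auto
  with \<open>d - 40 > 0\<close> key[of L] show False by (simp add: divide_simps mult.commute)
qed

end

text \<open>The extension \<open>g\<close> of \<open>f\<close> from the sphere along rays is within
  \<epsilon> of \<open>f\<close> on the ball, and \<open>g / (2 * \<epsilon>)\<close> is
  quasilinear. The bound 40 becomes 80 \<epsilon>, and returning to \<open>f\<close> costs
  \<epsilon> at the barycentre and \<epsilon> on average over the points.\<close>

lemma Hilbert_multi_affine:
  fixes f :: "'h::real_inner \<Rightarrow> real"
  assumes D: "D = closed_unit_ball UNIV" and \<epsilon>: "0 < \<epsilon>" and f: "eps_affine_on D \<epsilon> f"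
    and odd: "\<And>x. x \<in> D \<Longrightarrow> f (- x) = - f x"
  shows "multi_affine_on D (82 * \<epsilon>) f"
proof -
  have memD: "x \<in> D \<longleftrightarrow> norm x \<le> 1" for x by (simp add: D closed_unit_ball_def)
  have sgnD: "sgn x \<in> D" for x by (simp add: memD norm_sgn)
  have norm_sgn_eq: "norm x *\<^sub>R sgn x = x" for x :: 'h
    by (cases "x = 0") (simp_all add: sgn_div_norm)
  have f0: "f 0 = 0" using odd[of 0] by (simp add: memD)
  define g where "g x = norm x * f (sgn x)" for x
  have near: "\<bar>f x - g x\<bar> \<le> \<epsilon>" if "x \<in> D" for x
  proof -
    have "\<bar>f (norm x *\<^sub>R sgn x) - norm x * f (sgn x)\<bar> \<le> \<epsilon>"
      using that f f0 sgnD unfolding D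
      by (intro eps_affine_on_scaleR[where X = UNIV]) (auto simp: closed_unit_ball_def)
    then show ?thesis by (simp add: g_def norm_sgn_eq)
  qed
  have scale: "g (c *\<^sub>R x) = c * g x" for c x
  proof (cases c "0 :: real" rule: linorder_cases)
    case less
    then have "sgn (c *\<^sub>R x) = - sgn x" by (simp add: sgn_scaleR)
    then show ?thesis using less odd[OF sgnD] by (simp add: g_def)
  qed (simp_all add: g_def sgn_scaleR)
  interpret quasilinear "\<lambda>x. g x / (2 * \<epsilon>)"
  proof
    show "g (c *\<^sub>R x) / (2 * \<epsilon>) = c * (g x / (2 * \<epsilon>))" for c x by (simp add: scale)
    fix x y :: 'h
    define s where "s = norm x + norm y"
    have "\<bar>g (x + y) - g x - g y\<bar> \<le> s * (2 * \<epsilon>)"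
    proof (cases "s = 0")
      case True
      then have "x = 0" "y = 0" by (auto simp: s_def add_nonneg_eq_0_iff)
      then show ?thesis using \<epsilon> by (simp add: g_def s_def)
    next
      case False
      then have s: "s > 0" unfolding s_def by (metis add_nonneg_nonneg norm_ge_zero less_eq_real_def)
      define t where "t = norm x / s"
      have t: "0 \<le> t" "t \<le> 1" "s * t = norm x" "s * (1 - t) = norm y"
        using s by (simp_all add: t_def s_def field_simps)
      \<comment> \<open>\<open>x + y\<close> is \<open>s\<close> times a convex combination of the
        two directions. Near affinity of \<open>f\<close> at \<open>w\<close> and the distance from
        \<open>f\<close> to \<open>g\<close> contribute \<epsilon> each, both multiplied by
        \<open>s\<close>.\<close>
      define w where "w = t *\<^sub>R sgn x + (1 - t) *\<^sub>R sgn y"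
      have "w \<in> D"
        using convexD[OF convex_closed_unit_ball[OF subspace_UNIV] sgnD[unfolded D] sgnD[unfolded D], of t "1 - t"] t
        unfolding D w_def by simp
      have "s *\<^sub>R w = x + y"
        using t by (simp add: w_def scaleR_add_right norm_sgn_eq)
      then have "g (x + y) = s * g w" by (metis scale)
      moreover have "\<bar>f w - t * f (sgn x) - (1 - t) * f (sgn y)\<bar> \<le> \<epsilon>"
        unfolding w_def using t sgnD by (intro f[unfolded eps_affine_on_def, rule_format]) auto
      moreover note near[OF \<open>w \<in> D\<close>]
      ultimately have "\<bar>g w - t * f (sgn x) - (1 - t) * f (sgn y)\<bar> \<le> 2 * \<epsilon>" by linarith
      then have "s * \<bar>g w - t * f (sgn x) - (1 - t) * f (sgn y)\<bar> \<le> s * (2 * \<epsilon>)"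
        using s by (intro mult_left_mono) auto
      also have "s * \<bar>g w - t * f (sgn x) - (1 - t) * f (sgn y)\<bar> = \<bar>s * (g w - t * f (sgn x) - (1 - t) * f (sgn y))\<bar>"
        using s by (simp add: abs_mult)
      also have "s * (g w - t * f (sgn x) - (1 - t) * f (sgn y)) = s * g w - (s * t) * f (sgn x) - (s * (1 - t)) * f (sgn y)"
        by (simp add: algebra_simps)
      finally show ?thesis unfolding t g_def[of x] g_def[of y] \<open>g (x + y) = s * g w\<close> .
    qed
    then show "\<bar>g (x + y) / (2 * \<epsilon>) - g x / (2 * \<epsilon>) - g y / (2 * \<epsilon>)\<bar> \<le> norm x + norm y"
      using \<epsilon> by (simp add: s_def field_simps flip: diff_divide_distrib)
  qed
  show ?thesis
    unfolding multi_affine_on_def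
  proof (intro allI impI, elim conjE)
    fix S and u :: "'h \<Rightarrow> real" assume S: "finite S" "S \<subseteq> D" and u: "\<forall>x\<in>S. 0 \<le> u x" "sum u S = 1"
    have "\<bar>g (\<Sum>x\<in>S. u x *\<^sub>R x) / (2 * \<epsilon>) - (\<Sum>x\<in>S. u x * (g x / (2 * \<epsilon>)))\<bar> \<le> 40"
      using S u memD by (intro quasilinear_convex_combination) auto
    then have "\<bar>g (\<Sum>x\<in>S. u x *\<^sub>R x) - (\<Sum>x\<in>S. u x * g x)\<bar> \<le> 80 * \<epsilon>"
      using \<epsilon> by (simp add: field_simps flip: diff_divide_distrib sum_divide_distrib)
    moreover have "(\<Sum>x\<in>S. u x *\<^sub>R x) \<in> D"
      unfolding D using S u convex_closed_unit_ball[OF subspace_UNIV]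
      by (intro convex_sum) (auto simp: D)
    note near[OF this]
    moreover have "\<bar>(\<Sum>x\<in>S. u x * f x) - (\<Sum>x\<in>S. u x * g x)\<bar> \<le> (\<Sum>x\<in>S. u x * \<epsilon>)"
      unfolding sum_subtractf[symmetric] right_diff_distrib[symmetric] using S u near
      by (intro order_trans[OF sum_abs] sum_mono) (auto simp: abs_mult intro!: mult_left_mono)
    moreover have "(\<Sum>x\<in>S. u x * \<epsilon>) = \<epsilon>" using u by (simp flip: sum_distrib_right)
    ultimately show "\<bar>f (\<Sum>x\<in>S. u x *\<^sub>R x) - (\<Sum>x\<in>S. u x * f x)\<bar> \<le> 82 * \<epsilon>" by linarith
  qed
qed

lemma multi_affine_on_limit:
  assumes "\<And>\<delta>. \<epsilon> < \<delta> \<Longrightarrow> multi_affine_on D (C * \<delta>) f" "0 < C"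
  shows "multi_affine_on (D :: 'a::real_vector set) (C * \<epsilon>) f"
  unfolding multi_affine_on_def
proof (intro allI impI)
  fix S and u :: "'a \<Rightarrow> real" assume S: "finite S \<and> S \<subseteq> D \<and> (\<forall>x\<in>S. 0 \<le> u x) \<and> sum u S = 1"
  let ?d = "\<bar>f (\<Sum>x\<in>S. u x *\<^sub>R x) - (\<Sum>x\<in>S. u x * f x)\<bar>"
  have "?d / C \<le> \<epsilon>"
  proof (rule dense_ge)
    fix \<delta> assume "\<epsilon> < \<delta>"
    from assms(1)[OF this] S have "?d \<le> C * \<delta>" by (auto simp: multi_affine_on_def)
    then show "?d / C \<le> \<delta>" using assms(2) by (simp add: divide_simps mult.commute)
  qed
  then show "?d \<le> C * \<epsilon>" using assms(2) by (simp add: divide_simps mult.commute)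
qed

lemma Hilbert_affine_admissible:
  "affine_admissible (closed_unit_ball (UNIV :: 'h::real_inner set)) (82 + 1)"
proof (rule affine_admissible_ball[OF subspace_UNIV refl])
  fix f :: "'h \<Rightarrow> real" and \<epsilon> :: real
  assume *: "0 \<le> \<epsilon>" "eps_affine_on (closed_unit_ball UNIV) \<epsilon> f"
    "\<And>x. x \<in> closed_unit_ball UNIV \<Longrightarrow> f (- x) = - f x"
  show "multi_affine_on (closed_unit_ball UNIV) (82 * \<epsilon>) f"
  proof (rule multi_affine_on_limit)
    fix \<delta> assume "\<epsilon> < \<delta>"
    then have "eps_affine_on (closed_unit_ball UNIV) \<delta> f" "0 < \<delta>"
      using * eps_affine_on_mono[OF *(2), of \<delta>] by auto
    then show "multi_affine_on (closed_unit_ball UNIV) (82 * \<delta>) f"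
      using *(3) by (intro Hilbert_multi_affine) auto
  qed simp
qed

section \<open>Spaces of type \<open>L\<^sub>\<infinity>\<close>\<close>

text \<open>If finitely many points of the ball lie in \<open>3/2\<close> times a zonotope inside the ball, then \<open>f\<close> pulls
  back to a nearly affine function on a cube.\<close>

lemma zonotope_multi_affine:
  fixes f :: "'a::real_normed_vector \<Rightarrow> real" and v :: "'i \<Rightarrow> 'a"
  assumes X: "subspace X" and D: "D = closed_unit_ball X"
    and f: "eps_affine_on D \<epsilon> f" and odd: "\<And>x. x \<in> D \<Longrightarrow> f (- x) = - f x"
    and S: "finite S" "S \<subseteq> D" and u: "\<And>x. x \<in> S \<Longrightarrow> 0 \<le> u x" "sum u S = 1"
    and I: "finite I" and Z: "\<And>b. (\<And>i. i \<in> I \<Longrightarrow> \<bar>b i\<bar> \<le> 1) \<Longrightarrow> (\<Sum>i\<in>I. b i *\<^sub>R v i) \<in> D"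
    and a: "\<And>x i. x \<in> S \<Longrightarrow> i \<in> I \<Longrightarrow> \<bar>a x i\<bar> \<le> 1"
    and rep: "\<And>x. x \<in> S \<Longrightarrow> (\<Sum>i\<in>I. a x i *\<^sub>R v i) = (2 / 3) *\<^sub>R x"
  shows "\<bar>f (\<Sum>x\<in>S. u x *\<^sub>R x) - (\<Sum>x\<in>S. u x * f x)\<bar> \<le> 972 * \<epsilon>"
proof -
  define \<phi> where "\<phi> b = f (\<Sum>i\<in>I. b i *\<^sub>R v i)" for b
  interpret near_affine_cube I \<phi> \<epsilon> "{b. \<forall>i\<in>I. \<bar>b i\<bar> \<le> 1}"
  proof unfold_locales
    show "finite I" by (rule I)
    show "\<phi> b = \<phi> c" if "\<And>i. i \<in> I \<Longrightarrow> b i = c i" for b c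
      unfolding \<phi>_def using that by (intro arg_cong[where f = f] sum.cong) auto
    show "\<phi> (\<lambda>i. - b i) = - \<phi> b" if "b \<in> {b. \<forall>i\<in>I. \<bar>b i\<bar> \<le> 1}" for b
      unfolding \<phi>_def using that odd[OF Z[of b]] by (simp add: sum_negf)
    fix b c :: "'i \<Rightarrow> real" and t :: real
    assume *: "b \<in> {b. \<forall>i\<in>I. \<bar>b i\<bar> \<le> 1}" "c \<in> {b. \<forall>i\<in>I. \<bar>b i\<bar> \<le> 1}" "0 \<le> t" "t \<le> 1"
    have "(\<Sum>i\<in>I. (t * b i + (1 - t) * c i) *\<^sub>R v i)
        = t *\<^sub>R (\<Sum>i\<in>I. b i *\<^sub>R v i) + (1 - t) *\<^sub>R (\<Sum>i\<in>I. c i *\<^sub>R v i)"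
      by (simp add: scaleR_sum_right scaleR_add_left sum.distrib)
    then show "\<bar>\<phi> (\<lambda>i. t * b i + (1 - t) * c i) - t * \<phi> b - (1 - t) * \<phi> c\<bar> \<le> \<epsilon>"
      using * Z[of b] Z[of c] unfolding \<phi>_def
      by (simp only:) (intro f[unfolded eps_affine_on_def, rule_format], auto)
  qed
  have "\<bar>\<phi> (\<lambda>i. \<Sum>x\<in>S. u x * a x i) - (\<Sum>x\<in>S. u x * \<phi> (a x))\<bar> \<le> 646 * \<epsilon>"
    using S u a by (intro cube_convex_combination) auto
  moreover define y where "y = (\<Sum>x\<in>S. u x *\<^sub>R x)"
  have "(\<Sum>i\<in>I. (\<Sum>x\<in>S. u x * a x i) *\<^sub>R v i) = (\<Sum>x\<in>S. u x *\<^sub>R (\<Sum>i\<in>I. a x i *\<^sub>R v i))"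
    by (simp add: scaleR_sum_left scaleR_sum_right) (rule sum.swap)
  then have "\<phi> (\<lambda>i. \<Sum>x\<in>S. u x * a x i) = f ((2 / 3) *\<^sub>R y)"
    by (simp add: \<phi>_def rep y_def scaleR_sum_right mult.commute)
  moreover have "(\<Sum>x\<in>S. u x * \<phi> (a x)) = (\<Sum>x\<in>S. u x * f ((2 / 3) *\<^sub>R x))"
    by (simp add: \<phi>_def rep)
  ultimately have 1: "\<bar>f ((2 / 3) *\<^sub>R y) - (\<Sum>x\<in>S. u x * f ((2 / 3) *\<^sub>R x))\<bar> \<le> 646 * \<epsilon>"
    by simp
  have f0: "f 0 = 0" using odd[of 0] closed_unit_ball_0[OF X] by (simp add: D)
  \<comment> \<open>Shrinking by 2/3 costs \<epsilon> at \<open>y\<close> and \<epsilon> on average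
    over \<open>S\<close>; clearing the factor gives 3/2 (646 + 2) = 972.\<close>
  have scale: "\<bar>f ((2 / 3) *\<^sub>R x) - 2 / 3 * f x\<bar> \<le> \<epsilon>" if "x \<in> D" for x
    using that f f0 unfolding D by (intro eps_affine_on_scaleR[OF X]) auto
  have "y \<in> D"
    unfolding D y_def using S u convex_closed_unit_ball[OF X] by (intro convex_sum) (auto simp: D)
  note 2 = scale[OF this]
  have "\<bar>(\<Sum>x\<in>S. u x * f ((2 / 3) *\<^sub>R x)) - (\<Sum>x\<in>S. u x * (2 / 3 * f x))\<bar> \<le> (\<Sum>x\<in>S. u x * \<epsilon>)"
    unfolding sum_subtractf[symmetric] right_diff_distrib[symmetric] using S u scale
    by (intro order_trans[OF sum_abs] sum_mono) (auto simp: abs_mult intro!: mult_left_mono)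
  moreover have "(\<Sum>x\<in>S. u x * \<epsilon>) = \<epsilon>" using u by (simp flip: sum_distrib_right)
  moreover have "(\<Sum>x\<in>S. u x * (2 / 3 * f x)) = 2 / 3 * (\<Sum>x\<in>S. u x * f x)"
    by (simp add: sum_distrib_left mult_ac)
  ultimately show ?thesis using 1 2 unfolding y_def by linarith
qed

section \<open>Zonotopes in sequence spaces\<close>

definition ind :: "nat set \<Rightarrow> linfty" where
  "ind A = Bcontfun (indicator A)"

lemma ind_apply [simp]: "apply_bcontfun (ind A) k = indicator A k"
proof -
  have "(indicator A :: nat \<Rightarrow> real) \<in> bcontfun"
    by (rule bcontfun_normI[of _ 1]) (auto simp: indicator_def)
  then show ?thesis by (simp add: ind_def Bcontfun_inverse)
qed

lemma sum_apply_bcontfun: "apply_bcontfun (sum f I) k = (\<Sum>i\<in>I. apply_bcontfun (f i) k)"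
  for f :: "'i \<Rightarrow> linfty"
  by (induction I rule: infinite_finite_induct) auto

lemma linfty_ball: "x \<in> closed_unit_ball X \<longleftrightarrow> x \<in> X \<and> (\<forall>k. \<bar>apply_bcontfun x k\<bar> \<le> 1)" for x :: linfty
  unfolding closed_unit_ball_def
  by (auto intro: norm_bound order_trans[OF norm_bounded, simplified])
    (metis norm_bounded order_trans real_norm_def)

text \<open>The error vectors \<open>x - \<Sum>A. a x A ind A\<close> are used as additional generators of the zonotope.\<close>

lemma linfty_affine_admissible:
  fixes X :: "linfty set"
  assumes X: "subspace X"
    and approx: "\<And>S \<delta>. finite S \<Longrightarrow> S \<subseteq> closed_unit_ball X \<Longrightarrow> 0 < \<delta> \<Longrightarrow>
      \<exists>\<A> a. finite \<A> \<and> disjoint \<A> \<and> ind ` \<A> \<subseteq> X \<and>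
        (\<forall>x\<in>S. (\<forall>A\<in>\<A>. \<bar>a x A\<bar> \<le> 1) \<and> (\<forall>k. \<bar>apply_bcontfun x k - (\<Sum>A\<in>\<A>. a x A * indicator A k)\<bar> \<le> \<delta>))"
  shows "affine_admissible (closed_unit_ball X) (972 + 1)"
proof (rule affine_admissible_ball[OF X refl])
  fix f :: "linfty \<Rightarrow> real" and \<epsilon> :: real
  let ?D = "closed_unit_ball X"
  assume f: "0 \<le> \<epsilon>" "eps_affine_on ?D \<epsilon> f" "\<And>x. x \<in> ?D \<Longrightarrow> f (- x) = - f x"
  show "multi_affine_on ?D (972 * \<epsilon>) f"
    unfolding multi_affine_on_def
  proof (intro allI impI, elim conjE)
    fix S and u :: "linfty \<Rightarrow> real"
    assume S: "finite S" "S \<subseteq> ?D" and u: "\<forall>x\<in>S. 0 \<le> u x" "sum u S = 1"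
    \<comment> \<open>Chosen so that all error vectors together have norm at most 1/2. With the
      indicator part, of norm at most 1, the zonotope then has radius 2/3 (1 + 1/2) = 1.\<close>
    define \<delta> where "\<delta> = 1 / (2 * (real (card S) + 1))"
    have \<delta>: "\<delta> > 0" "real (card S) * \<delta> \<le> 1 / 2" by (simp_all add: \<delta>_def field_simps)
    obtain \<A> a where \<A>: "finite \<A>" "disjoint \<A>" "ind ` \<A> \<subseteq> X"
      and a: "\<forall>x\<in>S. (\<forall>A\<in>\<A>. \<bar>a x A\<bar> \<le> 1) \<and> (\<forall>k. \<bar>apply_bcontfun x k - (\<Sum>A\<in>\<A>. a x A * indicator A k)\<bar> \<le> \<delta>)"
      using approx[OF S \<delta>(1)] by (elim exE conjE)
    define e where "e x = x - (\<Sum>A\<in>\<A>. a x A *\<^sub>R ind A)" for x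
    have eX: "e x \<in> X" if "x \<in> S" for x
      unfolding e_def using that S \<A> X
      by (intro subspace_diff subspace_sum subspace_scale) (auto simp: closed_unit_ball_def)
    have e: "\<bar>apply_bcontfun (e x) k\<bar> \<le> \<delta>" if "x \<in> S" for x k
      using a that by (simp add: e_def sum_apply_bcontfun)
    define v where "v = case_sum (\<lambda>A. (2 / 3) *\<^sub>R ind A) (\<lambda>x. (2 / 3) *\<^sub>R e x)"
    \<comment> \<open>Coordinate 1 at the error generator belonging to \<open>x\<close> itself makes
      the representation of \<open>x\<close> exact.\<close>
    define c where "c x = case_sum (a x) (\<lambda>y. of_bool (y = x))" for x
    show "\<bar>f (\<Sum>x\<in>S. u x *\<^sub>R x) - (\<Sum>x\<in>S. u x * f x)\<bar> \<le> 972 * \<epsilon>"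
    proof (rule zonotope_multi_affine[OF X refl f(2,3) S _ u(2), where I = "\<A> <+> S" and v = v and a = c])
      show "finite (\<A> <+> S)" using \<A> S by simp
      show "\<bar>c x i\<bar> \<le> 1" if "x \<in> S" "i \<in> \<A> <+> S" for x i
        using that a by (auto simp: c_def)
      show "(\<Sum>i\<in>\<A> <+> S. c x i *\<^sub>R v i) = (2 / 3) *\<^sub>R x" if "x \<in> S" for x
      proof -
        have "(\<Sum>y\<in>S. of_bool (y = x) *\<^sub>R ((2 / 3) *\<^sub>R e y)) = (\<Sum>y\<in>S. if y = x then (2 / 3) *\<^sub>R e y else 0)"
          by (intro sum.cong) auto
        also have "\<dots> = (2 / 3) *\<^sub>R e x" using that S by simp
        finally show ?thesis
          using \<A> S by (simp add: sum.Plus c_def v_def e_def algebra_simps scaleR_sum_right)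
      qed
      fix b :: "nat set + linfty \<Rightarrow> real" assume b: "\<And>i. i \<in> \<A> <+> S \<Longrightarrow> \<bar>b i\<bar> \<le> 1"
      let ?z = "\<Sum>i\<in>\<A> <+> S. b i *\<^sub>R v i"
      have "?z \<in> X"
      proof (intro subspace_sum subspace_scale X)
        show "v i \<in> X" if "i \<in> \<A> <+> S" for i
          using that \<A>(3) eX by (auto simp: v_def intro!: subspace_scale[OF X])
      qed
      moreover have "\<bar>apply_bcontfun ?z k\<bar> \<le> 1" for k
      proof -
        \<comment> \<open>By disjointness at most one indicator is nonzero at
          \<open>k\<close>.\<close>
        have 1: "\<bar>\<Sum>A\<in>\<A>. b (Inl A) * indicator A k\<bar> \<le> 1"
        proof (cases "\<exists>A\<in>\<A>. k \<in> A")
          case True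
          then obtain A where A: "A \<in> \<A>" "k \<in> A" by blast
          have "(\<Sum>B\<in>\<A>. b (Inl B) * indicator B k) = (\<Sum>B\<in>\<A>. if B = A then b (Inl B) else 0)"
          proof (intro sum.cong refl)
            fix B assume "B \<in> \<A>"
            then have "k \<in> B \<longleftrightarrow> B = A" using A disjointD[OF \<A>(2), of B A] by blast
            then show "b (Inl B) * indicator B k = (if B = A then b (Inl B) else 0)"
              using A by (auto simp: indicator_def)
          qed
          also have "\<dots> = b (Inl A)" using A \<A>(1) by simp
          finally show ?thesis using b[of "Inl A"] A by auto
        next
          case False
          then have "(\<Sum>B\<in>\<A>. b (Inl B) * indicator B k) = (0 :: real)" by (intro sum.neutral) auto
          then show ?thesis by simp
        qed
        have "\<bar>\<Sum>x\<in>S. b (Inr x) * apply_bcontfun (e x) k\<bar> \<le> (\<Sum>x\<in>S. 1 * \<delta>)"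
          using b e by (intro order_trans[OF sum_abs] sum_mono, unfold abs_mult) (intro mult_mono, auto)
        then have 2: "\<bar>\<Sum>x\<in>S. b (Inr x) * apply_bcontfun (e x) k\<bar> \<le> 1 / 2" using \<delta> by simp
        have "apply_bcontfun ?z k = (\<Sum>A\<in>\<A>. b (Inl A) * apply_bcontfun (v (Inl A)) k)
            + (\<Sum>x\<in>S. b (Inr x) * apply_bcontfun (v (Inr x)) k)"
          by (simp add: sum_apply_bcontfun sum.Plus[OF \<A>(1) S(1)])
        moreover have "(\<Sum>A\<in>\<A>. b (Inl A) * apply_bcontfun (v (Inl A)) k)
            = 2 / 3 * (\<Sum>A\<in>\<A>. b (Inl A) * indicator A k)"
          unfolding sum_distrib_left by (intro sum.cong) (auto simp: v_def)
        moreover have "(\<Sum>x\<in>S. b (Inr x) * apply_bcontfun (v (Inr x)) k)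
            = 2 / 3 * (\<Sum>x\<in>S. b (Inr x) * apply_bcontfun (e x) k)"
          unfolding sum_distrib_left by (intro sum.cong) (auto simp: v_def)
        moreover note 1 2
        ultimately show ?thesis by linarith
      qed
      ultimately show "?z \<in> ?D" by (simp add: linfty_ball)
    qed (use u in auto)
  qed
qed

text \<open>The disjoint sets are the singletons below a cutoff beyond which all points of
  \<open>S\<close> are small.\<close>

lemma linfty_cutoff_affine_admissible:
  fixes X :: "linfty set"
  assumes X: "subspace X"
    and cutoff: "\<And>S \<delta>. finite S \<Longrightarrow> S \<subseteq> closed_unit_ball X \<Longrightarrow> 0 < \<delta> \<Longrightarrow>
      \<exists>n. (\<forall>i<n. ind {i} \<in> X) \<and> (\<forall>x\<in>S. \<forall>k\<ge>n. \<bar>apply_bcontfun x k\<bar> \<le> \<delta>)"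
  shows "affine_admissible (closed_unit_ball X) (972 + 1)"
proof (rule linfty_affine_admissible[OF X])
  fix S :: "linfty set" and \<delta> :: real
  assume S: "finite S" "S \<subseteq> closed_unit_ball X" and \<delta>: "0 < \<delta>"
  obtain n where n: "\<forall>i<n. ind {i} \<in> X" "\<forall>x\<in>S. \<forall>k\<ge>n. \<bar>apply_bcontfun x k\<bar> \<le> \<delta>"
    using cutoff[OF S \<delta>] by blast
  define \<A> where "\<A> = (\<lambda>i. {i}) ` {..<n}"
  define a where "a x A = apply_bcontfun x (the_elem A)" for x :: linfty and A :: "nat set"
  have sum: "(\<Sum>A\<in>\<A>. a x A * indicator A k) = (if k < n then apply_bcontfun x k else 0)" for x :: linfty and k
  proof -
    have "(\<Sum>A\<in>\<A>. a x A * indicator A k) = (\<Sum>i<n. apply_bcontfun x i * indicator {i} k)"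
      unfolding \<A>_def a_def by (subst sum.reindex) (auto simp: inj_on_def)
    also have "\<dots> = (\<Sum>i<n. if i = k then apply_bcontfun x i else 0)"
      by (intro sum.cong) (auto simp: indicator_def)
    finally show ?thesis by simp
  qed
  have "(\<forall>A\<in>\<A>. \<bar>a x A\<bar> \<le> 1) \<and> (\<forall>k. \<bar>apply_bcontfun x k - (\<Sum>A\<in>\<A>. a x A * indicator A k)\<bar> \<le> \<delta>)"
    if "x \<in> S" for x
    using that S(2) n(2) \<delta> unfolding sum by (auto simp: a_def linfty_ball)
  moreover have "finite \<A>" "disjoint \<A>" "ind ` \<A> \<subseteq> X"
    using n(1) by (auto simp: \<A>_def disjoint_def)
  ultimately show "\<exists>\<A> a. finite \<A> \<and> disjoint \<A> \<and> ind ` \<A> \<subseteq> X \<and>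
        (\<forall>x\<in>S. (\<forall>A\<in>\<A>. \<bar>a x A\<bar> \<le> 1) \<and> (\<forall>k. \<bar>apply_bcontfun x k - (\<Sum>A\<in>\<A>. a x A * indicator A k)\<bar> \<le> \<delta>))"
    by (intro exI[of _ \<A>] exI[of _ a] conjI ballI) auto
qed

lemma subspace_linfty_n: "subspace (linfty_n n)"
  by (auto simp: subspace_def linfty_n_def)

lemma linfty_n_affine_admissible: "affine_admissible (closed_unit_ball (linfty_n n)) (972 + 1)"
  by (rule linfty_cutoff_affine_admissible[OF subspace_linfty_n], rule exI[of _ n])
    (auto simp: linfty_n_def closed_unit_ball_def)

lemma subspace_c_zero: "subspace c_zero"
proof (rule subspaceI)
  show "0 \<in> c_zero" by (simp add: c_zero_def)
  show "x + y \<in> c_zero" if "x \<in> c_zero" "y \<in> c_zero" for x y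
    using that tendsto_add[of "apply_bcontfun x" 0 sequentially "apply_bcontfun y" 0] by (simp add: c_zero_def)
  show "c *\<^sub>R x \<in> c_zero" if "x \<in> c_zero" for c x
    using that tendsto_mult_right_zero[of "apply_bcontfun x" sequentially c] by (simp add: c_zero_def)
qed

lemma c_zero_affine_admissible: "affine_admissible (closed_unit_ball c_zero) (972 + 1)"
proof (rule linfty_cutoff_affine_admissible[OF subspace_c_zero])
  fix S :: "linfty set" and \<delta> :: real
  assume S: "finite S" "S \<subseteq> closed_unit_ball c_zero" and \<delta>: "0 < \<delta>"
  have "\<forall>\<^sub>F k in sequentially. \<forall>x\<in>S. \<bar>apply_bcontfun x k\<bar> \<le> \<delta>"
  proof (intro eventually_ball_finite S(1) ballI)
    fix x assume "x \<in> S"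
    then have "(\<lambda>k. apply_bcontfun x k) \<longlonglongrightarrow> 0" using S(2) by (auto simp: closed_unit_ball_def c_zero_def)
    from tendstoD[OF this \<delta>] show "\<forall>\<^sub>F k in sequentially. \<bar>apply_bcontfun x k\<bar> \<le> \<delta>"
      by (rule eventually_mono) simp
  qed
  then obtain n where "\<forall>k\<ge>n. \<forall>x\<in>S. \<bar>apply_bcontfun x k\<bar> \<le> \<delta>" by (auto simp: eventually_sequentially)
  moreover have "ind {i} \<in> c_zero" for i
  proof -
    have "\<forall>\<^sub>F k in sequentially. (indicator {i} k :: real) = 0"
      using eventually_gt_at_top[of i] by (rule eventually_mono) auto
    then show ?thesis by (simp add: c_zero_def tendsto_eventually)
  qed
  ultimately show "\<exists>n. (\<forall>i<n. ind {i} \<in> c_zero) \<and> (\<forall>x\<in>S. \<forall>k\<ge>n. \<bar>apply_bcontfun x k\<bar> \<le> \<delta>)" by blast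
qed

text \<open>No cutoff exists here. Instead the values of all \<open>x\<close> in \<open>S\<close>
  are rounded down simultaneously to multiples of \<open>1 / M\<close>; the level sets of the
  resulting vector form finitely many cells, on each of which every \<open>x\<close> varies by at
  most \<open>1 / M\<close>, so its value at one chosen point of the cell will do.\<close>

lemma linfty_UNIV_affine_admissible: "affine_admissible (closed_unit_ball (UNIV :: linfty set)) (972 + 1)"
proof (rule linfty_affine_admissible[OF subspace_UNIV])
  fix S :: "linfty set" and \<delta> :: real
  assume S: "finite S" "S \<subseteq> closed_unit_ball UNIV" and \<delta>: "0 < \<delta>"
  obtain M :: nat where M: "1 / \<delta> < real M" using reals_Archimedean2 by blast
  then have M0: "M > 0" using \<delta> by (cases M) auto
  define lev where "lev k = (\<lambda>x\<in>S. \<lfloor>real M * apply_bcontfun x k\<rfloor>)" for k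
  define \<A> where "\<A> = range (\<lambda>k. {j. lev j = lev k})"
  define a where "a x A = apply_bcontfun x (SOME k. k \<in> A)" for x :: linfty and A :: "nat set"
  have bound: "\<bar>apply_bcontfun x k\<bar> \<le> 1" if "x \<in> S" for x k using that S(2) by (auto simp: linfty_ball)
  have "lev k \<in> (\<Pi>\<^sub>E x\<in>S. {- int M..int M})" for k
  proof (rule PiE_I)
    fix x assume x: "x \<in> S"
    have "\<bar>real M * apply_bcontfun x k\<bar> \<le> real M * 1"
      unfolding abs_mult using bound[OF x] by (intro mult_mono) auto
    then show "lev k x \<in> {- int M..int M}" using x by (simp add: lev_def abs_le_iff) linarith
  qed (simp add: lev_def)
  then have "finite (range lev)" using S(1) by (intro finite_subset[of "range lev" "\<Pi>\<^sub>E x\<in>S. {- int M..int M}"] finite_PiE) auto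
  then have "finite ((\<lambda>l. {j. lev j = l}) ` range lev)" by (rule finite_imageI)
  then have fin: "finite \<A>" by (simp add: \<A>_def image_image)
  have dis: "disjoint \<A>" by (auto simp: \<A>_def disjoint_def)
  have sum: "(\<Sum>A\<in>\<A>. a x A * indicator A k) = a x {j. lev j = lev k}" for x :: linfty and k
  proof -
    have "(\<Sum>A\<in>\<A>. a x A * indicator A k) = (\<Sum>A\<in>\<A>. if A = {j. lev j = lev k} then a x A else 0)"
      by (intro sum.cong) (auto simp: \<A>_def indicator_def)
    also have "\<dots> = a x {j. lev j = lev k}" using fin by (simp add: \<A>_def)
    finally show ?thesis .
  qed
  have "(\<forall>A\<in>\<A>. \<bar>a x A\<bar> \<le> 1) \<and> (\<forall>k. \<bar>apply_bcontfun x k - (\<Sum>A\<in>\<A>. a x A * indicator A k)\<bar> \<le> \<delta>)"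
    if x: "x \<in> S" for x
  proof (intro conjI ballI allI)
    show "\<bar>a x A\<bar> \<le> 1" for A unfolding a_def by (rule bound[OF x])
    fix k
    define m where "m = (SOME j. lev j = lev k)"
    have "lev m = lev k" unfolding m_def by (rule someI[of _ k]) simp
    then have "\<lfloor>real M * apply_bcontfun x m\<rfloor> = \<lfloor>real M * apply_bcontfun x k\<rfloor>"
      using x by (metis lev_def restrict_apply')
    then have "\<bar>real M * apply_bcontfun x k - real M * apply_bcontfun x m\<bar> \<le> 1" by linarith
    then have "real M * \<bar>apply_bcontfun x k - apply_bcontfun x m\<bar> \<le> 1"
      unfolding right_diff_distrib[symmetric] abs_mult by simp
    then have "\<bar>apply_bcontfun x k - apply_bcontfun x m\<bar> \<le> 1 / real M"
      using M0 by (simp add: field_simps)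
    also have "\<dots> \<le> \<delta>" using M \<delta> M0 by (simp add: field_simps)
    finally show "\<bar>apply_bcontfun x k - (\<Sum>A\<in>\<A>. a x A * indicator A k)\<bar> \<le> \<delta>"
      unfolding sum by (simp add: a_def m_def)
  qed
  with fin dis show "\<exists>\<A> a. finite \<A> \<and> disjoint \<A> \<and> ind ` \<A> \<subseteq> UNIV \<and>
        (\<forall>x\<in>S. (\<forall>A\<in>\<A>. \<bar>a x A\<bar> \<le> 1) \<and> (\<forall>k. \<bar>apply_bcontfun x k - (\<Sum>A\<in>\<A>. a x A * indicator A k)\<bar> \<le> \<delta>))"
    by (intro exI[of _ \<A>] exI[of _ a] conjI ballI) auto
qed

section \<open>Jensen functions\<close>

lemma Jensen_midpoint:
  assumes "subspace X" "x \<in> closed_unit_ball X" "y \<in> closed_unit_ball X"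
  shows "midpoint x y \<in> closed_unit_ball X"
  using convexD[OF convex_closed_unit_ball[OF assms(1)] assms(2,3), of "1 / 2" "1 / 2"]
  by (simp add: midpoint_def scaleR_add_right)

text \<open>Halving the parameter: a supremum \<open>M\<close> of the defects satisfies \<open>M \<le> \<epsilon> + M / 2\<close>, provided it is finite.\<close>

lemma eps_affine_if_bounded:
  assumes X: "subspace X" and D: "D = closed_unit_ball X" and f: "eps_Jensen_on D \<epsilon> f"
    and bdd: "\<And>x y. x \<in> D \<Longrightarrow> y \<in> D \<Longrightarrow> \<exists>M. \<forall>t\<in>{0..1}. \<bar>f (t *\<^sub>R x + (1 - t) *\<^sub>R y)\<bar> \<le> M"
  shows "eps_affine_on D (2 * \<epsilon>) f"
  unfolding eps_affine_on_def
proof (intro ballI)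
  fix x y and s :: real assume xy: "x \<in> D" "y \<in> D" and s: "s \<in> {0..1}"
  define d where "d t = \<bar>f (t *\<^sub>R x + (1 - t) *\<^sub>R y) - t * f x - (1 - t) * f y\<bar>" for t
  obtain M where M: "\<And>t. t \<in> {0..1} \<Longrightarrow> \<bar>f (t *\<^sub>R x + (1 - t) *\<^sub>R y)\<bar> \<le> M"
    using bdd[OF xy] by blast
  have "d t \<le> M + \<bar>f x\<bar> + \<bar>f y\<bar>" if "t \<in> {0..1}" for t
  proof -
    have "\<bar>t * f x\<bar> \<le> \<bar>f x\<bar>" "\<bar>(1 - t) * f y\<bar> \<le> \<bar>f y\<bar>"
      using that by (auto simp: abs_mult intro!: mult_left_le_one_le)
    with M[OF that] show ?thesis unfolding d_def by linarith
  qed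
  then have bdd: "bdd_above (d ` {0..1})" by (intro bdd_aboveI[of _ "M + \<bar>f x\<bar> + \<bar>f y\<bar>"]) auto
  define S where "S = Sup (d ` {0..1})"
  have dS: "d t \<le> S" if "t \<in> {0..1}" for t unfolding S_def using that by (intro cSup_upper bdd) auto
  have mid: "\<bar>f (midpoint u v) - (f u + f v) / 2\<bar> \<le> \<epsilon>" if "u \<in> D" "v \<in> D" for u v
    using f that by (simp add: eps_Jensen_on_def)
  have segD: "t *\<^sub>R x + (1 - t) *\<^sub>R y \<in> D" if "t \<in> {0..1}" for t
    using that xy convexD[OF convex_closed_unit_ball[OF X], of x y t "1 - t"] by (auto simp: D)
  have avg: "\<bar>w\<bar> \<le> \<epsilon> + S / 2" if "\<bar>v\<bar> \<le> \<epsilon>" "\<bar>z\<bar> \<le> S" "w = v + z / 2" for v w z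
    using that abs_triangle_ineq[of v "z / 2"] by simp
  \<comment> \<open>The point with parameter \<open>t\<close> is the midpoint of an endpoint and the
    point with parameter \<open>2 * t\<close> or \<open>2 * t - 1\<close>, whose defect enters with
    factor 1/2.\<close>
  have half: "d t \<le> \<epsilon> + S / 2" if t: "t \<in> {0..1}" for t
  proof (cases "t \<le> 1 / 2")
    case True
    have eq: "midpoint ((2 * t) *\<^sub>R x + (1 - 2 * t) *\<^sub>R y) y = t *\<^sub>R x + (1 - t) *\<^sub>R y"
      by (simp add: midpoint_def algebra_simps flip: scaleR_add_left)
    have t2: "2 * t \<in> {0..1}" using t True by simp
    show ?thesis
      unfolding d_def
      using mid[OF segD[OF t2] xy(2), unfolded eq] dS[OF t2, unfolded d_def] by (rule avg) (simp add: field_simps)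
  next
    case False
    have eq: "midpoint ((2 * t - 1) *\<^sub>R x + (1 - (2 * t - 1)) *\<^sub>R y) x = t *\<^sub>R x + (1 - t) *\<^sub>R y"
      by (simp add: midpoint_def algebra_simps flip: scaleR_add_left)
    have t2: "2 * t - 1 \<in> {0..1}" using t False by simp
    show ?thesis
      unfolding d_def
      using mid[OF segD[OF t2] xy(1), unfolded eq] dS[OF t2, unfolded d_def] by (rule avg) (simp add: field_simps)
  qed
  have "S \<le> \<epsilon> + S / 2"
    unfolding S_def by (rule cSup_least) (use half in \<open>auto simp: S_def\<close>)
  then have "S \<le> 2 * \<epsilon>" by simp
  with dS[OF s] show "\<bar>f (s *\<^sub>R x + (1 - s) *\<^sub>R y) - s * f x - (1 - s) * f y\<bar> \<le> 2 * \<epsilon>"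
    unfolding d_def by linarith
qed

text \<open>The additive function is the limit of H(2^n x) / 2^n: doubling the argument changes the
  quotient by at most C / 2^(n + 1), which sums to C, and the additivity error at stage n is at most
  C / 2^n.\<close>

lemma Hyers:
  fixes H :: "real \<Rightarrow> real"
  assumes H: "\<And>x y. \<bar>H (x + y) - H x - H y\<bar> \<le> C"
  shows "\<exists>a. (\<forall>x y. a (x + y) = a x + a y) \<and> (\<forall>x. \<bar>H x - a x\<bar> \<le> C)"
proof -
  have C: "C \<ge> 0" using order_trans[OF abs_ge_zero H[of 0 0]] .
  define b where "b x n = H (2 ^ n * x) / 2 ^ n" for x n
  have step: "\<bar>b x (Suc n) - b x n\<bar> \<le> C * (1 / 2) ^ Suc n" for x n
  proof -
    have "b x (Suc n) - b x n = (H (2 ^ n * x + 2 ^ n * x) - H (2 ^ n * x) - H (2 ^ n * x)) / 2 ^ Suc n"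
      by (simp add: b_def field_simps)
    also have "\<bar>\<dots>\<bar> \<le> C / 2 ^ Suc n"
      using H[of "2 ^ n * x" "2 ^ n * x"] by (simp add: divide_right_mono)
    finally show ?thesis by (simp add: power_divide)
  qed
  have summ: "summable (\<lambda>n. C * (1 / 2 :: real) ^ Suc n)" by (intro summable_mult summable_Suc_iff[THEN iffD2] summable_geometric) simp
  have summ': "summable (\<lambda>n. b x (Suc n) - b x n)" for x
    by (rule summable_comparison_test'[OF summ, of 0]) (use step in simp)
  define a where "a x = b x 0 + (\<Sum>n. b x (Suc n) - b x n)" for x
  have lim: "(\<lambda>n. b x n) \<longlonglongrightarrow> a x" for x
  proof -
    have "(\<lambda>n. b x 0 + (\<Sum>k<n. b x (Suc k) - b x k)) \<longlonglongrightarrow> a x"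
      unfolding a_def by (intro tendsto_intros summable_LIMSEQ summ')
    then show ?thesis by (simp add: sum_lessThan_telescope)
  qed
  have "a (x + y) = a x + a y" for x y
  proof -
    have "(\<lambda>n. b (x + y) n - b x n - b y n) \<longlonglongrightarrow> 0"
    proof (rule Lim_null_comparison)
      have "norm (b (x + y) n - b x n - b y n) \<le> C * (1 / 2) ^ n" for n
      proof -
        have "b (x + y) n - b x n - b y n = (H (2 ^ n * x + 2 ^ n * y) - H (2 ^ n * x) - H (2 ^ n * y)) / 2 ^ n"
          by (simp add: b_def field_simps)
        also have "norm \<dots> \<le> C / 2 ^ n"
          using H[of "2 ^ n * x" "2 ^ n * y"] by (simp add: divide_right_mono)
        finally show ?thesis by (simp add: power_divide)
      qed
      then show "\<forall>\<^sub>F n in sequentially. norm (b (x + y) n - b x n - b y n) \<le> C * (1 / 2) ^ n" by simp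
      show "(\<lambda>n. C * (1 / 2 :: real) ^ n) \<longlonglongrightarrow> 0"
        by (intro tendsto_mult_right_zero LIMSEQ_power_zero) simp
    qed
    moreover have "(\<lambda>n. b (x + y) n - b x n - b y n) \<longlonglongrightarrow> a (x + y) - a x - a y"
      by (intro tendsto_diff lim)
    ultimately have "a (x + y) - a x - a y = 0" by (rule LIMSEQ_unique[rotated])
    then show ?thesis by simp
  qed
  moreover have "\<bar>H x - a x\<bar> \<le> C" for x
  proof -
    have "H x - a x = - (\<Sum>n. b x (Suc n) - b x n)" by (simp add: a_def b_def)
    moreover have "norm (\<Sum>n. b x (Suc n) - b x n) \<le> (\<Sum>n. C * (1 / 2) ^ Suc n)"
      by (rule norm_suminf_le) (use step summ in auto)
    moreover have "(\<Sum>n. C * (1 / 2 :: real) ^ Suc n) = C"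
      using sums_mult[OF power_half_series, of C] by (simp add: sums_iff)
    ultimately show ?thesis by simp
  qed
  ultimately show ?thesis by blast
qed

text \<open>\<open>h\<close> is extended from \<open>[0, 1)\<close> to the real line by \<open>h (x + 1) = h x + h 1\<close>.\<close>

lemma additive_approximation_on_interval:
  fixes h :: "real \<Rightarrow> real"
  assumes h: "\<And>s t. \<bar>s\<bar> \<le> 1 \<Longrightarrow> \<bar>t\<bar> \<le> 1 \<Longrightarrow> \<bar>h ((s + t) / 2) - (h s + h t) / 2\<bar> \<le> \<epsilon>"
    and h0: "h 0 = 0"
  shows "\<exists>a. (\<forall>x y. a (x + y) = a x + a y) \<and> (\<exists>C. \<forall>t. \<bar>t\<bar> \<le> 1 \<longrightarrow> \<bar>h t - a t\<bar> \<le> C)"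
proof -
  define H where "H x = h (frac x) + of_int \<lfloor>x\<rfloor> * h 1" for x
  \<comment> \<open>Pairs with the same sum share their midpoint.\<close>
  have swap: "\<bar>h s + h t - h s' - h t'\<bar> \<le> 4 * \<epsilon>"
    if "\<bar>s\<bar> \<le> 1" "\<bar>t\<bar> \<le> 1" "\<bar>s'\<bar> \<le> 1" "\<bar>t'\<bar> \<le> 1" "s + t = s' + t'" for s t s' t'
    using h[OF that(1,2)] h[OF that(3,4)] unfolding that(5) by (simp add: field_simps abs_le_iff)
  have "\<bar>H (x + y) - H x - H y\<bar> \<le> 4 * \<epsilon>" for x y
  proof -
    have fr: "0 \<le> frac x" "frac x \<le> 1" "0 \<le> frac y" "frac y \<le> 1" "0 \<le> frac (x + y)" "frac (x + y) \<le> 1"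
      by (auto intro: less_imp_le frac_lt_1)
    show ?thesis
    proof (cases "frac x + frac y < 1")
      case True
      then have "frac (x + y) = frac x + frac y" "\<lfloor>x + y\<rfloor> = \<lfloor>x\<rfloor> + \<lfloor>y\<rfloor>"
        by (simp_all add: frac_add floor_add)
      with swap[of "frac (x + y)" 0 "frac x" "frac y"] fr h0 show ?thesis
        by (simp add: H_def algebra_simps)
    next
      case False
      then have "frac (x + y) = frac x + frac y - 1" "\<lfloor>x + y\<rfloor> = \<lfloor>x\<rfloor> + \<lfloor>y\<rfloor> + 1"
        by (simp_all add: frac_add floor_add)
      \<comment> \<open>A carry replaces the pair of fractional parts by
        \<open>frac x + frac y - 1\<close> and 1, and the larger floor accounts for the additional
        \<open>h 1\<close>.\<close>
      moreover have "\<bar>h (frac x + frac y - 1) + h 1 - h (frac x) - h (frac y)\<bar> \<le> 4 * \<epsilon>"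
        using False fr by (intro swap) auto
      ultimately show ?thesis by (simp add: H_def distrib_right)
    qed
  qed
  then obtain a where a: "\<And>x y. a (x + y) = a x + a y" "\<And>x. \<bar>H x - a x\<bar> \<le> 4 * \<epsilon>"
    using Hyers[of H "4 * \<epsilon>"] by blast
  have a0: "a 0 = 0" using a(1)[of 0 0] by simp
  have a_neg: "a (- x) = - a x" for x using a(1)[of x "- x"] a0 by simp
  have pos: "\<bar>h t - a t\<bar> \<le> 4 * \<epsilon> + \<bar>h 1 - a 1\<bar>" if t: "0 \<le> t" "t \<le> 1" for t
  proof (cases "t = 1")
    case False
    then have "frac t = t" "\<lfloor>t\<rfloor> = 0" using t by (simp_all add: frac_eq floor_eq_iff)
    with a(2)[of t] show ?thesis by (simp add: H_def)
  qed (use order_trans[OF abs_ge_zero a(2)] in simp)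
  have "\<bar>h t - a t\<bar> \<le> 8 * \<epsilon> + \<bar>h 1 - a 1\<bar>" if t: "\<bar>t\<bar> \<le> 1" for t
  proof (cases "0 \<le> t")
    case True
    have "0 \<le> \<epsilon>" using order_trans[OF abs_ge_zero a(2)] by simp
    then show ?thesis using pos[of t] True t by simp
  next
    case False
    have "\<bar>h t + h (- t)\<bar> \<le> 4 * \<epsilon>" using swap[of t "- t" 0 0] t h0 by simp
    with pos[of "- t"] False t show ?thesis by (simp add: a_neg)
  qed
  with a(1) show ?thesis by blast
qed

lemma Jensen_admissible_ball:
  fixes X :: "'a::real_normed_vector set"
  assumes X: "subspace X" and adm: "affine_admissible (closed_unit_ball X) \<kappa>"
  shows "Jensen_admissible (closed_unit_ball X) (2 * \<kappa>)"
  unfolding Jensen_admissible_def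
proof (intro allI impI)
  define D where "D = closed_unit_ball X"
  fix \<epsilon> and f :: "'a \<Rightarrow> real"
  assume \<epsilon>: "0 \<le> \<epsilon>" and "eps_Jensen_on (closed_unit_ball X) \<epsilon> f"
  then have f: "\<bar>f (midpoint x y) - (f x + f y) / 2\<bar> \<le> \<epsilon>" if "x \<in> D" "y \<in> D" for x y
    using that by (simp add: eps_Jensen_on_def D_def)
  have D0: "0 \<in> D" unfolding D_def by (rule closed_unit_ball_0[OF X])
  have Dscale: "t *\<^sub>R x \<in> D" if "x \<in> D" "\<bar>t\<bar> \<le> 1" for t x
    unfolding D_def using closed_unit_ball_scaleR[OF X] that by (simp add: D_def)
  have Dmid: "midpoint x y \<in> D" if "x \<in> D" "y \<in> D" for x y
    using Jensen_midpoint[OF X] that by (simp add: D_def)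
  obtain B where B: "B \<subseteq> X" "independent B" "span B = X"
  proof -
    obtain B where B: "B \<subseteq> X" "independent B" "X \<subseteq> span B"
      using maximal_independent_subset[of X] by blast
    with span_subspace[OF B(1,3) X] that show ?thesis by blast
  qed
  have b0: "norm b > 0" "b \<in> X" if "b \<in> B" for b using B(1,2) that dependent_zero by auto
  have "\<exists>a. (\<forall>x y. a (x + y) = a x + a y) \<and>
      (\<exists>C. \<forall>t. \<bar>t\<bar> \<le> 1 \<longrightarrow> \<bar>(f (t *\<^sub>R sgn b) - f 0) - a t\<bar> \<le> C)" if "b \<in> B" for b
  proof (rule additive_approximation_on_interval)
    fix s t :: real assume st: "\<bar>s\<bar> \<le> 1" "\<bar>t\<bar> \<le> 1"
    have "sgn b \<in> D" using b0[OF that] X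
      by (simp add: D_def closed_unit_ball_def norm_sgn sgn_div_norm subspace_scale)
    with st have "s *\<^sub>R sgn b \<in> D" "t *\<^sub>R sgn b \<in> D" by (auto intro: Dscale)
    moreover have "midpoint (s *\<^sub>R sgn b) (t *\<^sub>R sgn b) = ((s + t) / 2) *\<^sub>R sgn b"
      by (simp add: midpoint_def flip: scaleR_add_left)
    ultimately show "\<bar>(f (((s + t) / 2) *\<^sub>R sgn b) - f 0) - ((f (s *\<^sub>R sgn b) - f 0) + (f (t *\<^sub>R sgn b) - f 0)) / 2\<bar> \<le> \<epsilon>"
      using f[of "s *\<^sub>R sgn b" "t *\<^sub>R sgn b"] by (simp add: field_simps)
  qed simp
  then obtain a where a_add: "\<And>b x y. b \<in> B \<Longrightarrow> a b (x + y) = a b x + a b y"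
    and a_near: "\<And>b. b \<in> B \<Longrightarrow> \<exists>C. \<forall>t. \<bar>t\<bar> \<le> 1 \<longrightarrow> \<bar>(f (t *\<^sub>R sgn b) - f 0) - a b t\<bar> \<le> C"
    by metis
  have a_0: "a b 0 = 0" if "b \<in> B" for b using a_add[OF that, of 0 0] by simp
  define T where "T x = {b. representation B x b \<noteq> 0}" for x
  \<comment> \<open>Additive on \<open>X\<close>, hence exactly Jensen, though not linear in
    general. The factor \<open>norm b\<close> converts a coordinate along \<open>b\<close> into one
    along \<open>sgn b\<close>, the direction in which \<open>a b\<close> was constructed.\<close>
  define g where "g x = (\<Sum>b\<in>T x. a b (norm b * representation B x b))" for x
  have T: "finite (T x)" "T x \<subseteq> B" for x
    unfolding T_def using representation_ne_zero by (auto simp: finite_representation)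
  have g_eq: "g x = (\<Sum>b\<in>U. a b (norm b * representation B x b))" if "finite U" "T x \<subseteq> U" "U \<subseteq> B" for x U
    unfolding g_def using that a_0 by (intro sum.mono_neutral_left) (auto simp: T_def)
  have g_add: "g (x + y) = g x + g y" if "x \<in> X" "y \<in> X" for x y
  proof -
    define U where "U = T x \<union> T y \<union> T (x + y)"
    have U: "finite U" "U \<subseteq> B" using T by (auto simp: U_def)
    have "g (x + y) = (\<Sum>b\<in>U. a b (norm b * representation B (x + y) b))"
      using U by (intro g_eq) (auto simp: U_def)
    also have "\<dots> = (\<Sum>b\<in>U. a b (norm b * representation B x b) + a b (norm b * representation B y b))"
      using B(2,3) that U(2) by (intro sum.cong) (auto simp: representation_add distrib_left a_add)
    also have "\<dots> = g x + g y"
      using g_eq[OF U(1) _ U(2), of x] g_eq[OF U(1) _ U(2), of y]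
      by (simp only: sum.distrib) (simp add: U_def le_supI1)
    finally show ?thesis .
  qed
  have g_mid: "g (midpoint x y) = (g x + g y) / 2" if "x \<in> D" "y \<in> D" for x y
  proof -
    have X': "x \<in> X" "y \<in> X" "midpoint x y \<in> X"
      using that Dmid[OF that] by (auto simp: D_def closed_unit_ball_def)
    have "g (midpoint x y) + g (midpoint x y) = g x + g y"
      using g_add[OF X'(3) X'(3)] g_add[OF X'(1,2)] by simp
    then show ?thesis by simp
  qed
  define F where "F x = f x - f 0 - g x" for x
  have g0: "g 0 = 0" using g_add[of 0 0] subspace_0[OF X] by simp
  have F: "\<bar>F (midpoint x y) - (F x + F y) / 2\<bar> \<le> \<epsilon>" if "x \<in> D" "y \<in> D" for x y
    using f[OF that] by (simp add: F_def g_mid[OF that] field_simps)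
  have F0: "F 0 = 0" by (simp add: F_def g0)
  have F_half: "\<bar>F x\<bar> \<le> 2 * \<bar>F ((1 / 2) *\<^sub>R x)\<bar> + 2 * \<epsilon>" if "x \<in> D" for x
  proof -
    have "\<bar>2 * F ((1 / 2) *\<^sub>R x) - F x\<bar> \<le> 2 * \<epsilon>"
      using F[OF that D0] by (simp add: midpoint_def F0 abs_le_iff field_simps)
    then show ?thesis by linarith
  qed
  \<comment> \<open>Radius and bound may depend on \<open>y\<close>. The vectors with this property
    form a subspace containing the basis, so no uniformity over the basis is required.\<close>
  define P where "P y \<longleftrightarrow> (\<exists>\<delta>>0. \<exists>M. \<forall>t. \<bar>t\<bar> \<le> \<delta> \<longrightarrow> t *\<^sub>R y \<in> D \<and> \<bar>F (t *\<^sub>R y)\<bar> \<le> M)" for y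
  have P: "P y" if "y \<in> X" for y
  proof -
    have "subspace {y. P y}"
    proof (rule subspaceI; simp)
      show "P 0" unfolding P_def by (auto simp: D0 F0 intro!: exI[of _ "1 :: real"])
    next
      fix y z assume "P y" "P z"
      then obtain \<delta> M \<delta>' M' where y: "\<delta> > 0" "\<And>t. \<bar>t\<bar> \<le> \<delta> \<Longrightarrow> t *\<^sub>R y \<in> D \<and> \<bar>F (t *\<^sub>R y)\<bar> \<le> M"
        and z: "\<delta>' > 0" "\<And>t. \<bar>t\<bar> \<le> \<delta>' \<Longrightarrow> t *\<^sub>R z \<in> D \<and> \<bar>F (t *\<^sub>R z)\<bar> \<le> M'"
        unfolding P_def by (elim exE conjE) blast
      show "P (y + z)"
        unfolding P_def
      proof (intro exI conjI allI impI)
        show "min \<delta> \<delta>' / 2 > 0" using y z by simp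
        fix t assume t: "\<bar>t\<bar> \<le> min \<delta> \<delta>' / 2"
        have eq: "midpoint ((2 * t) *\<^sub>R y) ((2 * t) *\<^sub>R z) = t *\<^sub>R (y + z)"
          by (simp add: midpoint_def scaleR_add_right)
        have yt: "(2 * t) *\<^sub>R y \<in> D \<and> \<bar>F ((2 * t) *\<^sub>R y)\<bar> \<le> M" by (rule y(2)) (use t in auto)
        have zt: "(2 * t) *\<^sub>R z \<in> D \<and> \<bar>F ((2 * t) *\<^sub>R z)\<bar> \<le> M'" by (rule z(2)) (use t in auto)
        show "t *\<^sub>R (y + z) \<in> D" using Dmid[of "(2 * t) *\<^sub>R y" "(2 * t) *\<^sub>R z"] yt zt by (simp add: eq)
        have "\<bar>F (t *\<^sub>R (y + z)) - (F ((2 * t) *\<^sub>R y) + F ((2 * t) *\<^sub>R z)) / 2\<bar> \<le> \<epsilon>"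
          using F[of "(2 * t) *\<^sub>R y" "(2 * t) *\<^sub>R z"] yt zt by (simp only: eq)
        with yt zt show "\<bar>F (t *\<^sub>R (y + z))\<bar> \<le> \<epsilon> + (M + M') / 2" by (auto simp: abs_le_iff field_simps)
      qed
    next
      fix c y assume "P y"
      then obtain \<delta> M where y: "\<delta> > 0" "\<And>t. \<bar>t\<bar> \<le> \<delta> \<Longrightarrow> t *\<^sub>R y \<in> D \<and> \<bar>F (t *\<^sub>R y)\<bar> \<le> M"
        unfolding P_def by (elim exE conjE) blast
      show "P (c *\<^sub>R y)"
        unfolding P_def
      proof (intro exI conjI allI impI)
        show "\<delta> / (\<bar>c\<bar> + 1) > 0" using y(1) by simp
        fix t assume "\<bar>t\<bar> \<le> \<delta> / (\<bar>c\<bar> + 1)"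
        then have "\<bar>t\<bar> * (\<bar>c\<bar> + 1) \<le> \<delta>" by (simp add: field_simps)
        then have "\<bar>t * c\<bar> \<le> \<delta>" by (simp add: abs_mult distrib_left)
        from y(2)[OF this] show "t *\<^sub>R c *\<^sub>R y \<in> D" "\<bar>F (t *\<^sub>R c *\<^sub>R y)\<bar> \<le> M" by simp_all
      qed
    qed
    moreover have "P b" if b: "b \<in> B" for b
    proof -
      obtain C where C: "\<And>t. \<bar>t\<bar> \<le> 1 \<Longrightarrow> \<bar>(f (t *\<^sub>R sgn b) - f 0) - a b t\<bar> \<le> C"
        using a_near[OF b] by blast
      show ?thesis
        unfolding P_def
      proof (intro exI conjI allI impI)
        show "1 / norm b > 0" using b0[OF b] by simp
        fix t assume "\<bar>t\<bar> \<le> 1 / norm b"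
        then have t: "\<bar>t * norm b\<bar> \<le> 1" using b0[OF b] by (simp add: abs_mult field_simps)
        have eq: "(t * norm b) *\<^sub>R sgn b = t *\<^sub>R b" using b0[OF b] by (simp add: sgn_div_norm)
        show "t *\<^sub>R b \<in> D"
          using t b0[OF b] X by (simp add: D_def closed_unit_ball_def subspace_scale abs_mult)
        have "representation B (t *\<^sub>R b) = (\<lambda>c. t * (if c = b then 1 else 0))"
          using B(2,3) b b0[OF b] by (simp add: representation_scale representation_basis)
        moreover from this have "T (t *\<^sub>R b) \<subseteq> {b}" by (auto simp: T_def split: if_splits)
        ultimately have "g (t *\<^sub>R b) = a b (t * norm b)"
          using g_eq[of "{b}" "t *\<^sub>R b"] b by (simp add: mult.commute)
        then show "\<bar>F (t *\<^sub>R b)\<bar> \<le> C" using C[OF t] by (simp add: F_def eq)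
      qed
    qed
    ultimately show ?thesis using that B(3) span_induct[of y B P] by simp
  qed
  have bounded: "\<exists>M. \<forall>t. \<bar>t\<bar> \<le> 1 \<longrightarrow> \<bar>F (t *\<^sub>R y)\<bar> \<le> M" if y: "y \<in> D" for y
  proof -
    obtain \<delta> M where \<delta>: "\<delta> > 0" "\<And>t. \<bar>t\<bar> \<le> \<delta> \<Longrightarrow> t *\<^sub>R y \<in> D \<and> \<bar>F (t *\<^sub>R y)\<bar> \<le> M"
      using P[of y] y unfolding P_def by (auto simp: D_def closed_unit_ball_def)
    \<comment> \<open>\<open>F_half\<close> doubles the interval on which \<open>F\<close> is
      bounded until it reaches from -1 to 1.\<close>
    have "\<exists>M. \<forall>t. \<bar>t\<bar> \<le> 1 \<and> \<bar>t\<bar> \<le> 2 ^ n * \<delta> \<longrightarrow> \<bar>F (t *\<^sub>R y)\<bar> \<le> M" for n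
    proof (induction n)
      case 0
      then show ?case using \<delta> by auto
    next
      case (Suc n)
      then obtain M where M: "\<And>t. \<bar>t\<bar> \<le> 1 \<Longrightarrow> \<bar>t\<bar> \<le> 2 ^ n * \<delta> \<Longrightarrow> \<bar>F (t *\<^sub>R y)\<bar> \<le> M" by blast
      have "\<bar>F (t *\<^sub>R y)\<bar> \<le> 2 * M + 2 * \<epsilon>" if "\<bar>t\<bar> \<le> 1" "\<bar>t\<bar> \<le> 2 ^ Suc n * \<delta>" for t
        using F_half[OF Dscale[OF y that(1)]] M[of "t / 2"] that by simp
      then show ?case by blast
    qed
    moreover obtain n where "1 / \<delta> < 2 ^ n" using real_arch_pow[of 2] by auto
    then have "1 \<le> 2 ^ n * \<delta>" using \<delta>(1) by (simp add: field_simps)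
    ultimately show ?thesis by (meson order_trans)
  qed
  have "eps_affine_on D (2 * \<epsilon>) F"
  proof (rule eps_affine_if_bounded[OF X D_def])
    show "eps_Jensen_on D \<epsilon> F" using F by (simp add: eps_Jensen_on_def)
    fix x y assume xy: "x \<in> D" "y \<in> D"
    obtain M where M: "\<And>t. \<bar>t\<bar> \<le> 1 \<Longrightarrow> \<bar>F (t *\<^sub>R x)\<bar> \<le> M" using bounded[OF xy(1)] by blast
    obtain M' where M': "\<And>t. \<bar>t\<bar> \<le> 1 \<Longrightarrow> \<bar>F (t *\<^sub>R y)\<bar> \<le> M'" using bounded[OF xy(2)] by blast
    have mid_bound: "\<bar>m\<bar> \<le> \<epsilon> + (c + d) / 2"
      if "\<bar>m - (p + q) / 2\<bar> \<le> \<epsilon>" "\<bar>p\<bar> \<le> c" "\<bar>q\<bar> \<le> d" for m p q c d :: real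
    proof -
      have "\<bar>(p + q) / 2\<bar> \<le> (c + d) / 2" using that abs_triangle_ineq[of p q] by simp
      with that(1) have "\<bar>m - (p + q) / 2\<bar> + \<bar>(p + q) / 2\<bar> \<le> \<epsilon> + (c + d) / 2" by (rule add_mono)
      moreover have "\<bar>m\<bar> \<le> \<bar>m - (p + q) / 2\<bar> + \<bar>(p + q) / 2\<bar>"
        using abs_triangle_ineq[of "m - (p + q) / 2" "(p + q) / 2"] by simp
      ultimately show ?thesis by (rule order_trans[rotated])
    qed
    define K where "K = \<epsilon> + (M + M') / 2"
    have "\<bar>F (t *\<^sub>R x + (1 - t) *\<^sub>R y)\<bar> \<le> 2 * K + 2 * \<epsilon>" if t: "t \<in> {0..1}" for t
    proof -
      \<comment> \<open>Half of \<open>u\<close> is a midpoint of two points on the lines through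
        \<open>x\<close> and \<open>y\<close>, where \<open>F\<close> is bounded;
        \<open>F_half\<close> returns to \<open>u\<close>.\<close>
      define u where "u = t *\<^sub>R x + (1 - t) *\<^sub>R y"
      have "u \<in> D"
        using convexD[OF convex_closed_unit_ball[OF X], of x y t "1 - t"] t xy by (simp add: D_def u_def)
      have tD: "t *\<^sub>R x \<in> D" "(1 - t) *\<^sub>R y \<in> D" using t xy by (auto intro!: Dscale)
      have "(1 / 2) *\<^sub>R u = midpoint (t *\<^sub>R x) ((1 - t) *\<^sub>R y)" by (simp add: u_def midpoint_def)
      then have "\<bar>F ((1 / 2) *\<^sub>R u)\<bar> \<le> K"
        unfolding K_def using mid_bound[OF F[OF tD] M[of t] M'[of "1 - t"]] t by simp
      with F_half[OF \<open>u \<in> D\<close>] show ?thesis unfolding u_def by linarith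
    qed
    then show "\<exists>M. \<forall>t\<in>{0..1}. \<bar>F (t *\<^sub>R x + (1 - t) *\<^sub>R y)\<bar> \<le> M" by blast
  qed
  then obtain k where k: "eps_affine_on D 0 k" "(SUP x\<in>D. ereal \<bar>F x - k x\<bar>) \<le> ereal (\<kappa> * (2 * \<epsilon>))"
    using adm \<epsilon> unfolding affine_admissible_def D_def by (metis mult_nonneg_nonneg zero_le_numeral)
  define G where "G x = f 0 + g x + k x" for x
  have "eps_Jensen_on D 0 G"
    unfolding eps_Jensen_on_def
  proof (intro ballI)
    fix x y assume xy: "x \<in> D" "y \<in> D"
    have "\<bar>k ((1 / 2) *\<^sub>R x + (1 - 1 / 2) *\<^sub>R y) - 1 / 2 * k x - (1 - 1 / 2) * k y\<bar> \<le> 0"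
      using xy by (intro k(1)[unfolded eps_affine_on_def, rule_format]) auto
    then have "k (midpoint x y) = (k x + k y) / 2"
      by (simp add: midpoint_def scaleR_add_right add_divide_distrib)
    then show "\<bar>G (midpoint x y) - (G x + G y) / 2\<bar> \<le> 0"
      by (simp add: G_def g_mid[OF xy] field_simps)
  qed
  moreover have "f x - G x = F x - k x" for x by (simp add: G_def F_def)
  then have "(SUP x\<in>D. ereal \<bar>f x - G x\<bar>) \<le> ereal (2 * \<kappa> * \<epsilon>)" using k(2) by (simp add: mult_ac)
  ultimately show "\<exists>g. eps_Jensen_on (closed_unit_ball X) 0 g \<and>
      (SUP x\<in>closed_unit_ball X. ereal \<bar>f x - g x\<bar>) \<le> ereal (2 * \<kappa> * \<epsilon>)"
    unfolding D_def by blast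
qed

section \<open>Banach--Mazur distance and conclusion\<close>

lemma linear_sum_inv_into:
  assumes T: "linear T" "bij_betw T E F" and E: "subspace E" and e: "\<And>i. i \<in> I \<Longrightarrow> e i \<in> F"
  shows "(\<Sum>i\<in>I. c i *\<^sub>R inv_into E T (e i)) \<in> E"
    and "T (\<Sum>i\<in>I. c i *\<^sub>R inv_into E T (e i)) = (\<Sum>i\<in>I. c i *\<^sub>R e i)"
proof -
  have im: "T ` E = F" using T(2) by (simp add: bij_betw_def)
  show "(\<Sum>i\<in>I. c i *\<^sub>R inv_into E T (e i)) \<in> E"
    using e im by (intro subspace_sum subspace_scale E inv_into_into) auto
  have "T (inv_into E T (e i)) = e i" if "i \<in> I" for i
    using e[OF that] im by (intro f_inv_into_f) auto
  then show "T (\<Sum>i\<in>I. c i *\<^sub>R inv_into E T (e i)) = (\<Sum>i\<in>I. c i *\<^sub>R e i)"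
    by (simp add: linear_sum[OF T(1)] linear_scale[OF T(1)])
qed

lemma linfty_n_eq_sum:
  assumes "y \<in> linfty_n m"
  shows "(\<Sum>i<m. apply_bcontfun y i *\<^sub>R ind {i}) = y"
proof (rule bcontfun_eqI)
  fix k
  have "apply_bcontfun (\<Sum>i<m. apply_bcontfun y i *\<^sub>R ind {i}) k = (\<Sum>i<m. if i = k then apply_bcontfun y i else 0)"
    unfolding sum_apply_bcontfun by (intro sum.cong) (auto simp: indicator_def)
  then show "apply_bcontfun (\<Sum>i<m. apply_bcontfun y i *\<^sub>R ind {i}) k = apply_bcontfun y k"
    using assms by (auto simp: linfty_n_def)
qed

lemma onorm_on_upper: "x \<in> E \<Longrightarrow> norm x \<le> 1 \<Longrightarrow> ereal (norm (T x)) \<le> onorm_on E T"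
  unfolding onorm_on_def by (rule SUP_upper) (simp add: closed_unit_ball_def)

text \<open>Since \<open>0 * \<infinity> = 0\<close> for extended reals, the product of the two norms only carries information if
  \<open>E\<close> is nontrivial, so that both factors are positive.\<close>

lemma banach_mazur_less_real:
  assumes less: "banach_mazur E F < ereal c" and E: "subspace E" "E \<noteq> {0}" and F: "subspace F"
  shows "\<exists>T a b. linear T \<and> bij_betw T E F \<and> 0 < a \<and> 0 < b \<and> a * b < c \<and>
    (\<forall>x\<in>E. norm x \<le> 1 \<longrightarrow> norm (T x) \<le> a) \<and> (\<forall>y\<in>F. norm y \<le> 1 \<longrightarrow> norm (inv_into E T y) \<le> b)"
proof -
  obtain T where T: "linear T" "bij_betw T E F"
    and prod: "onorm_on E T * onorm_on F (inv_into E T) < ereal c"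
    using less unfolding banach_mazur_def INF_less_iff by blast
  have im: "T ` E = F" and inj: "inj_on T E" using T(2) by (simp_all add: bij_betw_def)
  obtain x where x: "x \<in> E" "x \<noteq> 0" using E subspace_0[OF E(1)] by blast
  have x1: "sgn x \<in> E" "sgn x \<noteq> 0" "norm (sgn x) \<le> 1"
    using x E(1) by (simp_all add: sgn_div_norm subspace_scale)
  have Tx: "T (sgn x) \<noteq> 0"
    using inj x1 subspace_0[OF E(1)] linear_0[OF T(1)] by (metis inj_onD)
  have a0: "0 < onorm_on E T"
    using onorm_on_upper[OF x1(1,3), of T] Tx by (metis ereal_less(2) less_le_trans zero_less_norm_iff)
  define y where "y = sgn (T (sgn x))"
  have "T (sgn x) \<in> F" using x1(1) im by blast
  then have y: "y \<in> F" "y \<noteq> 0" "norm y \<le> 1"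
    using Tx F unfolding y_def by (simp_all add: sgn_div_norm subspace_scale)
  have "inv_into E T y \<noteq> 0"
    using y(1,2) im linear_0[OF T(1)] f_inv_into_f[of y T E] by auto
  then have b0: "0 < onorm_on F (inv_into E T)"
    using onorm_on_upper[OF y(1,3), of "inv_into E T"] by (metis ereal_less(2) less_le_trans zero_less_norm_iff)
  \<comment> \<open>Since the other factor is positive, an infinite norm would make the product
    infinite.\<close>
  obtain a where a: "onorm_on E T = ereal a" using a0 b0 prod by (cases "onorm_on E T") (auto split: if_splits)
  obtain b where b: "onorm_on F (inv_into E T) = ereal b"
    using a0 b0 prod a by (cases "onorm_on F (inv_into E T)") (auto split: if_splits)
  show ?thesis
  proof (intro exI conjI)
    show "linear T" "bij_betw T E F" by (fact T)+
    show "0 < a" "0 < b" "a * b < c" using a0 b0 prod by (simp_all add: a b)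
    show "\<forall>x\<in>E. norm x \<le> 1 \<longrightarrow> norm (T x) \<le> a" using onorm_on_upper[of _ E T] by (auto simp: a)
    show "\<forall>y\<in>F. norm y \<le> 1 \<longrightarrow> norm (inv_into E T y) \<le> b"
      using onorm_on_upper[of _ F "inv_into E T"] by (auto simp: b)
  qed
qed

text \<open>Pull the unit vectors of the cube back through \<open>T\<close> and divide by the bound
  \<open>b\<close> of the inverse: the zonotope then lies in the ball. The coordinates of
  \<open>2/3\<close> of a ball point are at most \<open>2/3 * b * a\<close>, and
  \<open>a * b < 3/2\<close>.\<close>

lemma Linfty1_affine_admissible:
  fixes X :: "'a::banach set"
  assumes L: "Linfty1_space X"
  shows "affine_admissible (closed_unit_ball X) (972 + 1)"
proof -
  have X: "subspace X" using L by (simp add: Linfty1_space_def)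
  show ?thesis
  proof (rule affine_admissible_ball[OF X refl])
    fix f :: "'a \<Rightarrow> real" and \<epsilon> :: real
    let ?D = "closed_unit_ball X"
    assume f: "0 \<le> \<epsilon>" "eps_affine_on ?D \<epsilon> f" "\<And>x. x \<in> ?D \<Longrightarrow> f (- x) = - f x"
    show "multi_affine_on ?D (972 * \<epsilon>) f"
      unfolding multi_affine_on_def
    proof (intro allI impI, elim conjE)
      fix S and u :: "'a \<Rightarrow> real"
      assume S: "finite S" "S \<subseteq> ?D" and u: "\<forall>x\<in>S. 0 \<le> u x" "sum u S = 1"
      have SX: "S \<subseteq> X" using S(2) by (auto simp: closed_unit_ball_def)
      have "fin_dim_subspace (span S)" "span S \<subseteq> X"
        using S(1) span_minimal[OF SX X] by (auto simp: fin_dim_subspace_def)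
      then obtain E where E: "fin_dim_subspace E" "E \<subseteq> X" "span S \<subseteq> E"
        and BM: "banach_mazur E (linfty_n (dim E)) \<le> ereal (1 + 1 / 4)"
        using L unfolding Linfty1_space_def by (metis zero_less_divide_1_iff zero_less_numeral)
      have subE: "subspace E" using E(1) by (auto simp: fin_dim_subspace_def)
      have SE: "S \<subseteq> E" using E(3) span_superset by blast
      define m where "m = dim E"
      show "\<bar>f (\<Sum>x\<in>S. u x *\<^sub>R x) - (\<Sum>x\<in>S. u x * f x)\<bar> \<le> 972 * \<epsilon>"
      proof (cases "E = {0}")
        case True
        show ?thesis
          by (rule zonotope_multi_affine[OF X refl f(2,3) S _ u(2), where I = "{} :: nat set"])
            (use u True SE closed_unit_ball_0[OF X] in auto)
      next
        case False
        \<comment> \<open>The gap between 5/4 and 3/2 provides an actual isomorphism even if the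
          infimum is not attained.\<close>
        have "banach_mazur E (linfty_n m) < ereal (3 / 2)"
          using BM unfolding m_def by (rule le_less_trans) simp
        then obtain T a b where T: "linear T" "bij_betw T E (linfty_n m)" and ab: "0 < a" "0 < b" "a * b < 3 / 2"
          and Ta: "\<And>x. x \<in> E \<Longrightarrow> norm x \<le> 1 \<Longrightarrow> norm (T x) \<le> a"
          and Tb: "\<And>y. y \<in> linfty_n m \<Longrightarrow> norm y \<le> 1 \<Longrightarrow> norm (inv_into E T y) \<le> b"
          using banach_mazur_less_real[OF _ subE False subspace_linfty_n] by metis
        have inj: "inj_on T E" and TE: "T x \<in> linfty_n m" if "x \<in> E" for x
          using T(2) that by (auto simp: bij_betw_def)
        define e where "e i = inv_into E T (ind {i})" for i
        have ind: "ind {i} \<in> linfty_n m" if "i \<in> {..<m}" for i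
          using that by (auto simp: linfty_n_def)
        have sum_E: "(\<Sum>i<m. c i *\<^sub>R e i) \<in> E"
          and T_sum: "T (\<Sum>i<m. c i *\<^sub>R e i) = (\<Sum>i<m. c i *\<^sub>R ind {i})" for c
          unfolding e_def by (rule linear_sum_inv_into[OF T subE ind]; assumption)+
        show ?thesis
        proof (rule zonotope_multi_affine[OF X refl f(2,3) S _ u(2), where I = "{..<m}"
              and v = "\<lambda>i. (1 / b) *\<^sub>R e i" and a = "\<lambda>x i. 2 / 3 * (b * apply_bcontfun (T x) i)"])
          show "finite {..<m}" by simp
        next
          fix x i assume x: "x \<in> S" and "i \<in> {..<m}"
          have "norm x \<le> 1" using x S(2) by (auto simp: closed_unit_ball_def)
          then have "\<bar>apply_bcontfun (T x) i\<bar> \<le> a"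
            using norm_bounded[of "T x" i] Ta[of x] SE x by auto
          then have "b * \<bar>apply_bcontfun (T x) i\<bar> \<le> b * a" using ab by (intro mult_left_mono) auto
          also have "\<dots> \<le> 3 / 2" using ab(3) by (simp add: mult.commute)
          finally show "\<bar>2 / 3 * (b * apply_bcontfun (T x) i)\<bar> \<le> 1" using ab(2) by (simp add: abs_mult)
        next
          fix x assume "x \<in> S"
          then have xE: "x \<in> E" using SE by blast
          have "T (\<Sum>i<m. apply_bcontfun (T x) i *\<^sub>R e i) = T x"
            unfolding T_sum by (rule linfty_n_eq_sum[OF TE[OF xE]])
          then have eq: "(\<Sum>i<m. apply_bcontfun (T x) i *\<^sub>R e i) = x"
            using inj[OF xE] sum_E xE by (meson inj_onD)
          have "(\<Sum>i<m. (2 / 3 * (b * apply_bcontfun (T x) i)) *\<^sub>R (1 / b) *\<^sub>R e i)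
              = (2 / 3) *\<^sub>R (\<Sum>i<m. apply_bcontfun (T x) i *\<^sub>R e i)"
            using ab unfolding scaleR_sum_right by (intro sum.cong) auto
          then show "(\<Sum>i<m. (2 / 3 * (b * apply_bcontfun (T x) i)) *\<^sub>R (1 / b) *\<^sub>R e i) = (2 / 3) *\<^sub>R x"
            by (simp only: eq)
        next
          fix c :: "nat \<Rightarrow> real" assume c: "\<And>i. i \<in> {..<m} \<Longrightarrow> \<bar>c i\<bar> \<le> 1"
          define y where "y = (\<Sum>i<m. c i *\<^sub>R ind {i})"
          define z where "z = (\<Sum>i<m. c i *\<^sub>R e i)"
          have zE: "z \<in> E" and Tz: "T z = y" unfolding z_def y_def by (rule sum_E T_sum)+
          have yk: "apply_bcontfun y k = (if k < m then c k else 0)" for k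
          proof -
            have "apply_bcontfun y k = (\<Sum>i<m. if i = k then c i else 0)"
              unfolding y_def sum_apply_bcontfun by (intro sum.cong) (auto simp: indicator_def)
            then show ?thesis by simp
          qed
          have "norm y \<le> 1" by (rule norm_bound) (use c yk in auto)
          moreover have "inv_into E T y = z" using inj[OF zE] zE Tz by (metis inv_into_f_f)
          moreover have "y \<in> linfty_n m" by (simp add: linfty_n_def yk)
          ultimately have "norm z \<le> b" using Tb by blast
          moreover have "(\<Sum>i<m. c i *\<^sub>R (1 / b) *\<^sub>R e i) = (1 / b) *\<^sub>R z"
            unfolding z_def scaleR_sum_right by (intro sum.cong) auto
          ultimately show "(\<Sum>i<m. c i *\<^sub>R (1 / b) *\<^sub>R e i) \<in> ?D"
            using ab zE E(2) X by (auto simp: closed_unit_ball_def subspace_scale)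
        qed (use u in auto)
      qed
    qed
  qed
qed

lemma ball_constants_le:
  assumes "subspace X" "affine_admissible (closed_unit_ball X) \<kappa>" "\<kappa> \<le> c"
  shows "affine_const (closed_unit_ball X) \<le> ereal c \<and> Jensen_const (closed_unit_ball X) \<le> ereal (2 * c)"
proof
  show "affine_const (closed_unit_ball X) \<le> ereal c"
    using affine_const_le[OF assms(2)] assms(3) by (simp add: order_trans)
  show "Jensen_const (closed_unit_ball X) \<le> ereal (2 * c)"
    by (rule order_trans[OF Jensen_const_le[OF Jensen_admissible_ball[OF assms(1,2)]]])
      (use assms(3) in simp)
qed

theorem corollary1:
  shows "((\<forall>n. affine_const (closed_unit_ball (linfty_n n)) \<le> 6 * 200 + 2 \<and>
               Jensen_const (closed_unit_ball (linfty_n n)) \<le> 2 * (6 * 200 + 2)) \<and>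
          (affine_const (closed_unit_ball c_zero) \<le> 6 * 200 + 2 \<and>
           Jensen_const (closed_unit_ball c_zero) \<le> 2 * (6 * 200 + 2)) \<and>
          (affine_const (closed_unit_ball (UNIV :: linfty set)) \<le> 6 * 200 + 2 \<and>
           Jensen_const (closed_unit_ball (UNIV :: linfty set)) \<le> 2 * (6 * 200 + 2)) \<and>
          (\<forall>X :: 'a::banach set. Linfty1_space X \<longrightarrow>
             affine_const (closed_unit_ball X) \<le> 6 * 200 + 2 \<and>
             Jensen_const (closed_unit_ball X) \<le> 2 * (6 * 200 + 2)))
       \<and> (affine_const (closed_unit_ball (UNIV :: 'h::{real_inner, complete_space} set)) \<le> 6 * 37 + 2 \<and>
          Jensen_const (closed_unit_ball (UNIV :: 'h set)) \<le> 2 * (6 * 37 + 2))"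
proof -
  \<comment> \<open>The affine constants obtained are 973 and 83, within the required 1202 and 224;
    the Jensen constants are at most twice as large.\<close>
  have eq: "6 * 200 + 2 = ereal 1202" "2 * ereal 1202 = ereal (2 * 1202)"
    "6 * 37 + 2 = ereal 224" "2 * ereal 224 = ereal (2 * 224)" by simp_all
  note linfty_n = ball_constants_le[OF subspace_linfty_n linfty_n_affine_admissible, of 1202]
  note c_zero = ball_constants_le[OF subspace_c_zero c_zero_affine_admissible, of 1202]
  note linfty = ball_constants_le[OF subspace_UNIV linfty_UNIV_affine_admissible, of 1202]
  note Hilbert = ball_constants_le[OF subspace_UNIV Hilbert_affine_admissible, of 224]
  have Linfty1: "affine_const (closed_unit_ball X) \<le> ereal 1202 \<and> Jensen_const (closed_unit_ball X) \<le> ereal (2 * 1202)"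
    if "Linfty1_space X" for X :: "'a set"
    using that by (intro ball_constants_le[OF _ Linfty1_affine_admissible]) (simp_all add: Linfty1_space_def)
  show ?thesis
    unfolding eq using linfty_n c_zero linfty Linfty1 Hilbert by simp
qed

end
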